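(* Let $T>0$, $n\ge1$, and let $u_1,u_2:(0,T)\times\mathbb{R}^n\to\mathbb{R}$ be upper semicontinuous. Assume that each $u_i$ has a finite extension to $(0,T]\times\mathbb{R}^n$ via its semicontinuous envelope, that is, for $i=1,2$ and all $x\in\mathbb{R}^n$ the quantity $$u_i(T,x)=\limsup_{\substack{(t,y)\in(0,T)\times\mathbb{R}^n\\ t\uparrow T,\ y\to x}}u_i(t,y)$$ is finite. Define $w(t,x)=u_1(t,x_1)+u_2(t,x_2)$ for $t\in(0,T]$, $x=(x_1,x_2)\in\mathbb{R}^n\times\mathbb{R}^n=\mathbb{R}^{2n}$. Suppose that $z=(z_1,z_2)\in\mathbb{R}^{2n}$, $b\in\mathbb{R}$, $p=(p_1,p_2)\in\mathbb{R}^{2n}$, $A\in\mathcal{S}^{2n}$ satisfy $$(b,p,A)\in\mathcal{P}_Q^{2,+}w(T,z).$$ Assume moreover that there is an $r>0$ such that for every $M>0$ there is a $C$ such that for $i=1,2$: $b_i\le C$ whenever $(b_i,q_i,X_i)\in\mathcal{P}^{2,+}u_i(t,x_i)$, $|x_i-z_i|+|T-t|<r$ and $|u_i(t,x_i)|+|q_i|+\|X_i\|\le M$ (here $t\in(0,T)$, $x_i\in\mathbb{R}^n$). Then for each $\varepsilon>0$ there exist $(b_i,X_i)\in\mathbb{R}\times\mathcal{S}^n$, $i=1,2$, such that $$(b_i,p_i,X_i)\in\bar{\mathcal{P}}_Q^{2,+}u_i(T,z_i),\qquad i=1,2,$$ and $$-\left(\frac1\varepsilon+\|A\|\right)I\le\begin{pmatrix}X_1&0\\0&X_2\end{pmatrix}\le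 A+\varepsilon A^2\quad\text{and}\quad b_1+b_2\ge b .$$
   Context: $\mathcal{S}^d$ is the space of real symmetric $d\times d$ matrices with its usual partial order, $\|\cdot\|$ is the operator norm, and $I$ is the identity matrix. Parabolic semijets: for $u:(0,T)\times\mathbb{R}^d\to\mathbb{R}$ and $(s,z)\in(0,T)\times\mathbb{R}^d$, $\mathcal{P}^{2,+}u(s,z)$ is the set of $(b,p,X)\in\mathbb{R}\times\mathbb{R}^d\times\mathcal{S}^d$ such that $$u(t,x)\le u(s,z)+b(t-s)+\langle p,x-z\rangle+\tfrac12\langle X(x-z),x-z\rangle+o\left(|t-s|+|x-z|^2\right)$$ as $(0,T)\times\mathbb{R}^d\ni(t,x)\to(s,z)$. For $Q=(0,T]\times\mathbb{R}^d$ (with $d=n$ for the $u_i$ and $d=2n$ for $w$), $u:Q\to\mathbb{R}$ and $(s,z)\in Q$, the semijet relative to $Q$, $\mathcal{P}_Q^{2,+}u(s,z)$, is the set of $(b,p,X)\in\mathbb{R}\times\mathbb{R}^d\times\mathcal{S}^d$ such that the same inequality holds as $Q\ni(t,x)\to(s,z)$. Its closure: $(b,p,X)\in\bar{\mathcal{P}}_Q^{2,+}u(T,z)$ iff there exist $(t_k,z_k;b_k,p_k,X_k)\in Q\times\mathbb{R}\times\mathbb{R}^d\times\mathcal{S}^d$ with $(b_k,p_k,X_k)\in\mathcal{P}_Q^{2,+}u(t_k,z_k)$ and $(t_k,z_k;u(t_k,z_k);b_k,p_k,X_k)\to(T,z;u(T,z);b,p,X)$. *)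

theory Defs
  imports "HOL-Analysis.Analysis" "HOL-Library.Landau_Symbols"
begin

definition usc_on :: "'a::topological_space set \<Rightarrow> ('a \<Rightarrow> real) \<Rightarrow> bool" where
  "usc_on S u \<longleftrightarrow> (\<forall>a\<in>S. Limsup (at a within S) (\<lambda>y. ereal (u y)) \<le> ereal (u a))"

abbreviation open_strip :: "real \<Rightarrow> (real \<times> (real ^ 'd)) set" where
  "open_strip T \<equiv> {0<..<T} \<times> UNIV"

abbreviation closed_strip :: "real \<Rightarrow> (real \<times> (real ^ 'd)) set" where
  "closed_strip T \<equiv> {0<..T} \<times> UNIV"

text \<open>Functions on a strip are total functions on pairs (time, space); their values outside the
  strip are irrelevant. In particular the value of \<open>u\<close> at time \<open>T\<close> is never used
  in the limit superior below, and is replaced by that limit in the extension.\<close>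

definition terminal_limsup :: "real \<Rightarrow> (real \<times> (real ^ 'd) \<Rightarrow> real) \<Rightarrow> real ^ 'd \<Rightarrow> ereal" where
  "terminal_limsup T u x = Limsup (at (T, x) within open_strip T) (\<lambda>q. ereal (u q))"

definition terminal_ext ::
    "real \<Rightarrow> (real \<times> (real ^ 'd) \<Rightarrow> real) \<Rightarrow> real \<times> (real ^ 'd) \<Rightarrow> real" where
  "terminal_ext T u =
     (\<lambda>(t, x). if t = T then real_of_ereal (terminal_limsup T u x) else u (t, x))"

definition sym_matrix :: "real ^ 'd ^ 'd \<Rightarrow> bool" where
  "sym_matrix X \<longleftrightarrow> transpose X = X"

definition loewner_le :: "real ^ 'd ^ 'd \<Rightarrow> real ^ 'd ^ 'd \<Rightarrow> bool" (infix \<open>\<preceq>\<close> 50) where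
  "X \<preceq> Y \<longleftrightarrow> (\<forall>\<xi>. (X *v \<xi>) \<bullet> \<xi> \<le> (Y *v \<xi>) \<bullet> \<xi>)"

abbreviation opnorm :: "real ^ 'd ^ 'd \<Rightarrow> real" where
  "opnorm X \<equiv> onorm ((*v) X)"

text \<open>The second-order parabolic superjet of \<open>u\<close> at \<open>(s, z)\<close> relative to \<open>S\<close>;
  meant for \<open>(s, z) \<in> S\<close>. The set \<open>S\<close> is the open strip for the unrestricted jet and
  the strip including the terminal time for the relative one.\<close>

definition superjet ::
    "(real \<times> (real ^ 'd)) set \<Rightarrow> (real \<times> (real ^ 'd) \<Rightarrow> real) \<Rightarrow> real \<times> (real ^ 'd)
      \<Rightarrow> (real \<times> (real ^ 'd) \<times> (real ^ 'd ^ 'd)) set" where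
  "superjet S u = (\<lambda>(s, z). {(b, p, X). sym_matrix X \<and>
     (\<exists>\<rho> \<in> o[at (s, z) within S](\<lambda>(t, x). \<bar>t - s\<bar> + (norm (x - z))\<^sup>2).
        \<forall>\<^sub>F (t, x) in at (s, z) within S.
          u (t, x) \<le> u (s, z) + b * (t - s) + p \<bullet> (x - z)
            + 1/2 * ((X *v (x - z)) \<bullet> (x - z)) + \<rho> (t, x))})"

definition superjet_closure ::
    "(real \<times> (real ^ 'd)) set \<Rightarrow> (real \<times> (real ^ 'd) \<Rightarrow> real) \<Rightarrow> real \<times> (real ^ 'd)
      \<Rightarrow> (real \<times> (real ^ 'd) \<times> (real ^ 'd ^ 'd)) set" where
  "superjet_closure S u = (\<lambda>(s, z). {(b, p, X). sym_matrix X \<and>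
     (\<exists>t' z' b' p' X'.
        (\<forall>k::nat. (t' k, z' k) \<in> S \<and> (b' k, p' k, X' k) \<in> superjet S u (t' k, z' k)) \<and>
        (\<lambda>k. (t' k, z' k, u (t' k, z' k), b' k, p' k, X' k))
          \<longlonglongrightarrow> (s, z, u (s, z), b, p, X))})"

text \<open>Vectors of dimension \<open>2n\<close> are indexed by \<open>'n + 'n\<close>: the components indexed by
  \<open>Inl i\<close> form the first half, those indexed by \<open>Inr i\<close> the second.\<close>

definition vfst :: "real ^ ('n + 'n) \<Rightarrow> real ^ 'n" where
  "vfst x = (\<chi> i. x $ Inl i)"

definition vsnd :: "real ^ ('n + 'n) \<Rightarrow> real ^ 'n" where
  "vsnd x = (\<chi> i. x $ Inr i)"

definition block_diag ::
    "real ^ 'n ^ 'n \<Rightarrow> real ^ 'n ^ 'n \<Rightarrow> real ^ ('n + 'n) ^ ('n + 'n)" where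
  "block_diag X Y = (\<chi> i j. case (i, j) of
       (Inl k, Inl l) \<Rightarrow> X $ k $ l
     | (Inr k, Inr l) \<Rightarrow> Y $ k $ l
     | _ \<Rightarrow> 0)"

end

theory Submission
  imports Defs
begin

text \<open>
Why the theorem is true. Subtracting small multiples of \<open>T - t\<close> and \<open>|x - z|\<^sup>2\<close>, one may assume
that \<open>w\<close> minus its test function has a strict local maximum at \<open>(T, z)\<close>. It suffices to find, for
every \<open>\<kappa> > 0\<close>, jets of \<open>u\<^sub>1\<close> and \<open>u\<^sub>2\<close> at times before \<open>T\<close> that satisfy the claim up to \<open>\<kappa>\<close>
(lemma \<open>parabolic_theorem_on_sums_approx\<close>). The matrices stay bounded by the two matrix
inequalities. The time derivatives are bounded above by the hypothesis on the \<open>u\<^sub>i\<close>, hence also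
below because \<open>b\<^sub>1 + b\<^sub>2 \<ge> b - \<kappa>\<close>. So a subsequence converges, and its limit is the required pair.

The approximate jets come from doubling the time variable. The terminal values of \<open>u\<^sub>1\<close> and \<open>u\<^sub>2\<close>
are limits superior along unrelated times, so one maximizes \<open>u\<^sub>1 (t, x\<^sub>1) + u\<^sub>2 (s, x\<^sub>2)\<close> minus the
test function minus \<open>(t - s)\<^sup>2 / (2 \<delta>)\<close>, with barriers \<open>\<eta> / (T - t)\<close> and \<open>\<eta> / (T - s)\<close> that keep
the maximum before time \<open>T\<close>. At this maximum the elliptic theorem on sums in the space-time
variables applies (lemma \<open>theorem_on_sums_approx\<close>); superjets in space-time project to parabolic
jets (lemma \<open>parabolic_jet_of_rescaled_superjet\<close>). The barrier raises the time derivatives, which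
is the harmless direction.

The theorem on sums rests on sup-convolution. The inequality
\<open>\<langle>A x, x\<rangle> \<le> \<langle>(A + \<epsilon> A\<^sup>2) y, y\<rangle> + (1/\<epsilon> + \<parallel>A\<parallel>) |x - y|\<^sup>2\<close> turns the maximum of a sum of upper
semicontinuous functions into a contact of the sum of their sup-convolutions, which are convex up
to a quadratic term, with a quadratic form. The set of points at which slightly tilted forms touch
has positive measure (\<open>jensen_contact_set_not_negligible\<close>), and almost every such point admits
second order expansions (\<open>alexandrov_where_touched_above\<close>). At such a point the Hessians are
ordered, and the superjets pass from the sup-convolutions to the original functions.

Alexandrov's theorem is obtained from Rademacher's theorem for the resolvent of the
subdifferential, which is nonexpansive. Rademacher's theorem in turn is reduced to monotone
functions of one real variable, for which a Vitali covering argument shows that difference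
quotients do not oscillate; linearity of the directional derivative is checked by integrating
over boxes.
\<close>

section \<open>Difference quotients of monotone functions\<close>

text \<open>The set is written with the scales \<open>1 / Suc n\<close> so that it is a countable intersection of
open sets when \<open>f\<close> is continuous. A point of a Lipschitz function where the derivative
along \<open>v\<close> fails to exist lies in one of these sets with rational \<open>a < b\<close>.\<close>

definition oscillating :: "('a::euclidean_space \<Rightarrow> real) \<Rightarrow> 'a \<Rightarrow> real \<Rightarrow> real \<Rightarrow> 'a set" where
  "oscillating f v a b = {x. \<forall>n::nat.
     (\<exists>s. 0 < \<bar>s\<bar> \<and> \<bar>s\<bar> < 1 / Suc n \<and> (f (x + s *\<^sub>R v) - f x) / s < a) \<and>
     (\<exists>s. 0 < \<bar>s\<bar> \<and> \<bar>s\<bar> < 1 / Suc n \<and> (f (x + s *\<^sub>R v) - f x) / s > b)}"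

text \<open>The sign \<open>\<sigma>\<close> treats slopes below and above \<open>a\<close> at once. The interval between
\<open>x\<close> and \<open>x + s\<close> has \<open>x\<close> on its boundary; continuity of \<open>F\<close> allows it
to be enlarged slightly without losing the strict slope condition, so that the Vitali covering
theorem applies with open balls and no endpoints have to be discarded.\<close>

lemma Vitali_monotone_slope:
  fixes F :: "real \<Rightarrow> real"
  assumes cont: "continuous_on UNIV F" and U: "open U" "E \<subseteq> U"
    and E: "\<And>x d. x \<in> E \<Longrightarrow> d > 0 \<Longrightarrow> \<exists>s. 0 < \<bar>s\<bar> \<and> \<bar>s\<bar> < d \<and> \<sigma> * ((F (x + s) - F x) / s - a) > 0"
  obtains C where "countable C" "disjoint_family_on (\<lambda>(c,r). ball c r) C"
    "\<And>c r. (c,r) \<in> C \<Longrightarrow> r > 0 \<and> ball c r \<subseteq> U \<and> \<sigma> * (F (c + r) - F (c - r) - a * (2 * r)) > 0"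
    "negligible (E - (\<Union>(c,r)\<in>C. ball c r))"
proof -
  define K where "K = {(c,r). r > 0 \<and> ball c r \<subseteq> U \<and> \<sigma> * (F (c + r) - F (c - r) - a * (2 * r)) > 0}"
  have *: "\<exists>i. i \<in> K \<and> x \<in> ball (fst i) (snd i) \<and> snd i < d" if x: "x \<in> E" and d: "d > 0" for x d
  proof -
    obtain e where e: "e > 0" "ball x e \<subseteq> U"
      using U x by (meson openE subsetD)
    define d' where "d' = min d e / 2"
    have d': "d' > 0" "d' \<le> d/2" "d' \<le> e/2" using d e by (auto simp: d'_def)
    obtain s where s: "0 < \<bar>s\<bar>" "\<bar>s\<bar> < d'" "\<sigma> * ((F (x + s) - F x) / s - a) > 0"
      using E[OF x d'(1)] by blast
    define c where "c = x + s/2"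
    define h where "h = (\<lambda>r. \<sigma> * (F (c + r) - F (c - r) - a * (2 * r)))"
    define P where "P = F (x + s) - F x"
    have "h (\<bar>s\<bar>/2) = \<bar>s\<bar> * (\<sigma> * (P / s - a))"
    proof (cases "s > 0")
      case True
      then have *: "c + \<bar>s\<bar>/2 = x + s" "c - \<bar>s\<bar>/2 = x" by (auto simp: c_def)
      have "h (\<bar>s\<bar>/2) = \<sigma> * (P - a * s)" unfolding h_def * P_def using True by simp
      moreover have "P - a * s = \<bar>s\<bar> * (P / s - a)" using True by (simp add: field_simps)
      ultimately show ?thesis by (metis mult.left_commute)
    next
      case False
      then have "s < 0" using s by simp
      then have *: "c + \<bar>s\<bar>/2 = x" "c - \<bar>s\<bar>/2 = x + s" by (auto simp: c_def)
      have "h (\<bar>s\<bar>/2) = \<sigma> * (- P + a * s)" unfolding h_def * P_def using \<open>s < 0\<close> by simp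
      moreover have "- P + a * s = \<bar>s\<bar> * (P / s - a)" using \<open>s < 0\<close> by (simp add: field_simps)
      ultimately show ?thesis by (metis mult.left_commute)
    qed
    then have h0: "h (\<bar>s\<bar>/2) > 0" using s by (simp add: P_def)
    have "continuous_on UNIV h" unfolding h_def
      by (intro continuous_intros continuous_on_compose2[OF cont]) auto
    then have "isCont h (\<bar>s\<bar>/2)" by (simp add: continuous_on_eq_continuous_at)
    then have "eventually (\<lambda>r. h r > 0) (at (\<bar>s\<bar>/2))"
      using h0 by (simp add: isCont_def order_tendstoD)
    then obtain q where q: "q > 0" "\<And>r. r \<noteq> \<bar>s\<bar>/2 \<Longrightarrow> dist r (\<bar>s\<bar>/2) < q \<Longrightarrow> h r > 0"
      by (auto simp: eventually_at)
    define r where "r = \<bar>s\<bar>/2 + min (q/2) (d'/2)"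
    have r: "r > \<bar>s\<bar>/2" "r < d'" "h r > 0"
      using q d' s by (auto simp: r_def dist_real_def min_def)
    have xb: "x \<in> ball c r" using r by (simp add: c_def dist_real_def)
    have "ball c r \<subseteq> ball x e"
    proof
      fix y assume "y \<in> ball c r"
      then have "\<bar>c - y\<bar> < d'" using r by (auto simp: dist_real_def)
      then have "\<bar>x - y\<bar> < e" using s d' unfolding c_def by (smt (verit) field_sum_of_halves)
      then show "y \<in> ball x e" by (simp add: dist_real_def)
    qed
    then have "(c,r) \<in> K" using r s e by (auto simp: K_def h_def)
    then show ?thesis using xb r d' d by (intro exI[of _ "(c,r)"]) auto
  qed
  obtain C where C: "countable C" "C \<subseteq> K"
    "pairwise (\<lambda>i j. disjnt (ball (fst i) (snd i)) (ball (fst j) (snd j))) C"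
    "negligible (E - (\<Union>i \<in> C. ball (fst i) (snd i)))"
    by (rule Vitali_covering_theorem_balls[OF *]) blast+
  show thesis
  proof
    show "disjoint_family_on (\<lambda>(c,r). ball c r) C"
      using C(3) by (auto simp: disjoint_family_on_def pairwise_def disjnt_def case_prod_unfold)
    show "negligible (E - (\<Union>(c,r)\<in>C. ball c r))" using C(4) by (simp add: case_prod_unfold)
  qed (use C in \<open>auto simp: K_def\<close>)
qed

lemma emeasure_interval_measure_ball:
  fixes F :: "real \<Rightarrow> real"
  assumes "r > 0" "mono F" "continuous_on UNIV F"
  shows "emeasure (interval_measure F) (ball c r) = ennreal (F (c + r) - F (c - r))"
proof -
  have m: "\<And>x y. x \<le> y \<Longrightarrow> F x \<le> F y" using assms by (simp add: mono_def)
  have p: "emeasure (interval_measure F) {a..a} = 0" for a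
    using emeasure_interval_measure_Icc[of a a F] m assms by auto
  have eq: "{c-r..c+r} = ball c r \<union> {c-r..c-r} \<union> {c+r..c+r}" using assms
    by (auto simp: dist_real_def)
  have "emeasure (interval_measure F) {c-r..c+r} = emeasure (interval_measure F) (ball c r)"
    unfolding eq using p by (simp only: emeasure_Un_null_set null_setsI sets_interval_measure borel_closed borel_open open_ball
          closed_atLeastAtMost sets.Un)
  then show ?thesis using emeasure_interval_measure_Icc[of "c-r" "c+r" F] m assms by auto
qed

lemma oscillating_in_borel:
  fixes f :: "'a::euclidean_space \<Rightarrow> real"
  assumes "continuous_on UNIV f"
  shows "oscillating f v a b \<in> sets borel"
proof -
  have c: "continuous_on UNIV (\<lambda>x. (f (x + s *\<^sub>R v) - f x) / s)" for s
    unfolding divide_inverse by (intro continuous_intros continuous_on_compose2[OF assms]) (use assms in auto)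
  have o1: "open {x. \<exists>s. 0 < \<bar>s\<bar> \<and> \<bar>s\<bar> < 1 / Suc n \<and> (f (x + s *\<^sub>R v) - f x) / s < a}" for n
  proof -
    have "{x. \<exists>s. 0 < \<bar>s\<bar> \<and> \<bar>s\<bar> < 1 / Suc n \<and> (f (x + s *\<^sub>R v) - f x) / s < a}
      = (\<Union>s\<in>{s. 0 < \<bar>s\<bar> \<and> \<bar>s\<bar> < 1 / Suc n}. {x. (f (x + s *\<^sub>R v) - f x) / s < a})" by auto
    also have "open \<dots>" using c by (intro open_UN ballI open_Collect_less) auto
    finally show ?thesis .
  qed
  have o2: "open {x. \<exists>s. 0 < \<bar>s\<bar> \<and> \<bar>s\<bar> < 1 / Suc n \<and> (f (x + s *\<^sub>R v) - f x) / s > b}" for n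
  proof -
    have "{x. \<exists>s. 0 < \<bar>s\<bar> \<and> \<bar>s\<bar> < 1 / Suc n \<and> (f (x + s *\<^sub>R v) - f x) / s > b}
      = (\<Union>s\<in>{s. 0 < \<bar>s\<bar> \<and> \<bar>s\<bar> < 1 / Suc n}. {x. (f (x + s *\<^sub>R v) - f x) / s > b})" by auto
    also have "open \<dots>" using c by (intro open_UN ballI open_Collect_less) auto
    finally show ?thesis .
  qed
  have "oscillating f v a b = (\<Inter>n. {x. \<exists>s. 0 < \<bar>s\<bar> \<and> \<bar>s\<bar> < 1 / Suc n \<and> (f (x + s *\<^sub>R v) - f x) / s < a}
     \<inter> {x. \<exists>s. 0 < \<bar>s\<bar> \<and> \<bar>s\<bar> < 1 / Suc n \<and> (f (x + s *\<^sub>R v) - f x) / s > b})"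
    unfolding oscillating_def by blast
  also have "\<dots> \<in> sets borel"
    using o1 o2 by (intro sets.countable_INT) (auto intro!: borel_open open_Int)
  finally show ?thesis .
qed

text \<open>The classical two step Vitali argument. Cover almost all of a bounded piece \<open>E\<close> of the set by
disjoint balls \<open>V\<close> of slope below \<open>a\<close> inside an open set of measure almost that of
\<open>E\<close>, then cover almost all of \<open>E \<inter> V\<close> by disjoint balls \<open>W \<subseteq> V\<close> of
slope above \<open>b\<close>. With \<open>\<nu>\<close> the Stieltjes measure of \<open>F\<close>, this gives
\<open>b |E| \<le> \<nu> W \<le> \<nu> V \<le> a |V|\<close>, which is compatible with \<open>a < b\<close> only
if \<open>E\<close> is null.\<close>

lemma monotone_oscillation_negligible:
  fixes F :: "real \<Rightarrow> real"
  assumes mono: "mono F" and cont: "continuous_on UNIV F" and "a < b"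
  shows "negligible (oscillating F 1 a b)"
proof -
  define E where "E = (\<lambda>n::nat. oscillating F 1 a b \<inter> ball 0 (real n))"
  let ?\<nu> = "interval_measure F"
  have small: "\<exists>s. 0 < \<bar>s\<bar> \<and> \<bar>s\<bar> < d \<and> (F (x + s) - F x) / s < a"
              "\<exists>s. 0 < \<bar>s\<bar> \<and> \<bar>s\<bar> < d \<and> (F (x + s) - F x) / s > b"
    if x: "x \<in> oscillating F 1 a b" and d: "d > 0" for x d
  proof -
    obtain n::nat where n: "1 / Suc n < d" using nat_approx_posE[OF d] by blast
    show "\<exists>s. 0 < \<bar>s\<bar> \<and> \<bar>s\<bar> < d \<and> (F (x + s) - F x) / s < a"
         "\<exists>s. 0 < \<bar>s\<bar> \<and> \<bar>s\<bar> < d \<and> (F (x + s) - F x) / s > b"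
      using x n unfolding oscillating_def by (simp, meson order_less_trans)+
  qed
  have slope_nonneg: "(F (x + s) - F x) / s \<ge> 0" for x s
  proof (cases "s \<ge> 0")
    case True
    then show ?thesis using monoD[OF mono, of x "x+s"] by auto
  next
    case False
    then show ?thesis using monoD[OF mono, of "x+s" x] by (auto simp: divide_nonpos_neg)
  qed
  have neg: "negligible (E n)" for n
  proof (cases "E n = {}")
    case False
    then have a: "a > 0" using small(1)[of _ 1] slope_nonneg unfolding E_def
      by (metis IntD1 all_not_in_conv less_le_trans not_less zero_less_one)
    have b: "b > 0" using a \<open>a < b\<close> by simp
    have Eb[measurable]: "E n \<in> sets borel" unfolding E_def using oscillating_in_borel[OF cont] by auto
    have Efin: "emeasure lborel (E n) < \<infinity>"
    proof -
      have "emeasure lborel (E n) \<le> emeasure lborel (ball (0::real) (real n))"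
        unfolding E_def by (intro emeasure_mono) auto
      also have "\<dots> < \<infinity>" using emeasure_lborel_ball_finite[of 0 "real n"] by (simp add: less_top)
      finally show ?thesis .
    qed
    have key: "ennreal b * emeasure lborel (E n) \<le> ennreal a * (emeasure lborel (E n) + ennreal e)" if e: "e > 0" for e
    proof -
      obtain U where U: "open U" "E n \<subseteq> U" "(U - E n) \<in> lmeasurable" "emeasure lebesgue (U - E n) < ennreal e"
        using sets_lebesgue_outer_open[of "E n" e] e Eb by auto
      have "emeasure lborel U = emeasure lborel (E n) + emeasure lborel (U - E n)"
        using U(1,2) Eb by (subst plus_emeasure) (auto simp: Un_absorb1)
      also have "emeasure lborel (U - E n) \<le> ennreal e" using U(1,4) Eb
        by (simp add: emeasure_completion order.strict_implies_order)
      finally have mU: "emeasure lborel U \<le> emeasure lborel (E n) + ennreal e"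
        by (simp add: add_left_mono)
      obtain C where C: "countable C" "disjoint_family_on (\<lambda>(c,r). ball c r) C"
        "\<And>c r. (c,r) \<in> C \<Longrightarrow> r > 0 \<and> ball c r \<subseteq> U \<and> (-1) * (F (c + r) - F (c - r) - a * (2 * r)) > 0"
        "negligible (E n - (\<Union>(c,r)\<in>C. ball c r))"
      proof (rule Vitali_monotone_slope[OF cont U(1,2), of "-1" a])
        fix x d :: real assume "x \<in> E n" "0 < d"
        then show "\<exists>s. 0 < \<bar>s\<bar> \<and> \<bar>s\<bar> < d \<and> (-1) * ((F (x + s) - F x) / s - a) > 0"
          using small(1)[of x d] unfolding E_def by auto
      qed blast
      define V where "V = (\<Union>(c,r)\<in>C. ball c r)"
      have oV: "open V" by (auto simp: V_def)
      have "\<exists>s. 0 < \<bar>s\<bar> \<and> \<bar>s\<bar> < d \<and> 1 * ((F (x + s) - F x) / s - b) > 0" if "x \<in> E n \<inter> V" "d > 0" for x d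
        using small(2)[of x d] that unfolding E_def by auto
      then obtain D where D: "countable D" "disjoint_family_on (\<lambda>(c,r). ball c r) D"
        "\<And>c r. (c,r) \<in> D \<Longrightarrow> r > 0 \<and> ball c r \<subseteq> V \<and> 1 * (F (c + r) - F (c - r) - b * (2 * r)) > 0"
        "negligible ((E n \<inter> V) - (\<Union>(c,r)\<in>D. ball c r))"
        using Vitali_monotone_slope[OF cont oV, of "E n \<inter> V" 1 b] by blast
      define W where "W = (\<Union>(c,r)\<in>D. ball c r)"
      have oW: "open W" by (auto simp: W_def)
      have WV: "W \<subseteq> V" unfolding W_def using D(3) by blast
      have VU: "V \<subseteq> U" unfolding V_def using C(3) by blast
      have len: "emeasure lborel (ball c r) = ennreal (2 * r)" if "r > 0" for c r :: real
        using that by (simp add: ball_eq_greaterThanLessThan)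
      have "emeasure lborel (E n) \<le> emeasure lborel W"
      proof -
        have "E n \<subseteq> W \<union> ((E n - V) \<union> ((E n \<inter> V) - W))" by auto
        then have "emeasure lebesgue (E n) \<le> emeasure lebesgue (W \<union> ((E n - V) \<union> ((E n \<inter> V) - W)))"
          using Eb oV oW by (intro emeasure_mono) auto
        also have "\<dots> = emeasure lebesgue W"
          using C(4) D(4) oW unfolding V_def[symmetric] W_def[symmetric]
          by (intro emeasure_Un_null_set) (auto simp: negligible_iff_null_sets)
        finally show ?thesis using Eb oW by (simp add: emeasure_completion)
      qed
      then have "ennreal b * emeasure lborel (E n) \<le> ennreal b * emeasure lborel W"
        by (rule mult_left_mono) simp
      also have "\<dots> = (\<integral>\<^sup>+i. ennreal b * emeasure lborel (case i of (c,r) \<Rightarrow> ball c r) \<partial>count_space D)"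
        unfolding W_def using D(1,2)
        by (subst emeasure_UN_countable) (auto simp: nn_integral_cmult)
      also have "\<dots> \<le> (\<integral>\<^sup>+i. emeasure ?\<nu> (case i of (c,r) \<Rightarrow> ball c r) \<partial>count_space D)"
      proof (intro nn_integral_mono)
        fix i assume "i \<in> space (count_space D)"
        then obtain c r where i: "i = (c,r)" "(c,r) \<in> D" by (cases i) auto
        show "ennreal b * emeasure lborel (case i of (c,r) \<Rightarrow> ball c r) \<le> emeasure ?\<nu> (case i of (c,r) \<Rightarrow> ball c r)"
          using D(3)[OF i(2)] b i by (simp add: len emeasure_interval_measure_ball[OF _ mono cont] 
              ennreal_mult[symmetric] ennreal_leI)
      qed
      also have "\<dots> = emeasure ?\<nu> W"
        unfolding W_def using D(1,2) by (subst emeasure_UN_countable) auto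
      also have "\<dots> \<le> emeasure ?\<nu> V" using WV oV by (intro emeasure_mono) auto
      also have "\<dots> = (\<integral>\<^sup>+i. emeasure ?\<nu> (case i of (c,r) \<Rightarrow> ball c r) \<partial>count_space C)"
        unfolding V_def using C(1,2) by (subst emeasure_UN_countable) auto
      also have "\<dots> \<le> (\<integral>\<^sup>+i. ennreal a * emeasure lborel (case i of (c,r) \<Rightarrow> ball c r) \<partial>count_space C)"
      proof (intro nn_integral_mono)
        fix i assume "i \<in> space (count_space C)"
        then obtain c r where i: "i = (c,r)" "(c,r) \<in> C" by (cases i) auto
        show "emeasure ?\<nu> (case i of (c,r) \<Rightarrow> ball c r) \<le> ennreal a * emeasure lborel (case i of (c,r) \<Rightarrow> ball c r)"
          using C(3)[OF i(2)] a i by (simp add: len emeasure_interval_measure_ball[OF _ mono cont] 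
              ennreal_mult[symmetric] ennreal_leI)
      qed
      also have "\<dots> = ennreal a * emeasure lborel V"
        unfolding V_def using C(1,2)
        by (subst emeasure_UN_countable) (auto simp: nn_integral_cmult)
      also have "\<dots> \<le> ennreal a * emeasure lborel U" using VU U(1) by (intro mult_left_mono emeasure_mono) auto
      also have "\<dots> \<le> ennreal a * (emeasure lborel (E n) + ennreal e)" using mU by (intro mult_left_mono) auto
      finally show ?thesis .
    qed
    obtain m where m: "m \<ge> 0" "emeasure lborel (E n) = ennreal m"
      using Efin by (metis ennreal_cases infinity_ennreal_def order_less_irrefl)
    have "b * m \<le> a * (m + e)" if "e > 0" for e
      using key[OF that] m a b that
      by (simp add: ennreal_mult[symmetric] ennreal_plus[symmetric] del: ennreal_plus)
    from this[of "(b-a)*m/(2*a)"] have "m = 0"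
    proof -
      assume *: "0 < (b-a)*m/(2*a) \<Longrightarrow> b * m \<le> a * (m + (b-a)*m/(2*a))"
      show "m = 0"
      proof (rule ccontr)
        assume "m \<noteq> 0"
        then have "m > 0" using m by simp
        then have "(b-a)*m/(2*a) > 0" using a \<open>a<b\<close> by simp
        then have "b * m \<le> a * m + (b-a)*m/2" using * a by (simp add: field_simps)
        then have "(b-a)*m/2 \<le> 0" by (simp add: field_simps)
        moreover have "(b-a)*m > 0" using \<open>m>0\<close> \<open>a<b\<close> by simp
        ultimately show False by simp
      qed
    qed
    then show ?thesis using m Eb by (simp add: negligible_iff_emeasure0 emeasure_completion)
  qed simp
  have "oscillating F 1 a b = (\<Union>n. E n)"
    unfolding E_def by (auto) (meson real_arch_simple order_le_less_trans lt_ex reals_Archimedean2)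
  then show ?thesis using neg by (simp add: negligible_Union_nat)
qed

section \<open>Rademacher's theorem\<close>

definition has_dir_deriv :: "('a::euclidean_space \<Rightarrow> real) \<Rightarrow> 'a \<Rightarrow> 'a \<Rightarrow> real \<Rightarrow> bool" where
  "has_dir_deriv f v x d \<longleftrightarrow> ((\<lambda>t. (f (x + t *\<^sub>R v) - f x) / t) \<longlongrightarrow> d) (at 0)"

text \<open>The limit is the supremum of the rates that eventually bound the quotient from below; every
rate above it eventually bounds the quotient from above, since otherwise the quotient would
oscillate between two rational rates.\<close>

lemma has_dir_deriv_if_not_oscillating:
  assumes bd: "\<And>s. \<bar>(f (x + s *\<^sub>R v) - f x) / s\<bar> \<le> M"
    and no: "\<And>a b. a \<in> \<rat> \<Longrightarrow> b \<in> \<rat> \<Longrightarrow> a < b \<Longrightarrow> x \<notin> oscillating f v a b"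
  shows "\<exists>d. has_dir_deriv f v x d"
proof -
  define q where "q = (\<lambda>s. (f (x + s *\<^sub>R v) - f x) / s)"
  have ev: "eventually (\<lambda>s. q s \<ge> a) (at 0) \<or> eventually (\<lambda>s. q s \<le> b) (at 0)"
    if "a \<in> \<rat>" "b \<in> \<rat>" "a < b" for a b
  proof -
    define P where "P = (\<lambda>n::nat. \<forall>s. 0 < \<bar>s\<bar> \<longrightarrow> \<bar>s\<bar> < 1 / Suc n \<longrightarrow> q s \<ge> a)"
    define Q where "Q = (\<lambda>n::nat. \<forall>s. 0 < \<bar>s\<bar> \<longrightarrow> \<bar>s\<bar> < 1 / Suc n \<longrightarrow> q s \<le> b)"
    have "x \<notin> oscillating f v a b" using no that by blast
    then have "\<exists>n. P n \<or> Q n"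
      unfolding oscillating_def q_def P_def Q_def mem_Collect_eq by (metis not_less)
    then obtain n where n: "P n \<or> Q n" by blast
    from n[unfolded P_def Q_def] show ?thesis
    proof
      assume *: "\<forall>s. 0 < \<bar>s\<bar> \<longrightarrow> \<bar>s\<bar> < 1 / Suc n \<longrightarrow> q s \<ge> a"
      have "eventually (\<lambda>s. q s \<ge> a) (at 0)"
        unfolding eventually_at by (rule exI[of _ "1 / Suc n"]) (use * in \<open>auto simp: dist_real_def\<close>)
      then show ?thesis ..
    next
      assume *: "\<forall>s. 0 < \<bar>s\<bar> \<longrightarrow> \<bar>s\<bar> < 1 / Suc n \<longrightarrow> q s \<le> b"
      have "eventually (\<lambda>s. q s \<le> b) (at 0)"
        unfolding eventually_at by (rule exI[of _ "1 / Suc n"]) (use * in \<open>auto simp: dist_real_def\<close>)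
      then show ?thesis ..
    qed
  qed
  define A where "A = {a. eventually (\<lambda>s. q s \<ge> a) (at 0)}"
  have qM: "- M \<le> q s" "q s \<le> M" for s using bd[of s] unfolding q_def by linarith+
  have mA: "-M \<in> A" using qM by (simp add: A_def)
  have ub: "a \<le> M" if "a \<in> A" for a
  proof -
    have "eventually (\<lambda>s. a \<le> M) (at (0::real))"
      using that unfolding A_def mem_Collect_eq by (rule eventually_mono) (use qM in \<open>blast intro: order_trans\<close>)
    then show ?thesis by simp
  qed
  then have bdd: "bdd_above A" by (meson bdd_aboveI)
  have "(q \<longlongrightarrow> Sup A) (at 0)"
  proof (rule order_tendstoI)
    fix l assume "l < Sup A"
    then obtain a where "a \<in> A" "l < a" using less_cSup_iff[of A l] mA bdd by blast
    then show "eventually (\<lambda>s. l < q s) (at 0)"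
      unfolding A_def mem_Collect_eq by (auto elim: eventually_mono)
  next
    fix u assume u: "Sup A < u"
    then obtain b where b: "Sup A < b" "b < u" "b \<in> \<rat>" using Rats_dense_in_real by blast
    then obtain a where a: "Sup A < a" "a < b" "a \<in> \<rat>" using Rats_dense_in_real by blast
    have "a \<notin> A" using a bdd by (meson cSup_upper not_less)
    then have "eventually (\<lambda>s. q s \<le> b) (at 0)" using ev[OF a(3) b(3) a(2)] by (auto simp: A_def)
    then show "eventually (\<lambda>s. q s < u) (at 0)" by (rule eventually_mono) (use b in auto)
  qed
  then show ?thesis unfolding has_dir_deriv_def q_def by blast
qed

lemma oscillating_slice:
  "oscillating (\<lambda>t::real. f (x + t *\<^sub>R v)) 1 a b = {t. x + t *\<^sub>R v \<in> oscillating f v a b}"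
  by (simp add: oscillating_def scaleR_add_left add.assoc)

text \<open>Adding \<open>M t\<close> makes an \<open>M\<close>-Lipschitz function monotone and shifts all slopes by \<open>M\<close>.\<close>

lemma lipschitz_oscillation_negligible_real:
  fixes g :: "real \<Rightarrow> real"
  assumes lip: "M-lipschitz_on UNIV g" and "a < b"
  shows "negligible (oscillating g 1 a b)"
proof -
  have l: "\<bar>g x - g y\<bar> \<le> M * \<bar>x - y\<bar>" for x y using lipschitz_onD[OF lip, of x y] by (simp add: dist_real_def)
  define F where "F = (\<lambda>t. g t + M * t)"
  have "mono F" unfolding F_def mono_def
  proof (intro allI impI)
    fix x y :: real assume "x \<le> y"
    then show "g x + M * x \<le> g y + M * y" using l[of x y] by (simp add: abs_if algebra_simps split: if_splits)
  qed
  moreover have "continuous_on UNIV F" unfolding F_def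
    using lipschitz_on_continuous_on[OF lip] by (intro continuous_intros)
  ultimately have "negligible (oscillating F 1 (a + M) (b + M))"
    using \<open>a < b\<close> by (intro monotone_oscillation_negligible) auto
  moreover have "(F (x + s) - F x) / s = (g (x + s) - g x) / s + M" if "0 < \<bar>s\<bar>" for x s
    using that by (simp add: F_def field_simps)
  then have "oscillating F 1 (a + M) (b + M) = oscillating g 1 a b"
    unfolding oscillating_def by (simp cong: conj_cong)
  ultimately show ?thesis by simp
qed

text \<open>Every line in direction \<open>v\<close> meets the set in a null set. By translation invariance the measure of
the set is the average over \<open>t \<in> [0, 1]\<close> of the measure of its translate by \<open>t v\<close>,
and exchanging the integrals turns this average into an integral of measures of slices.\<close>

lemma lipschitz_oscillation_null:
  fixes f :: "'a::euclidean_space \<Rightarrow> real"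
  assumes lip: "L-lipschitz_on UNIV f" and "a < b"
  shows "oscillating f v a b \<in> null_sets lborel"
proof -
  define N where "N = oscillating f v a b"
  have N[measurable]: "N \<in> sets borel" unfolding N_def
    using lipschitz_on_continuous_on[OF lip] by (rule oscillating_in_borel)
  have slice: "(\<integral>\<^sup>+t. indicator {0..1} t * indicator N (x + t *\<^sub>R v) \<partial>lborel) = (0::ennreal)" for x
  proof -
    have lip': "(L * norm v)-lipschitz_on UNIV (\<lambda>t::real. f (x + t *\<^sub>R v))"
    proof (rule lipschitz_onI)
      fix s t :: real
      show "dist (f (x + s *\<^sub>R v)) (f (x + t *\<^sub>R v)) \<le> L * norm v * dist s t"
        using lipschitz_onD[OF lip, of "x + s *\<^sub>R v" "x + t *\<^sub>R v"]
        by (simp add: dist_norm scaleR_diff_left[symmetric] mult_ac)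
    qed (use lipschitz_on_nonneg[OF lip] in auto)
    have "negligible {t. x + t *\<^sub>R v \<in> N}"
      using lipschitz_oscillation_negligible_real[OF lip' \<open>a < b\<close>] unfolding oscillating_slice N_def .
    then have "{t. x + t *\<^sub>R v \<in> N} \<in> null_sets lborel"
      unfolding negligible_iff_null_sets by (subst (asm) null_sets_completion_iff) measurable
    then have "AE t in lborel. x + t *\<^sub>R v \<notin> N" by (auto dest: AE_not_in)
    then show ?thesis by (subst nn_integral_0_iff_AE) (measurable, auto simp: indicator_def)
  qed
  have trans: "(\<integral>\<^sup>+x. indicator N (x + c) \<partial>lborel) = emeasure lborel N" for c
  proof -
    have "emeasure lborel N = (\<integral>\<^sup>+x. indicator N x \<partial>(distr lborel borel ((+) c)))"
      by (simp add: lborel_distr_plus)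
    also have "\<dots> = (\<integral>\<^sup>+x. indicator N (c + x) \<partial>lborel)" by (subst nn_integral_distr) measurable
    finally show ?thesis by (simp add: add.commute)
  qed
  have "emeasure lborel N = (\<integral>\<^sup>+t. indicator {0..1} t * emeasure lborel N \<partial>(lborel::real measure))"
    by (simp add: nn_integral_multc)
  also have "\<dots> = (\<integral>\<^sup>+t. (\<integral>\<^sup>+x. indicator {0..1} t * indicator N (x + t *\<^sub>R v) \<partial>lborel) \<partial>(lborel::real measure))"
    by (subst nn_integral_cmult) (simp_all add: trans)
  also have "\<dots> = (\<integral>\<^sup>+x. (\<integral>\<^sup>+t. indicator {0..1} t * indicator N (x + t *\<^sub>R v) \<partial>(lborel::real measure)) \<partial>lborel)"
    by (rule lborel_pair.Fubini') (measurable)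
  also have "\<dots> = 0" by (simp add: slice)
  finally show ?thesis using N unfolding N_def by (auto simp: null_sets_def)
qed

lemma lipschitz_quotient_bound:
  fixes f :: "'a::euclidean_space \<Rightarrow> real"
  assumes lip: "L-lipschitz_on UNIV f"
  shows "\<bar>(f (x + s *\<^sub>R v) - f x) / s\<bar> \<le> L * norm v"
proof (cases "s = 0")
  case False
  have "\<bar>f (x + s *\<^sub>R v) - f x\<bar> \<le> L * (\<bar>s\<bar> * norm v)"
    using lipschitz_onD[OF lip, of "x + s *\<^sub>R v" x] by (simp add: dist_norm)
  then show ?thesis using False by (simp add: field_simps)
qed (use lipschitz_on_nonneg[OF lip] in auto)

lemma lipschitz_dir_deriv_ae:
  fixes f :: "'a::euclidean_space \<Rightarrow> real"
  assumes lip: "L-lipschitz_on UNIV f"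
  shows "AE x in lborel. \<exists>d. has_dir_deriv f v x d"
proof -
  let ?R = "{(a,b). a \<in> \<rat> \<and> b \<in> \<rat> \<and> a < (b::real)}"
  have "countable ?R" by (rule countable_subset[of _ "\<rat> \<times> \<rat>"]) (auto simp: countable_rat)
  then have "AE x in lborel. \<forall>p\<in>?R. x \<notin> oscillating f v (fst p) (snd p)"
    by (subst AE_ball_countable) (auto intro!: AE_not_in lipschitz_oscillation_null[OF lip])
  then show ?thesis
  proof eventually_elim
    case (elim x)
    show ?case
      by (rule has_dir_deriv_if_not_oscillating[where M="L * norm v", OF lipschitz_quotient_bound[OF lip]])
         (use elim in force)
  qed
qed

text \<open>Boxes generate the Borel sets and are closed under intersection, so the two densities, shifted to
be nonnegative, define the same measure.\<close>

lemma AE_eq_if_box_integrals_eq: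
  fixes d1 d2 :: "'a::euclidean_space \<Rightarrow> real"
  assumes [measurable]: "d1 \<in> borel_measurable borel" "d2 \<in> borel_measurable borel"
    and bd: "AE x in lborel. \<bar>d1 x\<bar> \<le> M" "AE x in lborel. \<bar>d2 x\<bar> \<le> M"
    and eq: "\<And>l u. (\<integral>x. indicator (box l u) x * d1 x \<partial>lborel) = (\<integral>x. indicator (box l u) x * d2 x \<partial>lborel)"
  shows "AE x in lborel. d1 x = d2 x"
proof -
  have em: "emeasure (density lborel (\<lambda>x. ennreal (d x + M))) (box l u)
      = ennreal ((\<integral>x. indicator (box l u) x * d x \<partial>lborel) + M * measure lborel (box l u))"
    if [measurable]: "d \<in> borel_measurable borel" and b: "AE x in lborel. \<bar>d x\<bar> \<le> M" for d :: "'a \<Rightarrow> real" and l u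
  proof -
    have i0: "integrable lborel (indicator (box l u) :: 'a \<Rightarrow> real)"
      using emeasure_lborel_box_finite[of l u] by (simp add: less_top)
    have i1: "integrable lborel (\<lambda>x. indicator (box l u) x * d x)"
    proof (rule Bochner_Integration.integrable_bound)
      show "integrable lborel (\<lambda>x. M * indicator (box l u) x :: real)" using i0 by simp
      show "AE x in lborel. norm (indicator (box l u) x * d x) \<le> norm (M * indicator (box l u) x)"
        using b by eventually_elim (auto simp: indicator_def)
    qed measurable
    have "emeasure (density lborel (\<lambda>x. ennreal (d x + M))) (box l u)
       = (\<integral>\<^sup>+x. ennreal (d x + M) * indicator (box l u) x \<partial>lborel)"
      by (rule emeasure_density) auto
    also have "\<dots> = (\<integral>\<^sup>+x. ennreal (indicator (box l u) x * d x + M * indicator (box l u) x) \<partial>lborel)"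
      by (rule nn_integral_cong) (auto simp: indicator_def)
    also have "\<dots> = ennreal (\<integral>x. indicator (box l u) x * d x + M * indicator (box l u) x \<partial>lborel)"
      using i0 i1 by (intro nn_integral_eq_integral) (auto, use b in eventually_elim, auto simp: indicator_def)
    also have "(\<integral>x. indicator (box l u) x * d x + M * indicator (box l u) x \<partial>lborel)
        = (\<integral>x. indicator (box l u) x * d x \<partial>lborel) + M * measure lborel (box l u)"
      using i0 i1 by (subst Bochner_Integration.integral_add) auto
    finally show ?thesis .
  qed
  have "density lborel (\<lambda>x. ennreal (d1 x + M)) = density lborel (\<lambda>x. ennreal (d2 x + M))"
  proof (rule measure_eqI_generator_eq)
    let ?E = "range (\<lambda>(a, b). box a b::'a set)"
    show "Int_stable ?E" by (auto simp: Int_stable_def box_Int_box)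
    show "?E \<subseteq> Pow UNIV" "sets (density lborel (\<lambda>x. ennreal (d1 x + M))) = sigma_sets UNIV ?E" 
       "sets (density lborel (\<lambda>x. ennreal (d2 x + M))) = sigma_sets UNIV ?E"
      by (simp_all add: borel_eq_box)
    let ?A = "\<lambda>n::nat. box (- (real n *\<^sub>R One)) (real n *\<^sub>R One) :: 'a set"
    show "range ?A \<subseteq> ?E" "(\<Union>i. ?A i) = UNIV" unfolding UN_box_eq_UNIV by auto
    show "emeasure (density lborel (\<lambda>x. ennreal (d1 x + M))) (?A i) \<noteq> \<infinity>" for i
      using bd by (subst em) auto
    show "emeasure (density lborel (\<lambda>x. ennreal (d1 x + M))) X = emeasure (density lborel (\<lambda>x. ennreal (d2 x + M))) X"
      if "X \<in> ?E" for X
      using that bd by (auto simp: em eq)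
  qed
  then have "AE x in lborel. ennreal (d1 x + M) = ennreal (d2 x + M)"
    by (subst (asm) sigma_finite_measure.density_unique_iff[OF sigma_finite_lborel]) auto
  then show ?thesis using bd by eventually_elim auto
qed

text \<open>A limit along a sequence, so that measurability in \<open>x\<close> is immediate; the value is
meaningful only where \<open>has_dir_deriv\<close> holds.\<close>

definition dir_deriv :: "('a::euclidean_space \<Rightarrow> real) \<Rightarrow> 'a \<Rightarrow> 'a \<Rightarrow> real" where
  "dir_deriv f v x = lim (\<lambda>k. (f (x + (1 / Suc k) *\<^sub>R v) - f x) / (1 / Suc k))"

lemma has_dir_deriv_LIMSEQ:
  assumes "has_dir_deriv f v x d"
  shows "(\<lambda>k. (f (x + (1 / Suc k) *\<^sub>R v) - f x) / (1 / Suc k)) \<longlonglongrightarrow> d"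
proof -
  have "filterlim (\<lambda>k. 1 / real (Suc k)) (at 0) sequentially"
    using LIMSEQ_Suc[OF lim_1_over_n] by (auto simp: filterlim_at)
  then show ?thesis
    using assms filterlim_compose[of "\<lambda>t. (f (x + t *\<^sub>R v) - f x) / t"] unfolding has_dir_deriv_def by blast
qed

lemma has_dir_deriv_dir_deriv: "has_dir_deriv f v x d \<Longrightarrow> dir_deriv f v x = d"
  unfolding dir_deriv_def by (rule limI[OF has_dir_deriv_LIMSEQ])

text \<open>The difference quotient of \<open>f\<close> along \<open>w\<close>, evaluated at \<open>x + v/k\<close>, tends to
\<open>D\<^sub>v\<^sub>+\<^sub>w f - D\<^sub>v f\<close> pointwise almost everywhere. Tested on a box, the shift by
\<open>v/k\<close> can be moved to the indicator function, where it disappears in the limit; hence the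
same quotients also have the limit \<open>D\<^sub>w f\<close>, and both limits have equal integrals over
every box.\<close>

lemma dir_deriv_add_ae:
  fixes f :: "'a::euclidean_space \<Rightarrow> real"
  assumes lip: "L-lipschitz_on UNIV f"
  shows "AE x in lborel. dir_deriv f (v + w) x = dir_deriv f v x + dir_deriv f w x"
proof -
  define q where "q = (\<lambda>u k x. (f (x + (1 / real (Suc k)) *\<^sub>R u) - f x) / (1 / Suc k))"
  have f[measurable]: "f \<in> borel_measurable borel"
    using lipschitz_on_continuous_on[OF lip] by (rule borel_measurable_continuous_onI)
  have qm[measurable]: "q u k \<in> borel_measurable borel" for u k unfolding q_def by measurable
  have qb: "\<bar>q u k x\<bar> \<le> L * norm u" for u k x
    unfolding q_def by (rule lipschitz_quotient_bound[OF lip])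
  have dm[measurable]: "dir_deriv f u \<in> borel_measurable borel" for u
    unfolding dir_deriv_def q_def[symmetric] by (rule borel_measurable_lim_metric) measurable
  have lim: "AE x in lborel. (\<lambda>k. q u k x) \<longlonglongrightarrow> dir_deriv f u x" for u
    using lipschitz_dir_deriv_ae[OF lip, of u]
    by eventually_elim (unfold q_def, metis has_dir_deriv_dir_deriv has_dir_deriv_LIMSEQ)
  have db: "AE x in lborel. \<bar>dir_deriv f u x\<bar> \<le> L * norm u" for u
    using lim[of u] by eventually_elim (rule LIMSEQ_le_const2[OF tendsto_rabs], auto simp: qb)
  define h where "h = (\<lambda>x. dir_deriv f (v + w) x - dir_deriv f v x)"
  have [measurable]: "h \<in> borel_measurable borel" unfolding h_def by measurable
  have split: "q w k (x + (1 / real (Suc k)) *\<^sub>R v) = q (v + w) k x - q v k x" for k x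
    by (simp only: q_def scaleR_add_right add.assoc diff_divide_distrib[symmetric]) simp
  have hl: "AE x in lborel. (\<lambda>k. q w k (x + (1 / real (Suc k)) *\<^sub>R v)) \<longlonglongrightarrow> h x"
    using lim[of "v+w"] lim[of v] by eventually_elim (simp only: split h_def tendsto_diff)
  have hb: "AE x in lborel. \<bar>h x\<bar> \<le> L * norm w"
    using hl by eventually_elim (rule LIMSEQ_le_const2[OF tendsto_rabs], auto simp: qb)
  have L0: "L \<ge> 0" using lipschitz_on_nonneg[OF lip] .
  have "AE x in lborel. h x = dir_deriv f w x"
  proof (rule AE_eq_if_box_integrals_eq[OF _ _ hb db])
    fix l u :: 'a
    obtain R where R: "box l u \<subseteq> ball 0 R" using bounded_box[of l u] bounded_subset_ballD by metis
    define B where "B = (ball 0 (R + norm v) :: 'a set)"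
    have iB: "integrable lborel (\<lambda>x. (L * norm w) * indicator B x :: real)"
      using emeasure_lborel_ball_finite[of "0::'a" "R + norm v"] unfolding B_def
      by (intro integrable_mult_right integrable_real_indicator) auto
    define I where "I = (\<lambda>k. \<integral>x. indicator (box l u) x * q w k (x + (1 / real (Suc k)) *\<^sub>R v) \<partial>lborel)"
    have I1: "I \<longlonglongrightarrow> (\<integral>x. indicator (box l u) x * h x \<partial>lborel)"
      unfolding I_def
    proof (rule integral_dominated_convergence[where w="\<lambda>x. (L * norm w) * indicator B x"])
      show "AE x in lborel. (\<lambda>i. indicator (box l u) x * q w i (x + (1 / real (Suc i)) *\<^sub>R v)) \<longlonglongrightarrow> indicator (box l u) x * h x"
        using hl by eventually_elim (rule tendsto_mult_left)
      show "AE x in lborel. norm (indicator (box l u) x * q w i (x + (1 / real (Suc i)) *\<^sub>R v)) \<le> L * norm w * indicator B x" for i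
      proof (rule AE_I2)
        fix x
        have "x \<in> B" if "x \<in> box l u" using that R unfolding B_def
          using norm_ge_zero[of v] by (auto dest!: subsetD simp del: norm_ge_zero)
        then show "norm (indicator (box l u) x * q w i (x + (1 / real (Suc i)) *\<^sub>R v)) \<le> L * norm w * indicator B x"
          using qb L0 by (auto simp: indicator_def)
      qed
    qed (use iB in measurable)
    have I2eq: "I k = (\<integral>x. indicator (box l u) (x - (1 / real (Suc k)) *\<^sub>R v) * q w k x \<partial>lborel)" for k
    proof -
      let ?c = "(1 / real (Suc k)) *\<^sub>R v"
      have "(\<integral>x. indicator (box l u) (x - ?c) * q w k x \<partial>lborel)
          = (\<integral>x. indicator (box l u) (x - ?c) * q w k x \<partial>(distr lborel borel ((+) ?c)))"
        by (simp add: lborel_distr_plus)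
      also have "\<dots> = (\<integral>x. indicator (box l u) x * q w k (?c + x) \<partial>lborel)"
        by (subst integral_distr) simp_all
      finally show ?thesis unfolding I_def by (simp add: add.commute)
    qed
    have vl: "(\<lambda>k. x - (1 / real (Suc k)) *\<^sub>R v) \<longlonglongrightarrow> x" for x
    proof -
      have "(\<lambda>k. x - (1 / real (Suc k)) *\<^sub>R v) \<longlonglongrightarrow> x - 0 *\<^sub>R v"
        using LIMSEQ_Suc[OF lim_1_over_n] by (intro tendsto_intros)
      then show ?thesis by simp
    qed
    have fr: "AE x in lborel. x \<notin> frontier (box l u)"
    proof -
      have "frontier (box l u) \<in> null_sets lebesgue"
        using negligible_convex_frontier[OF convex_box(2)] by (simp add: negligible_iff_null_sets)
      then have "frontier (box l u) \<in> null_sets lborel"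
        by (subst (asm) null_sets_completion_iff) auto
      then show ?thesis by (rule AE_not_in)
    qed
    have I2: "I \<longlonglongrightarrow> (\<integral>x. indicator (box l u) x * dir_deriv f w x \<partial>lborel)"
      unfolding I2eq
    proof (rule integral_dominated_convergence[where w="\<lambda>x. (L * norm w) * indicator B x"])
      show "AE x in lborel. (\<lambda>i. indicator (box l u) (x - (1 / real (Suc i)) *\<^sub>R v) * q w i x) \<longlonglongrightarrow> indicator (box l u) x * dir_deriv f w x"
        using lim[of w] fr
      proof eventually_elim
        case (elim x)
        have "(\<lambda>i. indicator (box l u) (x - (1 / real (Suc i)) *\<^sub>R v) :: real) \<longlonglongrightarrow> indicator (box l u) x"
        proof (cases "x \<in> box l u")
          case True
          have "eventually (\<lambda>i. x - (1 / real (Suc i)) *\<^sub>R v \<in> box l u) sequentially"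
            by (rule topological_tendstoD[OF vl open_box True])
          then have "eventually (\<lambda>i. indicator (box l u) (x - (1 / real (Suc i)) *\<^sub>R v) = (indicator (box l u) x :: real)) sequentially"
            by eventually_elim (use True in auto)
          then show ?thesis by (rule tendsto_eventually)
        next
          case False
          then have "x \<in> - closure (box l u)" using elim(2) by (simp add: frontier_def interior_open[OF open_box])
          then have "eventually (\<lambda>i. x - (1 / real (Suc i)) *\<^sub>R v \<in> - closure (box l u)) sequentially"
            by (intro topological_tendstoD[OF vl]) auto
          then have "eventually (\<lambda>i. indicator (box l u) (x - (1 / real (Suc i)) *\<^sub>R v) = (indicator (box l u) x :: real)) sequentially"
            by eventually_elim (use False closure_subset in \<open>auto simp: indicator_def\<close>)
          then show ?thesis by (rule tendsto_eventually)
        qed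
        then show ?case using elim(1) by (rule tendsto_mult)
      qed
      show "AE x in lborel. norm (indicator (box l u) (x - (1 / real (Suc i)) *\<^sub>R v) * q w i x) \<le> L * norm w * indicator B x" for i
      proof (rule AE_I2)
        fix x
        let ?c = "(1 / real (Suc i)) *\<^sub>R v"
        have "x \<in> B" if "x - ?c \<in> box l u"
        proof -
          have "norm (x - ?c) < R" using that R by auto
          moreover have "norm ?c \<le> norm v" by (simp add: field_simps mult_left_le)
          moreover have "norm x \<le> norm (x - ?c) + norm ?c" by (metis diff_add_cancel norm_triangle_ineq)
          ultimately show ?thesis unfolding B_def by simp
        qed
        then show "norm (indicator (box l u) (x - ?c) * q w i x) \<le> L * norm w * indicator B x"
          using qb L0 by (auto simp: indicator_def)
      qed
    qed (use iB in measurable)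
    show "(\<integral>x. indicator (box l u) x * h x \<partial>lborel) = (\<integral>x. indicator (box l u) x * dir_deriv f w x \<partial>lborel)"
      using LIMSEQ_unique[OF I1 I2] .
  qed measurable
  then show ?thesis unfolding h_def by eventually_elim simp
qed

lemma has_dir_deriv_scaleR:
  assumes "has_dir_deriv f v x d"
  shows "has_dir_deriv f (c *\<^sub>R v) x (c * d)"
proof (cases "c = 0")
  case False
  have "((\<lambda>t. c * ((f (x + (t * c) *\<^sub>R v) - f x) / (t * c))) \<longlongrightarrow> c * d) (at 0)"
  proof (rule tendsto_mult_left)
    have "filterlim (\<lambda>t. t * c) (at 0) (at 0)"
      using False by (auto simp: filterlim_at eventually_at_filter intro!: tendsto_eq_intros)
    then show "((\<lambda>t. (f (x + (t * c) *\<^sub>R v) - f x) / (t * c)) \<longlongrightarrow> d) (at 0)"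
      using assms filterlim_compose[of "\<lambda>t. (f (x + t *\<^sub>R v) - f x) / t"] unfolding has_dir_deriv_def by blast
  qed
  then show ?thesis using False unfolding has_dir_deriv_def by (simp add: mult.commute)
qed (simp add: has_dir_deriv_def)

lemma dir_deriv_linear_ae:
  fixes f :: "'a::euclidean_space \<Rightarrow> real"
  assumes lip: "L-lipschitz_on UNIV f"
  shows "AE x in lborel. has_dir_deriv f v x (\<Sum>b\<in>Basis. (v \<bullet> b) * dir_deriv f b x)"
proof -
  have "AE x in lborel. has_dir_deriv f (\<Sum>b\<in>B. (v \<bullet> b) *\<^sub>R b) x (\<Sum>b\<in>B. (v \<bullet> b) * dir_deriv f b x)"
    if "finite B" for B :: "'a set"
    using that
  proof (induction B)
    case empty
    then show ?case by (simp add: has_dir_deriv_def)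
  next
    case (insert b B)
    let ?s = "\<Sum>b\<in>B. (v \<bullet> b) *\<^sub>R b"
    show ?case
      using insert.IH lipschitz_dir_deriv_ae[OF lip, of b] dir_deriv_add_ae[OF lip, of "(v \<bullet> b) *\<^sub>R b" ?s]
        lipschitz_dir_deriv_ae[OF lip, of "(v \<bullet> b) *\<^sub>R b + ?s"]
    proof eventually_elim
      case (elim x)
      obtain d where d: "has_dir_deriv f b x d" using elim by blast
      obtain e where e: "has_dir_deriv f ((v \<bullet> b) *\<^sub>R b + ?s) x e" using elim by blast
      have "dir_deriv f ((v \<bullet> b) *\<^sub>R b) x = (v \<bullet> b) * dir_deriv f b x"
        using has_dir_deriv_dir_deriv[OF has_dir_deriv_scaleR[OF d]] has_dir_deriv_dir_deriv[OF d] by simp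
      then have "e = (v \<bullet> b) * dir_deriv f b x + (\<Sum>b\<in>B. (v \<bullet> b) * dir_deriv f b x)"
        using elim(3) has_dir_deriv_dir_deriv[OF e] has_dir_deriv_dir_deriv[OF elim(1)] by simp
      then show ?case using e insert.hyps by simp
    qed
  qed
  from this[OF finite_Basis] show ?thesis by (simp add: euclidean_representation)
qed

text \<open>At almost every point the directional derivative is linear along a countable dense set of
directions. Finitely many of them form a fine net of the unit sphere, and the Lipschitz condition
controls the quotient in the remaining directions, uniformly.\<close>

lemma rademacher_real_ae:
  fixes f :: "'a::euclidean_space \<Rightarrow> real"
  assumes lip: "L-lipschitz_on UNIV f"
  shows "AE x in lborel. f differentiable (at x)"
proof -
  obtain V :: "'a set" where V: "countable V" "\<And>X. open X \<Longrightarrow> X \<noteq> {} \<Longrightarrow> \<exists>d\<in>V. d \<in> X"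
    using countable_dense_exists by blast
  have "AE x in lborel. \<forall>v\<in>V. has_dir_deriv f v x (\<Sum>b\<in>Basis. (v \<bullet> b) * dir_deriv f b x)"
    using V(1) by (subst AE_ball_countable) (auto intro: dir_deriv_linear_ae[OF lip])
  then show ?thesis
  proof eventually_elim
    case (elim x)
    define D where "D = (\<lambda>h. \<Sum>b\<in>Basis. (h \<bullet> b) * dir_deriv f b x)"
    have lin: "bounded_linear D" unfolding D_def by (intro bounded_linear_intros)
    define K where "K = onorm D"
    have K: "\<bar>D h\<bar> \<le> K * norm h" for h using onorm[OF lin, of h] by (simp add: K_def)
    have K0: "K \<ge> 0" unfolding K_def by (rule onorm_pos_le[OF lin])
    have L0: "L \<ge> 0" using lipschitz_on_nonneg[OF lip] .
    have "(f has_derivative D) (at x)"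
      unfolding has_derivative_at_alt
    proof (intro conjI lin allI impI)
      fix e :: real assume e: "e > 0"
      define \<eta> where "\<eta> = e / (L + K + 1)"
      have \<eta>: "\<eta> > 0" using e L0 K0 by (simp add: \<eta>_def)
      have "sphere (0::'a) 1 \<subseteq> (\<Union>v\<in>V. ball v \<eta>)"
      proof
        fix u :: 'a
        obtain v where "v \<in> V" "v \<in> ball u \<eta>" using V(2)[of "ball u \<eta>"] \<eta> by auto
        then show "u \<in> (\<Union>v\<in>V. ball v \<eta>)" by (auto simp: dist_commute)
      qed
      then obtain W where W: "W \<subseteq> V" "finite W" "sphere (0::'a) 1 \<subseteq> (\<Union>v\<in>W. ball v \<eta>)"
        by (rule compactE_image[OF compact_sphere, rotated]) auto
      have "\<forall>v\<in>W. eventually (\<lambda>t. \<bar>(f (x + t *\<^sub>R v) - f x) / t - D v\<bar> < \<eta>) (at 0)"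
      proof
        fix v assume "v \<in> W"
        then have "((\<lambda>t. (f (x + t *\<^sub>R v) - f x) / t) \<longlongrightarrow> D v) (at 0)"
          using elim W(1) unfolding has_dir_deriv_def D_def by blast
        from tendstoD[OF this \<eta>] show "eventually (\<lambda>t. \<bar>(f (x + t *\<^sub>R v) - f x) / t - D v\<bar> < \<eta>) (at 0)"
          by (simp add: dist_real_def)
      qed
      then have "eventually (\<lambda>t. \<forall>v\<in>W. \<bar>(f (x + t *\<^sub>R v) - f x) / t - D v\<bar> < \<eta>) (at 0)"
        using W(2) by (simp add: eventually_ball_finite)
      then obtain d where d: "d > 0" "\<And>t v. t \<noteq> 0 \<Longrightarrow> \<bar>t\<bar> < d \<Longrightarrow> v \<in> W \<Longrightarrow> \<bar>(f (x + t *\<^sub>R v) - f x) / t - D v\<bar> < \<eta>"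
        by (auto simp: eventually_at dist_real_def)
      have "norm (f y - f x - D (y - x)) \<le> e * norm (y - x)" if y: "norm (y - x) < d" for y
      proof (cases "y = x")
        case True
        then show ?thesis using linear_0[OF bounded_linear.linear[OF lin]] by simp
      next
        case False
        define t where "t = norm (y - x)"
        have t: "t > 0" "t < d" using False y by (auto simp: t_def)
        define u where "u = (1/t) *\<^sub>R (y - x)"
        have u: "norm u = 1" "y = x + t *\<^sub>R u" using t by (auto simp: u_def t_def)
        then obtain v where v: "v \<in> W" "dist v u < \<eta>" using W(3) by (metis (no_types, lifting) UN_E mem_ball mem_sphere_0 subsetD)
        have "\<bar>(f (x + t *\<^sub>R v) - f x) / t - D v\<bar> < \<eta>" using d(2)[of t v] t v by auto
        then have 1: "\<bar>f (x + t *\<^sub>R v) - f x - t * D v\<bar> \<le> t * \<eta>"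
          using t by (simp add: field_simps abs_le_iff abs_less_iff)
        have 2: "\<bar>f (x + t *\<^sub>R u) - f (x + t *\<^sub>R v)\<bar> \<le> L * (t * \<eta>)"
        proof -
          have "\<bar>f (x + t *\<^sub>R u) - f (x + t *\<^sub>R v)\<bar> \<le> L * dist (x + t *\<^sub>R u) (x + t *\<^sub>R v)"
            using lipschitz_onD[OF lip UNIV_I UNIV_I] by (metis dist_real_def)
          also have "dist (x + t *\<^sub>R u) (x + t *\<^sub>R v) = t * dist v u"
            using t by (simp add: dist_norm scaleR_diff_right[symmetric] norm_minus_commute)
          also have "L * (t * dist v u) \<le> L * (t * \<eta>)" using L0 t v by (intro mult_left_mono) auto
          finally show ?thesis .
        qed
        have 3: "\<bar>D v - D u\<bar> \<le> K * \<eta>"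
        proof -
          have "D v - D u = D (v - u)" using linear_diff[OF bounded_linear.linear[OF lin], of v u] by simp
          then have "\<bar>D v - D u\<bar> \<le> K * norm (v - u)" using K by metis
          also have "\<dots> \<le> K * \<eta>" using K0 v by (intro mult_left_mono) (auto simp: dist_norm)
          finally show ?thesis .
        qed
        have 4: "\<bar>t * D v - t * D u\<bar> \<le> t * (K * \<eta>)"
          using 3 t by (simp add: right_diff_distrib[symmetric] abs_mult)
        have "\<bar>f y - f x - t * D u\<bar> \<le> t * \<eta> + L * (t * \<eta>) + t * (K * \<eta>)"
          unfolding u(2) using 1 2 4 by linarith
        also have "\<dots> = t * (\<eta> * (L + K + 1))" by (simp add: algebra_simps)
        also have "\<eta> * (L + K + 1) = e" using L0 K0 by (simp add: \<eta>_def)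
        finally have "\<bar>f y - f x - t * D u\<bar> \<le> e * t" by (simp add: mult.commute)
        moreover have "D (y - x) = t * D u"
          using u(2) linear_cmul[OF bounded_linear.linear[OF lin], of t u] by simp
        ultimately show ?thesis by (simp add: t_def)
      qed
      then show "\<exists>d>0. \<forall>y. norm (y - x) < d \<longrightarrow> norm (f y - f x - D (y - x)) \<le> e * norm (y - x)"
        using d(1) by blast
    qed
    then show ?case by (auto simp: differentiable_def)
  qed
qed

theorem rademacher:
  fixes f :: "'a::euclidean_space \<Rightarrow> 'b::euclidean_space"
  assumes lip: "L-lipschitz_on UNIV f"
  shows "negligible {x. \<not> f differentiable (at x)}"
proof -
  have "L-lipschitz_on UNIV (\<lambda>x. f x \<bullet> i)" if "i \<in> Basis" for i
  proof (rule lipschitz_onI)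
    fix x y
    show "dist (f x \<bullet> i) (f y \<bullet> i) \<le> L * dist x y"
      using lipschitz_onD[OF lip, of x y] Basis_le_norm[OF that, of "f x - f y"]
      by (simp add: dist_norm inner_diff_left)
  qed (rule lipschitz_on_nonneg[OF lip])
  then have "AE x in lborel. \<forall>i\<in>Basis. (\<lambda>x. f x \<bullet> i) differentiable (at x)"
    by (subst AE_ball_countable) (auto intro: rademacher_real_ae countable_finite)
  then have "AE x in lborel. f differentiable (at x)"
    by eventually_elim (subst differentiable_componentwise_within, auto)
  then show ?thesis
    unfolding eventually_ae_filter negligible_iff_null_sets
    by (auto simp: Collect_mono intro: null_sets_completion_subset null_sets_completionI)
qed

section \<open>Subgradients and second order expansions of convex functions\<close>

text \<open>Convex functions enter below through the assumption that every point has a subgradient; for the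
sup-convolutions these are given explicitly by the maximizers.\<close>

definition subgradient :: "('a::real_inner \<Rightarrow> real) \<Rightarrow> 'a \<Rightarrow> 'a \<Rightarrow> bool" where
  "subgradient g x q \<longleftrightarrow> (\<forall>z. g x + q \<bullet> (z - x) \<le> g z)"

lemma subgradientD: "subgradient g x q \<Longrightarrow> g x + q \<bullet> (z - x) \<le> g z"
  by (simp add: subgradient_def)

lemma nonpos_if_le_small_multiples:
  fixes K C :: real
  assumes "\<And>t. 0 < t \<Longrightarrow> t \<le> 1 \<Longrightarrow> K \<le> t * C"
  shows "K \<le> 0"
proof (rule ccontr)
  assume "\<not> K \<le> 0"
  then have K: "K > 0" by simp
  define t where "t = min 1 (K / (2 * (\<bar>C\<bar> + 1)))"
  have t: "0 < t" "t \<le> 1" using K by (auto simp: t_def)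
  have "t \<le> K / (2 * (\<bar>C\<bar> + 1))" by (simp add: t_def)
  then have "t * (\<bar>C\<bar> + 1) \<le> K / 2" by (simp add: field_simps)
  moreover have "t * C \<le> t * (\<bar>C\<bar> + 1)" using t by (intro mult_left_mono) auto
  ultimately show False using assms[OF t] K by linarith
qed

lemma subgradients_imp_convex:
  fixes g :: "'a::real_inner \<Rightarrow> real"
  assumes "\<And>x. \<exists>q. subgradient g x q"
  shows "convex_on UNIV g"
proof (rule convex_onI)
  fix t :: real and x y :: 'a assume t: "0 < t" "t < 1"
  let ?z = "(1 - t) *\<^sub>R x + t *\<^sub>R y"
  obtain q where q: "subgradient g ?z q" using assms by blast
  have "(1 - t) * (g ?z + q \<bullet> (x - ?z)) + t * (g ?z + q \<bullet> (y - ?z)) \<le> (1 - t) * g x + t * g y"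
    using t subgradientD[OF q] by (intro add_mono mult_left_mono) auto
  moreover have "(1 - t) * (q \<bullet> (x - ?z)) + t * (q \<bullet> (y - ?z)) = 0"
    by (simp add: inner_diff_right inner_add_right algebra_simps)
  ultimately show "g ?z \<le> (1 - t) * g x + t * g y"
    by (simp add: algebra_simps)
qed simp

text \<open>The point is the minimizer of \<open>g + |\<cdot> - y|\<^sup>2 / 2\<close>, that is, the value at \<open>y\<close> of the
resolvent \<open>(id + \<partial>g)\<^sup>-\<^sup>1\<close>.\<close>

lemma subgradient_resolvent_exists:
  fixes g :: "'a::euclidean_space \<Rightarrow> real"
  assumes sub: "\<And>x. \<exists>q. subgradient g x q"
  shows "\<exists>x. subgradient g x (y - x)"
proof -
  have conv: "convex_on UNIV g" by (rule subgradients_imp_convex[OF sub])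
  then have cont: "continuous_on UNIV g" by (rule convex_on_continuous[OF open_UNIV])
  define \<phi> where "\<phi> = (\<lambda>x. g x + 1/2 * (norm (x - y))\<^sup>2)"
  obtain q0 where q0: "subgradient g y q0" using sub by blast
  define R where "R = 2 * norm q0"
  have "continuous_on (cball y R) \<phi>" unfolding \<phi>_def
    by (intro continuous_intros continuous_on_subset[OF cont]) auto
  moreover have "y \<in> cball y R" by (simp add: R_def)
  ultimately obtain x where x: "x \<in> cball y R" "\<And>z. z \<in> cball y R \<Longrightarrow> \<phi> x \<le> \<phi> z"
    using continuous_attains_inf[of "cball y R" \<phi>] by auto
  have min: "\<phi> x \<le> \<phi> z" for z
  proof (cases "z \<in> cball y R")
    case False
    then have "norm (z - y) > 2 * norm q0" by (simp add: R_def dist_norm norm_minus_commute)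
    then have "norm q0 * norm (z - y) \<le> 1/2 * (norm (z - y))\<^sup>2"
      using mult_right_mono[of "2 * norm q0" "norm (z - y)" "norm (z - y)"] by (simp add: power2_eq_square)
    moreover have "- (norm q0 * norm (z - y)) \<le> q0 \<bullet> (z - y)"
      using norm_cauchy_schwarz[of "- q0" "z - y"] by simp
    ultimately have "\<phi> y \<le> \<phi> z" using subgradientD[OF q0, of z] by (simp add: \<phi>_def)
    moreover have "\<phi> x \<le> \<phi> y" using x(2)[of y] by (simp add: R_def)
    ultimately show ?thesis by simp
  qed (use x in auto)
  have "g x + (y - x) \<bullet> (z - x) \<le> g z" for z
  proof -
    have "g x + (y - x) \<bullet> (z - x) - g z \<le> t * (1/2 * (norm (z - x))\<^sup>2)" if t: "0 < t" "t \<le> 1" for t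
    proof -
      have "\<phi> x \<le> \<phi> (x + t *\<^sub>R (z - x))" by (rule min)
      moreover have "x + t *\<^sub>R (z - x) = (1 - t) *\<^sub>R x + t *\<^sub>R z" by (simp add: algebra_simps)
      then have "g (x + t *\<^sub>R (z - x)) \<le> (1 - t) * g x + t * g z"
        using convex_onD[OF conv, of t x z] t by auto
      moreover have "(norm (x + t *\<^sub>R (z - x) - y))\<^sup>2
         = (norm (x - y))\<^sup>2 - 2 * t * ((y - x) \<bullet> (z - x)) + t * (t * (norm (z - x))\<^sup>2)"
        unfolding power2_norm_eq_inner
        by (simp add: inner_diff_left inner_diff_right inner_add_left inner_add_right inner_commute algebra_simps)
      ultimately have "t * (g x + (y - x) \<bullet> (z - x) - g z) \<le> t * (t * (1/2 * (norm (z - x))\<^sup>2))"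
        by (simp add: \<phi>_def algebra_simps)
      then show ?thesis using t by (simp only: mult_le_cancel_left_pos)
    qed
    then show ?thesis using nonpos_if_le_small_multiples by (metis diff_le_0_iff_le)
  qed
  then show ?thesis by (auto simp: subgradient_def)
qed

lemma subgradient_resolvent_nonexpansive:
  assumes "subgradient g x (y - x)" "subgradient g x' (y' - x')"
  shows "norm (x - x') \<le> norm (y - y')"
proof -
  have "(norm (x - x'))\<^sup>2 \<le> (y - y') \<bullet> (x - x')"
    using subgradientD[OF assms(1), of x'] subgradientD[OF assms(2), of x]
    by (simp add: power2_norm_eq_inner inner_diff_left inner_diff_right inner_commute algebra_simps)
  also have "\<dots> \<le> norm (y - y') * norm (x - x')" by (rule norm_cauchy_schwarz)
  finally show ?thesis by (cases "x = x'") (auto simp: power2_eq_square)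
qed

lemma subgradient_eq_if_touched_above:
  assumes sub: "subgradient g x q'" and up: "\<And>h. g (x + h) \<le> g x + q \<bullet> h + C * (norm h)\<^sup>2"
  shows "q' = q"
proof -
  define N where "N = (norm (q' - q))\<^sup>2"
  have "N \<le> t * (C * N)" if t: "0 < t" "t \<le> 1" for t
  proof -
    have "q' \<bullet> (t *\<^sub>R (q' - q)) \<le> q \<bullet> (t *\<^sub>R (q' - q)) + C * (norm (t *\<^sub>R (q' - q)))\<^sup>2"
      using subgradientD[OF sub, of "x + t *\<^sub>R (q' - q)"] up[of "t *\<^sub>R (q' - q)"] by simp
    moreover have "q' \<bullet> (t *\<^sub>R (q' - q)) - q \<bullet> (t *\<^sub>R (q' - q)) = t * N"
      unfolding N_def power2_norm_eq_inner by (simp add: inner_diff_left right_diff_distrib)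
    moreover have "(norm (t *\<^sub>R (q' - q)))\<^sup>2 = t * (t * N)"
      by (simp add: N_def power_mult_distrib power2_eq_square)
    ultimately have "t * N \<le> t * (t * (C * N))" by (simp add: mult_ac)
    then show ?thesis using t by (simp only: mult_le_cancel_left_pos)
  qed
  then have "N \<le> 0" by (rule nonpos_if_le_small_multiples)
  then show ?thesis by (simp add: N_def)
qed

text \<open>The subgradient inequality at \<open>x'\<close>, tested at the point at distance \<open>|x' - x|\<close> from
\<open>x'\<close> in the direction \<open>q' - q\<close>, bounds \<open>|q' - q| |x' - x|\<close> by the values of the
touching paraboloid at distance at most \<open>2 |x' - x|\<close> from \<open>x\<close>.\<close>

lemma subgradient_lipschitz_where_touched_above:
  assumes sub: "subgradient g x q" and up: "\<And>h. g (x + h) \<le> g x + q \<bullet> h + C * (norm h)\<^sup>2"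
    and sub': "subgradient g x' q'" and C: "C \<ge> 0"
  shows "norm (q' - q) \<le> 4 * C * norm (x' - x)"
proof (cases "q' = q")
  case False
  define D where "D = norm (q' - q)"
  define t where "t = norm (x' - x)"
  have D: "D > 0" using False by (simp add: D_def)
  have "x' \<noteq> x" using False subgradient_eq_if_touched_above[OF _ up] sub' by metis
  then have t: "t > 0" by (simp add: t_def)
  define z where "z = x' + (t / D) *\<^sub>R (q' - q)"
  have "g x' + q' \<bullet> (z - x') \<le> g z" by (rule subgradientD[OF sub'])
  also have "g z \<le> g x + q \<bullet> (z - x) + C * (norm (z - x))\<^sup>2" using up[of "z - x"] by simp
  finally have "g x' + q' \<bullet> (z - x') \<le> g x + q \<bullet> (z - x) + C * (norm (z - x))\<^sup>2" .
  moreover have "g x + q \<bullet> (x' - x) \<le> g x'" by (rule subgradientD[OF sub])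
  ultimately have "(q' - q) \<bullet> (z - x') \<le> C * (norm (z - x))\<^sup>2"
    by (simp add: inner_diff_left inner_diff_right)
  moreover have "(q' - q) \<bullet> (z - x') = t * D"
    using D by (simp add: z_def D_def dot_square_norm power2_eq_square)
  moreover have "norm (z - x) \<le> 2 * t"
  proof -
    have "norm (z - x) \<le> norm (x' - x) + norm ((t / D) *\<^sub>R (q' - q))"
      unfolding z_def by (metis add_diff_eq add.commute norm_triangle_ineq)
    then show ?thesis using D t by (simp add: t_def D_def)
  qed
  then have "C * (norm (z - x))\<^sup>2 \<le> C * (2 * t)\<^sup>2" using C by (intro mult_left_mono power_mono) auto
  ultimately have "t * D \<le> t * (4 * C * t)" by (simp add: power2_eq_square algebra_simps)
  then show ?thesis using t by (simp add: t_def D_def)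
qed (use C in auto)

definition has_second_order_expansion :: "('a::real_inner \<Rightarrow> real) \<Rightarrow> 'a \<Rightarrow> 'a \<Rightarrow> ('a \<Rightarrow> 'a) \<Rightarrow> bool" where
  "has_second_order_expansion g x q M \<longleftrightarrow> bounded_linear M \<and>
     (\<forall>e>0. \<exists>d>0. \<forall>h. norm h < d \<longrightarrow> \<bar>g (x + h) - g x - q \<bullet> h - 1/2 * (M h \<bullet> h)\<bar> \<le> e * (norm h)\<^sup>2)"

text \<open>Splitting \<open>[0, 1]\<close> into \<open>n\<close> equal parts replaces \<open>c\<close> by \<open>c / n\<close>.\<close>

lemma increment_bound_by_subdivision:
  fixes \<phi> :: "real \<Rightarrow> real"
  assumes "\<And>s t. s \<in> {0..1} \<Longrightarrow> t \<in> {0..1} \<Longrightarrow> \<bar>\<phi> t - \<phi> s\<bar> \<le> \<bar>t - s\<bar> * E + (t - s)\<^sup>2 * c"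
  shows "\<bar>\<phi> 1 - \<phi> 0\<bar> \<le> E"
proof -
  have "\<bar>\<phi> 1 - \<phi> 0\<bar> \<le> E + c / real (Suc n)" for n
  proof -
    let ?m = "real (Suc n)"
    have "\<phi> 1 - \<phi> 0 = (\<Sum>k<Suc n. \<phi> (real (Suc k) / ?m) - \<phi> (real k / ?m))"
      using sum_lessThan_telescope[of "\<lambda>k. \<phi> (real k / ?m)" "Suc n"] by simp
    also have "\<bar>\<dots>\<bar> \<le> (\<Sum>k<Suc n. \<bar>\<phi> (real (Suc k) / ?m) - \<phi> (real k / ?m)\<bar>)" by (rule sum_abs)
    also have "\<dots> \<le> (\<Sum>k<Suc n. (1 / ?m) * E + (1 / ?m)\<^sup>2 * c)"
    proof (rule sum_mono)
      fix k assume k: "k \<in> {..<Suc n}"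
      have "real (Suc k) / ?m - real k / ?m = 1 / ?m" by (simp add: diff_divide_distrib[symmetric])
      then show "\<bar>\<phi> (real (Suc k) / ?m) - \<phi> (real k / ?m)\<bar> \<le> (1 / ?m) * E + (1 / ?m)\<^sup>2 * c"
        using assms[of "real k / ?m" "real (Suc k) / ?m"] k by (auto simp: field_simps)
    qed
    also have "\<dots> = ?m * ((1 / ?m) * E + (1 / ?m)\<^sup>2 * c)" by simp
    also have "\<dots> = E + c / ?m"
    proof -
      have *: "m * ((1 / m) * E + (1 / m)\<^sup>2 * c) = E + c / m" if "m \<noteq> 0" for m :: real
        using that by (simp add: power2_eq_square field_simps)
      show ?thesis by (rule *) simp
    qed
    finally show ?thesis .
  qed
  moreover have "(\<lambda>n. E + c / real (Suc n)) \<longlonglongrightarrow> E + 0"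
    by (intro tendsto_add tendsto_const LIMSEQ_Suc[OF lim_const_over_n])
  ultimately show ?thesis using LIMSEQ_le_const[of _ "E + 0"] by (auto intro: LIMSEQ_le_const)
qed

text \<open>Alexandrov's theorem, at points where \<open>g\<close> is touched from above by a paraboloid. The resolvent
\<open>P = (id + \<partial>g)\<^sup>-\<^sup>1\<close> is nonexpansive, so by Rademacher's theorem it is differentiable
outside a null set, and the image of that null set under \<open>P\<close> is the exceptional set \<open>N\<close>.
If \<open>x = P y\<close> is not in \<open>N\<close>, the touching paraboloid makes the inverse of \<open>P\<close>
Lipschitz at \<open>x\<close>, which forces the derivative of \<open>P\<close> at \<open>y\<close> to be invertible.
Hence the subgradients have a first order expansion at \<open>x\<close>, and adding them up along a
segment gives a second order expansion of \<open>g\<close>.\<close>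

theorem alexandrov_where_touched_above:
  fixes g :: "'a::euclidean_space \<Rightarrow> real"
  assumes sub: "\<And>x. \<exists>q. subgradient g x q"
  obtains N where "negligible N"
    "\<And>x q C. x \<notin> N \<Longrightarrow> (\<forall>h. g (x + h) \<le> g x + q \<bullet> h + C * (norm h)\<^sup>2) \<Longrightarrow>
       \<exists>M. has_second_order_expansion g x q M"
proof -
  define P where "P = (\<lambda>y. SOME x. subgradient g x (y - x))"
  have P: "subgradient g (P y) (y - P y)" for y
    unfolding P_def using subgradient_resolvent_exists[OF sub, of y] by (rule someI_ex)
  have Plip: "norm (P y - P y') \<le> norm (y - y')" for y y'
    by (rule subgradient_resolvent_nonexpansive[OF P P])
  have Peq: "P (x + q) = x" if "subgradient g x q" for x q
    using subgradient_resolvent_nonexpansive[OF P[of "x+q"], of x "x+q"] that by simp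
  have lip: "1-lipschitz_on UNIV P" using Plip by (intro lipschitz_onI) (auto simp: dist_norm)
  define N where "N = P ` {y. \<not> P differentiable (at y)}"
  have "negligible N" unfolding N_def
    by (rule negligible_locally_Lipschitz_image[OF order_refl rademacher[OF lip]])
       (use Plip in \<open>auto intro!: exI[of _ UNIV] exI[of _ "1::real"]\<close>)
  moreover have "\<exists>M. has_second_order_expansion g x q M"
    if xN: "x \<notin> N" and up0: "\<And>h. g (x + h) \<le> g x + q \<bullet> h + C0 * (norm h)\<^sup>2" for x q C0
  proof -
    define C where "C = max C0 0"
    have C: "C \<ge> 0" by (simp add: C_def)
    have up: "g (x + h) \<le> g x + q \<bullet> h + C * (norm h)\<^sup>2" for h
      using up0[of h] mult_right_mono[of C0 C "(norm h)\<^sup>2"] by (simp add: C_def)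
    have q: "subgradient g x q" using sub[of x] subgradient_eq_if_touched_above[OF _ up] by blast
    define y where "y = x + q"
    have Py: "P y = x" unfolding y_def by (rule Peq[OF q])
    then have "P differentiable (at y)" using xN by (auto simp: N_def)
    then obtain D where D: "(P has_derivative D) (at y)" by (auto simp: differentiable_def)
    then have Dlin: "bounded_linear D" by (rule has_derivative_bounded_linear)
    then have linD: "linear D" by (rule bounded_linear.linear)
    define B where "B = 4 * C + 1"
    have B: "B \<ge> 1" using C by (simp add: B_def)
    \<comment> \<open>the inverse of \<open>P\<close> is Lipschitz at \<open>x\<close>, against arbitrary \<open>y'\<close>\<close>
    have expand: "norm (y' - y) \<le> B * norm (P y' - x)" for y'
    proof -
      have "norm ((y' - P y') - q) \<le> 4 * C * norm (P y' - x)"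
        by (rule subgradient_lipschitz_where_touched_above[OF q up P C])
      moreover have "y' - y = (P y' - x) + ((y' - P y') - q)" by (simp add: y_def)
      then have "norm (y' - y) \<le> norm (P y' - x) + norm ((y' - P y') - q)" by (metis norm_triangle_ineq)
      ultimately show ?thesis by (simp add: B_def algebra_simps)
    qed
    have Dinj: "norm k \<le> B * norm (D k)" for k
    proof (cases "k = 0")
      case False
      have "norm k - B * norm (D k) \<le> \<eta> * (B * norm k)" if \<eta>: "0 < \<eta>" "\<eta> \<le> 1" for \<eta>
      proof -
        obtain d where d: "d > 0" "\<And>y'. norm (y' - y) < d \<Longrightarrow> norm (P y' - P y - D (y' - y)) \<le> \<eta> * norm (y' - y)"
          using D \<eta> unfolding has_derivative_at_alt by blast
        define t where "t = d / (2 * norm k)"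
        have t: "t > 0" using d False by (simp add: t_def)
        have "norm (t *\<^sub>R k) < d" using d False by (simp add: t_def)
        then have "norm (P (y + t *\<^sub>R k) - P y - t *\<^sub>R D k) \<le> \<eta> * (t * norm k)"
          using d(2)[of "y + t *\<^sub>R k"] t by (simp add: linear_cmul[OF linD])
        then have "norm (P (y + t *\<^sub>R k) - P y) \<le> t * norm (D k) + \<eta> * (t * norm k)"
          using norm_triangle_sub[of "P (y + t *\<^sub>R k) - P y" "t *\<^sub>R D k"] t by (simp only: norm_scaleR abs_of_pos)
        then have "B * norm (P (y + t *\<^sub>R k) - P y) \<le> B * (t * norm (D k) + \<eta> * (t * norm k))"
          using B by (intro mult_left_mono) auto
        moreover have "t * norm k \<le> B * norm (P (y + t *\<^sub>R k) - P y)"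
          using expand[of "y + t *\<^sub>R k"] t Py by simp
        ultimately have "t * (norm k - B * norm (D k)) \<le> t * (\<eta> * (B * norm k))" by (simp add: algebra_simps)
        then show ?thesis using t by (simp only: mult_le_cancel_left_pos)
      qed
      then have "norm k - B * norm (D k) \<le> 0" by (rule nonpos_if_le_small_multiples)
      then show ?thesis by simp
    qed (use B in auto)
    have "inj D"
    proof (rule linear_injective_0[OF linD, THEN iffD2], intro allI impI)
      fix k assume "D k = 0" then show "k = 0" using Dinj[of k] by simp
    qed
    then obtain D' where D': "linear D'" "\<And>h. D (D' h) = h"
      using linear_injective_isomorphism[OF linD] by blast
    have D'b: "norm (D' h) \<le> B * norm h" for h using Dinj[of "D' h"] D'(2) by simp
    define M where "M = (\<lambda>h. D' h - h)"
    have Mlin: "bounded_linear M" unfolding M_def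
      using D'(1) by (intro bounded_linear_sub bounded_linear_ident) (simp add: linear_conv_bounded_linear)
    have "\<exists>d>0. \<forall>h. norm h < d \<longrightarrow> \<bar>g (x + h) - g x - q \<bullet> h - 1/2 * (M h \<bullet> h)\<bar> \<le> e * (norm h)\<^sup>2"
      if e: "e > 0" for e
    proof -
      define \<eta> where "\<eta> = e / B\<^sup>2"
      have \<eta>: "\<eta> > 0" using e B by (simp add: \<eta>_def)
      obtain d where d: "d > 0" "\<And>y'. norm (y' - y) < d \<Longrightarrow> norm (P y' - P y - D (y' - y)) \<le> \<eta> * norm (y' - y)"
        using D \<eta> unfolding has_derivative_at_alt by blast
      have slope: "norm (q' - q - M h) \<le> e * norm h" if h: "norm h < d / B" and q': "subgradient g (x + h) q'" for h q'
      proof -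
        define y' where "y' = x + h + q'"
        have Py': "P y' = x + h" unfolding y'_def by (rule Peq[OF q'])
        have yy: "norm (y' - y) \<le> B * norm h" using expand[of y'] Py' by simp
        also have "\<dots> < d" using h B by (simp add: field_simps)
        finally have "norm (P y' - P y - D (y' - y)) \<le> \<eta> * norm (y' - y)" by (rule d(2))
        then have 1: "norm (h - D (y' - y)) \<le> \<eta> * norm (y' - y)" by (simp add: Py Py')
        also have "\<dots> \<le> \<eta> * (B * norm h)" using yy \<eta> by (intro mult_left_mono) auto
        finally have 2: "norm (h - D (y' - y)) \<le> \<eta> * (B * norm h)" .
        have "D (D' h - (y' - y)) = h - D (y' - y)" by (simp add: linear_diff[OF linD] D'(2))
        then have "norm (D' h - (y' - y)) \<le> B * norm (h - D (y' - y))" using Dinj by metis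
        also have "\<dots> \<le> B * (\<eta> * (B * norm h))" using 2 B by (intro mult_left_mono) auto
        also have "\<dots> = e * norm h" using B by (simp add: \<eta>_def power2_eq_square)
        finally have "norm (D' h - (y' - y)) \<le> e * norm h" .
        moreover have "D' h - (y' - y) = - (q' - q - M h)" by (simp add: y'_def y_def M_def)
        ultimately show ?thesis by (metis norm_minus_cancel)
      qed
      have "\<bar>g (x + h) - g x - q \<bullet> h - 1/2 * (M h \<bullet> h)\<bar> \<le> e * (norm h)\<^sup>2" if h: "norm h < d / B" for h
      proof -
        define m where "m = M h \<bullet> h"
        define \<phi> where "\<phi> = (\<lambda>t. g (x + t *\<^sub>R h) - t * (q \<bullet> h) - 1/2 * t\<^sup>2 * m)"
        have one: "\<phi> t - \<phi> s \<le> \<bar>t - s\<bar> * (e * (norm h)\<^sup>2) + (t - s)\<^sup>2 * (\<bar>m\<bar> / 2)"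
          if s: "s \<in> {0..1}" and t: "t \<in> {0..1}" for s t
        proof -
          obtain r where r: "subgradient g (x + t *\<^sub>R h) r" using sub by blast
          have th: "norm (t *\<^sub>R h) \<le> norm h" using t by (simp add: mult_left_le_one_le)
          then have "norm (r - q - M (t *\<^sub>R h)) \<le> e * norm (t *\<^sub>R h)" using h by (intro slope[OF _ r]) simp
          also have "\<dots> \<le> e * norm h" using th e by (intro mult_left_mono) auto
          finally have "norm (r - q - M (t *\<^sub>R h)) * norm h \<le> e * norm h * norm h" by (rule mult_right_mono) simp
          moreover have "\<bar>(r - q - M (t *\<^sub>R h)) \<bullet> h\<bar> \<le> norm (r - q - M (t *\<^sub>R h)) * norm h"
            by (rule Cauchy_Schwarz_ineq2)
          moreover have "(r - q - M (t *\<^sub>R h)) \<bullet> h = r \<bullet> h - q \<bullet> h - t * m"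
            by (simp add: inner_diff_left m_def linear_cmul[OF bounded_linear.linear[OF Mlin]])
          ultimately have 1: "\<bar>r \<bullet> h - q \<bullet> h - t * m\<bar> \<le> e * (norm h)\<^sup>2"
            by (simp add: power2_eq_square mult.assoc)
          have "g (x + t *\<^sub>R h) + r \<bullet> ((x + s *\<^sub>R h) - (x + t *\<^sub>R h)) \<le> g (x + s *\<^sub>R h)"
            by (rule subgradientD[OF r])
          moreover have "(x + s *\<^sub>R h) - (x + t *\<^sub>R h) = (s - t) *\<^sub>R h" by (simp add: scaleR_left_diff_distrib)
          ultimately have gg: "g (x + t *\<^sub>R h) - g (x + s *\<^sub>R h) \<le> (t - s) * (r \<bullet> h)"
            by (simp add: left_diff_distrib)
          have "\<phi> t - \<phi> s \<le> (t - s) * (r \<bullet> h - q \<bullet> h - t * m) + (t - s)\<^sup>2 * (m / 2)"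
          proof -
            define \<mu> where "\<mu> = m / 2"
            have m2: "m = 2 * \<mu>" by (simp add: \<mu>_def)
            have "\<phi> t - \<phi> s = (g (x + t *\<^sub>R h) - g (x + s *\<^sub>R h)) - (t - s) * (q \<bullet> h) - (t\<^sup>2 - s\<^sup>2) * \<mu>"
              unfolding \<phi>_def m2 by (simp add: left_diff_distrib)
            also have "\<dots> \<le> (t - s) * (r \<bullet> h) - (t - s) * (q \<bullet> h) - (t\<^sup>2 - s\<^sup>2) * \<mu>"
              using gg by simp
            also have "\<dots> = (t - s) * (r \<bullet> h - q \<bullet> h - t * (2 * \<mu>)) + (t - s)\<^sup>2 * \<mu>"
              by algebra
            finally show ?thesis unfolding m2[symmetric] unfolding \<mu>_def .
          qed
          moreover have "(t - s) * (r \<bullet> h - q \<bullet> h - t * m) \<le> \<bar>t - s\<bar> * (e * (norm h)\<^sup>2)"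
          proof -
            have "(t - s) * (r \<bullet> h - q \<bullet> h - t * m) \<le> \<bar>t - s\<bar> * \<bar>r \<bullet> h - q \<bullet> h - t * m\<bar>"
              unfolding abs_mult[symmetric] by (rule abs_ge_self)
            also have "\<dots> \<le> \<bar>t - s\<bar> * (e * (norm h)\<^sup>2)" by (rule mult_left_mono[OF 1]) simp
            finally show ?thesis .
          qed
          moreover have "(t - s)\<^sup>2 * (m / 2) \<le> (t - s)\<^sup>2 * (\<bar>m\<bar> / 2)" by (intro mult_left_mono) auto
          ultimately show ?thesis by linarith
        qed
        have "\<bar>\<phi> 1 - \<phi> 0\<bar> \<le> e * (norm h)\<^sup>2"
        proof (rule increment_bound_by_subdivision)
          fix s t :: real assume st: "s \<in> {0..1}" "t \<in> {0..1}"
          show "\<bar>\<phi> t - \<phi> s\<bar> \<le> \<bar>t - s\<bar> * (e * (norm h)\<^sup>2) + (t - s)\<^sup>2 * (\<bar>m\<bar> / 2)"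
            using one[OF st] one[OF st(2,1)] unfolding abs_minus_commute[of s t] power2_commute[of s t] by linarith
        qed
        then show ?thesis by (simp add: \<phi>_def m_def)
      qed
      then show ?thesis using d B by (intro exI[of _ "d / B"]) auto
    qed
    then show ?thesis using Mlin unfolding has_second_order_expansion_def by blast
  qed
  ultimately show thesis by (intro that[of N]) auto
qed

lemma contact_point_touched_above:
  fixes G :: "'a::real_inner \<Rightarrow> real"
  assumes S: "bounded_linear S" "\<And>x y. S x \<bullet> y = x \<bullet> S y"
    and max: "\<And>y'. G y' - 1/2 * (S y' \<bullet> y') - p \<bullet> y' \<le> G y - 1/2 * (S y \<bullet> y) - p \<bullet> y"
  shows "G (y + h) \<le> G y + (S y + p) \<bullet> h + 1/2 * (S h \<bullet> h)"
proof -
  have "S y \<bullet> h = S h \<bullet> y" using S(2)[of y h] by (simp add: inner_commute)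
  then have "S (y + h) \<bullet> (y + h) = S y \<bullet> y + 2 * (S y \<bullet> h) + S h \<bullet> h"
    by (simp add: linear_add[OF bounded_linear.linear[OF S(1)]] inner_add_left inner_add_right)
  then show ?thesis using max[of "y + h"] by (simp add: inner_add_left inner_add_right algebra_simps)
qed

text \<open>The set collects the points near the strict maximum of \<open>G - S/2\<close> at which some slightly tilted
function \<open>G - S/2 - p\<close> is maximal. At such points \<open>G\<close> lies between an affine function and a
paraboloid, so the tilt \<open>p\<close> is determined by the point and depends on it in a Lipschitz way.
Every small tilt occurs; a null set cannot have a ball as its Lipschitz image.\<close>

lemma jensen_contact_set_not_negligible:
  fixes G :: "'a::euclidean_space \<Rightarrow> real"
  assumes sub: "\<And>x. \<exists>q. subgradient G x q"
    and S: "bounded_linear S" "\<And>x y. S x \<bullet> y = x \<bullet> S y"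
    and strict: "\<And>y. G y - 1/2 * (S y \<bullet> y) \<le> G 0 - c * (norm y)\<^sup>2" and "c > 0" "\<kappa> > 0"
  shows "\<not> negligible {y. norm y < \<kappa> \<and> (\<exists>p. norm p < \<kappa> \<and>
     (\<forall>y'. G y' - 1/2 * (S y' \<bullet> y') - p \<bullet> y' \<le> G y - 1/2 * (S y \<bullet> y) - p \<bullet> y))}"
    (is "\<not> negligible ?K")
proof
  assume neg: "negligible ?K"
  let ?touch = "\<lambda>y p. \<forall>y'. G y' - 1/2 * (S y' \<bullet> y') - p \<bullet> y' \<le> G y - 1/2 * (S y \<bullet> y) - p \<bullet> y"
  have cont: "continuous_on UNIV G"
    using subgradients_imp_convex[OF sub] by (rule convex_on_continuous[OF open_UNIV])
  define s where "s = onorm S"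
  have s: "s \<ge> 0" "norm (S h) \<le> s * norm h" for h
    unfolding s_def using onorm[OF S(1)] onorm_pos_le[OF S(1)] by auto
  have lip: "norm (p' - p) \<le> (3 * s) * norm (y' - y)" if "?touch y p" "?touch y' p'" for y p y' p'
  proof -
    have up: "G (y + h) \<le> G y + (S y + p) \<bullet> h + (s / 2) * (norm h)\<^sup>2" if "?touch y p" for y p h
    proof -
      have "S h \<bullet> h \<le> norm (S h) * norm h" by (rule norm_cauchy_schwarz)
      also have "\<dots> \<le> s * norm h * norm h" using s by (intro mult_right_mono) auto
      finally have "1/2 * (S h \<bullet> h) \<le> (s / 2) * (norm h)\<^sup>2" by (simp add: power2_eq_square)
      moreover have "G (y + h) \<le> G y + (S y + p) \<bullet> h + 1/2 * (S h \<bullet> h)"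
        using that by (intro contact_point_touched_above[OF S]) auto
      ultimately show ?thesis by simp
    qed
    have sg: "subgradient G y (S y + p)" if "?touch y p" for y p
      using sub[of y] subgradient_eq_if_touched_above[OF _ up[OF that]] by blast
    have "norm ((S y' + p') - (S y + p)) \<le> 4 * (s / 2) * norm (y' - y)"
      using subgradient_lipschitz_where_touched_above[OF sg[OF that(1)] up[OF that(1)] sg[OF that(2)]] s by simp
    moreover have "p' - p = ((S y' + p') - (S y + p)) - S (y' - y)"
      by (simp add: linear_diff[OF bounded_linear.linear[OF S(1)]])
    then have "norm (p' - p) \<le> norm ((S y' + p') - (S y + p)) + norm (S (y' - y))"
      by (metis norm_triangle_ineq4)
    ultimately show ?thesis using s(2)[of "y' - y"] by simp
  qed
  define \<tau> where "\<tau> = (\<lambda>y. SOME p. norm p < \<kappa> \<and> ?touch y p)"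
  have \<tau>: "norm (\<tau> y) < \<kappa> \<and> ?touch y (\<tau> y)" if "y \<in> ?K" for y
    unfolding \<tau>_def by (rule someI_ex) (use that in blast)
  have "negligible (\<tau> ` ?K)"
  proof (rule negligible_locally_Lipschitz_image[OF order_refl neg])
    fix y assume y: "y \<in> ?K"
    have "norm (\<tau> y' - \<tau> y) \<le> (3 * s) * norm (y' - y)" if "y' \<in> ?K" for y'
      using lip \<tau>[OF y] \<tau>[OF that] by blast
    then show "\<exists>T B. open T \<and> y \<in> T \<and> (\<forall>y'\<in>?K \<inter> T. norm (\<tau> y' - \<tau> y) \<le> B * norm (y' - y))"
      by (intro exI[of _ UNIV] exI[of _ "3 * s"]) blast
  qed
  moreover define \<delta> where "\<delta> = min \<kappa> (c * \<kappa> / 2)"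
  have \<delta>: "\<delta> > 0" using \<open>c > 0\<close> \<open>\<kappa> > 0\<close> by (simp add: \<delta>_def)
  have "ball 0 \<delta> \<subseteq> \<tau> ` ?K"
  proof
    fix p :: 'a assume "p \<in> ball 0 \<delta>"
    then have p: "norm p < \<delta>" by simp
    define \<Psi> where "\<Psi> = (\<lambda>y. G y - 1/2 * (S y \<bullet> y) - p \<bullet> y)"
    have "continuous_on (cball 0 \<kappa>) \<Psi>" unfolding \<Psi>_def
      by (intro continuous_intros continuous_on_subset[OF cont] bounded_linear.continuous_on[OF S(1)]) auto
    then obtain y where y: "y \<in> cball 0 \<kappa>" "\<And>z. z \<in> cball 0 \<kappa> \<Longrightarrow> \<Psi> z \<le> \<Psi> y"
      using continuous_attains_sup[of "cball 0 \<kappa>" \<Psi>] \<open>\<kappa> > 0\<close> by auto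
    have far: "norm z < \<kappa> / 2" if "\<Psi> z \<ge> \<Psi> 0" for z
    proof (rule ccontr)
      assume "\<not> norm z < \<kappa> / 2"
      then have z: "norm z \<ge> \<kappa> / 2" by simp
      then have zp: "norm z > 0" using \<open>\<kappa> > 0\<close> by linarith
      have "S 0 = 0" using linear_0[OF bounded_linear.linear[OF S(1)]] .
      then have "c * (norm z)\<^sup>2 \<le> - (p \<bullet> z)" using that strict[of z] by (simp add: \<Psi>_def)
      also have "\<dots> \<le> norm p * norm z" using norm_cauchy_schwarz[of "-p" z] by simp
      also have "\<dots> < \<delta> * norm z" using p zp by simp
      also have "\<dots> \<le> (c * \<kappa> / 2) * norm z" by (intro mult_right_mono) (auto simp: \<delta>_def)
      finally have "c * (norm z * norm z) < c * ((\<kappa> / 2) * norm z)" by (simp add: power2_eq_square)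
      then have "norm z < \<kappa> / 2" using \<open>c > 0\<close> zp by (simp only: mult_less_cancel_left_pos mult_less_cancel_right_pos)
      then show False using z by simp
    qed
    have y0: "\<Psi> 0 \<le> \<Psi> y" using y(2)[of 0] \<open>\<kappa> > 0\<close> by simp
    then have ny: "norm y < \<kappa>" using far[of y] \<open>\<kappa> > 0\<close> by simp
    have "\<Psi> z \<le> \<Psi> y" for z
    proof (cases "norm z \<le> \<kappa>")
      case False
      then have "\<Psi> z < \<Psi> 0" using far[of z] \<open>\<kappa> > 0\<close> by force
      then show ?thesis using y0 by simp
    qed (use y in auto)
    then have t: "?touch y p" by (simp add: \<Psi>_def)
    moreover have "norm p < \<kappa>" using p by (simp add: \<delta>_def)
    ultimately have yK: "y \<in> ?K" using ny by blast
    have "norm (\<tau> y - p) \<le> (3 * s) * norm (y - y)"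
      using lip[OF t] \<tau>[OF yK] by blast
    then have "\<tau> y = p" by simp
    then show "p \<in> \<tau> ` ?K" using yK by blast
  qed
  ultimately have "negligible (ball (0::'a) \<delta>)" using negligible_subset by blast
  then show False using \<delta> open_not_negligible[of "ball (0::'a) \<delta>"] by auto
qed

section \<open>Maxima of upper semicontinuous functions\<close>

definition upper_semicont :: "'a::topological_space set \<Rightarrow> ('a \<Rightarrow> real) \<Rightarrow> bool" where
  "upper_semicont D \<phi> \<longleftrightarrow> (\<forall>x\<in>D. \<forall>\<tau>. \<phi> x < \<tau> \<longrightarrow> eventually (\<lambda>y. \<phi> y < \<tau>) (at x within D))"

text \<open>Only an enclosing compact subset of \<open>D\<close> is asked for; it keeps maximizing sequences inside a set
\<open>D\<close> that need not be closed.\<close>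

definition compact_superlevels :: "'a::topological_space set \<Rightarrow> ('a \<Rightarrow> real) \<Rightarrow> bool" where
  "compact_superlevels D \<phi> \<longleftrightarrow> (\<forall>c. \<exists>K. compact K \<and> K \<subseteq> D \<and> {x\<in>D. c \<le> \<phi> x} \<subseteq> K)"

lemma upper_semicont_attains_max:
  assumes "D \<noteq> {}" "upper_semicont D \<phi>" "compact_superlevels D \<phi>"
  obtains x where "x \<in> D" "\<And>y. y \<in> D \<Longrightarrow> \<phi> y \<le> \<phi> x"
proof (rule ccontr)
  assume "\<not> thesis"
  then have neg: "\<forall>x\<in>D. \<exists>y\<in>D. \<phi> x < \<phi> y" using that by (meson not_le)
  obtain x0 where x0: "x0 \<in> D" using assms(1) by auto
  obtain K where K: "compact K" "K \<subseteq> D" "{x\<in>D. \<phi> x0 \<le> \<phi> x} \<subseteq> K"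
    using assms(3) unfolding compact_superlevels_def by blast
  have "\<exists>x' U. x' \<in> D \<and> open U \<and> x \<in> U \<and> (\<forall>y\<in>D \<inter> U. \<phi> y < \<phi> x')" if "x \<in> D" for x
  proof -
    obtain x' where x': "x' \<in> D" "\<phi> x < \<phi> x'" using neg \<open>x \<in> D\<close> by blast
    then obtain U where "open U" "x \<in> U" "\<forall>y\<in>U. y \<noteq> x \<longrightarrow> y \<in> D \<longrightarrow> \<phi> y < \<phi> x'"
      using assms(2) \<open>x \<in> D\<close> unfolding upper_semicont_def eventually_at_topological by meson
    then show ?thesis using x' by (metis IntE)
  qed
  then obtain b U where bU: "\<And>x. x \<in> D \<Longrightarrow> b x \<in> D \<and> open (U x) \<and> x \<in> U x \<and> (\<forall>y\<in>D \<inter> U x. \<phi> y < \<phi> (b x))"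
    by metis
  have oU: "open (U x)" if "x \<in> K" for x using bU[of x] K(2) that by blast
  have cov: "K \<subseteq> (\<Union>x\<in>K. U x)" using bU K(2) by blast
  obtain F where F: "F \<subseteq> K" "finite F" "K \<subseteq> (\<Union>x\<in>F. U x)"
    using compactE_image[of K K U, OF K(1) oU cov] by blast
  have x0K: "x0 \<in> K" using K(3) x0 by auto
  then have "F \<noteq> {}" using F by auto
  then have fin: "finite ((\<lambda>x. \<phi> (b x)) ` F)" and "(\<lambda>x. \<phi> (b x)) ` F \<noteq> {}" using F by auto
  then have "Max ((\<lambda>x. \<phi> (b x)) ` F) \<in> (\<lambda>x. \<phi> (b x)) ` F" using fin by (intro Max_in)
  then obtain x where "x \<in> F" "Max ((\<lambda>x. \<phi> (b x)) ` F) = \<phi> (b x)" by blast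
  then have x: "x \<in> F" "\<And>y. y \<in> F \<Longrightarrow> \<phi> (b y) \<le> \<phi> (b x)"
    using Max_ge[OF fin] by auto
  have cov: "\<phi> y < \<phi> (b x)" if yK: "y \<in> K" for y
  proof -
    obtain z where z: "z \<in> F" "y \<in> U z" using yK F(3) by blast
    then have "\<phi> y < \<phi> (b z)" using bU[of z] that F(1) K(2) by auto
    then show ?thesis using x(2)[OF z(1)] by simp
  qed
  have "b x \<in> D" using bU x(1) F(1) K(2) by blast
  moreover have "\<phi> x0 < \<phi> (b x)" using cov x0K by simp
  ultimately have "b x \<in> K" using K(3) by auto
  then show False using cov by blast
qed

lemma upper_semicont_add:
  assumes "upper_semicont D \<phi>" "upper_semicont D \<psi>"
  shows "upper_semicont D (\<lambda>x. \<phi> x + \<psi> x)"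
  unfolding upper_semicont_def
proof (intro ballI allI impI)
  fix x \<tau> assume x: "x \<in> D" "\<phi> x + \<psi> x < \<tau>"
  define e where "e = (\<tau> - \<phi> x - \<psi> x) / 2"
  have "eventually (\<lambda>y. \<phi> y < \<phi> x + e) (at x within D)" "eventually (\<lambda>y. \<psi> y < \<psi> x + e) (at x within D)"
    using assms x unfolding upper_semicont_def e_def by auto
  then show "eventually (\<lambda>y. \<phi> y + \<psi> y < \<tau>) (at x within D)"
    by eventually_elim (simp add: e_def field_simps)
qed

lemma upper_semicont_if_continuous: "continuous_on D \<psi> \<Longrightarrow> upper_semicont D \<psi>"
  unfolding upper_semicont_def continuous_on_def by (auto intro: order_tendstoD)

lemma compact_superlevels_add_bounded:
  assumes "compact_superlevels D \<phi>" "\<And>x. x \<in> D \<Longrightarrow> \<psi> x \<le> B"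
  shows "compact_superlevels D (\<lambda>x. \<phi> x + \<psi> x)"
  unfolding compact_superlevels_def
proof
  fix c
  obtain K where K: "compact K" "K \<subseteq> D" "{x\<in>D. c - B \<le> \<phi> x} \<subseteq> K"
    using assms(1) unfolding compact_superlevels_def by blast
  have "{x\<in>D. c \<le> \<phi> x + \<psi> x} \<subseteq> {x\<in>D. c - B \<le> \<phi> x}" using assms(2) by (auto) (smt (verit))
  then show "\<exists>K. compact K \<and> K \<subseteq> D \<and> {x\<in>D. c \<le> \<phi> x + \<psi> x} \<subseteq> K" using K by blast
qed

section \<open>Sup-convolutions and the theorem on sums\<close>

text \<open>The Hessian is any linear map: only its quadratic form matters, and matrices are made symmetric
where they are needed.\<close>

definition elliptic_superjet :: "'a::real_inner set \<Rightarrow> ('a \<Rightarrow> real) \<Rightarrow> 'a \<Rightarrow> 'a \<Rightarrow> ('a \<Rightarrow> 'a) \<Rightarrow> bool" where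
  "elliptic_superjet D v x p X \<longleftrightarrow> bounded_linear X \<and>
     (\<forall>e>0. \<exists>d>0. \<forall>x'\<in>D. norm (x' - x) < d \<longrightarrow>
        v x' \<le> v x + p \<bullet> (x' - x) + 1/2 * (X (x' - x) \<bullet> (x' - x)) + e * (norm (x' - x))\<^sup>2)"

text \<open>Here \<open>g y = l/2 |y|\<^sup>2 + sup\<^sub>x (v x - l/2 |x - y|\<^sup>2)\<close> is the sup-convolution of \<open>v\<close> made convex
by a quadratic term: a supremum of affine functions of \<open>y\<close>. The supremum is attained at
\<open>\<xi> y\<close>, and the slope of the affine function selected there is a subgradient.\<close>

lemma sup_convolution_exists:
  fixes v :: "'a::euclidean_space \<Rightarrow> real"
  assumes D: "bounded D" "D \<noteq> {}" and usc: "upper_semicont D v" "compact_superlevels D v"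
  obtains g \<xi> where "\<And>y. \<xi> y \<in> D"
    "\<And>y. g y = v (\<xi> y) - l/2 * (norm (\<xi> y))\<^sup>2 + l * (\<xi> y \<bullet> y)"
    "\<And>x y. x \<in> D \<Longrightarrow> v x - l/2 * (norm x)\<^sup>2 + l * (x \<bullet> y) \<le> g y"
    "\<And>y. subgradient g y (l *\<^sub>R \<xi> y)"
proof -
  obtain R where R: "\<And>x. x \<in> D \<Longrightarrow> norm x \<le> R" using D(1) bounded_iff by blast
  have "\<exists>x\<in>D. \<forall>x'\<in>D. v x' + (- l/2 * (norm x')\<^sup>2 + l * (x' \<bullet> y)) \<le> v x + (- l/2 * (norm x)\<^sup>2 + l * (x \<bullet> y))" for y
  proof (rule upper_semicont_attains_max[OF D(2), where \<phi>="\<lambda>x. v x + (- l/2 * (norm x)\<^sup>2 + l * (x \<bullet> y))"])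
    show "upper_semicont D (\<lambda>x. v x + (- l/2 * (norm x)\<^sup>2 + l * (x \<bullet> y)))"
      by (intro upper_semicont_add usc upper_semicont_if_continuous continuous_intros)
    show "compact_superlevels D (\<lambda>x. v x + (- l/2 * (norm x)\<^sup>2 + l * (x \<bullet> y)))"
    proof (rule compact_superlevels_add_bounded[OF usc(2)])
      fix x assume x: "x \<in> D"
      have "\<bar>l * (x \<bullet> y)\<bar> \<le> \<bar>l\<bar> * (R * norm y)"
        unfolding abs_mult using Cauchy_Schwarz_ineq2[of x y] mult_right_mono[OF R[OF x], of "norm y"]
        by (intro mult_left_mono) auto
      moreover have "- l/2 * (norm x)\<^sup>2 \<le> \<bar>l\<bar>/2 * R\<^sup>2"
      proof -
        have "- l/2 * (norm x)\<^sup>2 \<le> \<bar>l\<bar>/2 * (norm x)\<^sup>2" by (intro mult_right_mono) auto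
        also have "\<dots> \<le> \<bar>l\<bar>/2 * R\<^sup>2" using R[OF x] by (intro mult_left_mono power_mono) auto
        finally show ?thesis .
      qed
      ultimately show "- l/2 * (norm x)\<^sup>2 + l * (x \<bullet> y) \<le> \<bar>l\<bar>/2 * R\<^sup>2 + \<bar>l\<bar> * (R * norm y)" by linarith
    qed
  qed blast
  then obtain \<xi> where \<xi>: "\<And>y. \<xi> y \<in> D"
    "\<And>x y. x \<in> D \<Longrightarrow> v x + (- l/2 * (norm x)\<^sup>2 + l * (x \<bullet> y)) \<le> v (\<xi> y) + (- l/2 * (norm (\<xi> y))\<^sup>2 + l * (\<xi> y \<bullet> y))"
    by metis
  define g where "g = (\<lambda>y. v (\<xi> y) - l/2 * (norm (\<xi> y))\<^sup>2 + l * (\<xi> y \<bullet> y))"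
  have sup: "v x - l/2 * (norm x)\<^sup>2 + l * (x \<bullet> y) \<le> g y" if "x \<in> D" for x y
    using \<xi>(2)[OF that, of y] by (simp add: g_def)
  have "subgradient g y (l *\<^sub>R \<xi> y)" for y
    unfolding subgradient_def
  proof
    fix z show "g y + l *\<^sub>R \<xi> y \<bullet> (z - y) \<le> g z"
      using sup[OF \<xi>(1)[of y], of z] by (simp add: g_def inner_diff_right algebra_simps)
  qed
  then show thesis using that[of \<xi> g] \<xi>(1) sup by (simp add: g_def)
qed

text \<open>Sup-convolution does not lose information: translating \<open>x\<close> and \<open>y\<close> together by \<open>h\<close>
compares \<open>v (x + h)\<close> with \<open>g (y + h)\<close>, so that an expansion of \<open>g\<close> at \<open>y\<close>
yields a superjet of \<open>v\<close> at the maximizing point \<open>x\<close>.\<close>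

lemma superjet_of_sup_convolution:
  fixes v :: "'a::euclidean_space \<Rightarrow> real"
  assumes gx: "g y = v x - l/2 * (norm x)\<^sup>2 + l * (x \<bullet> y)"
    and sup: "\<And>x y. x \<in> D \<Longrightarrow> v x - l/2 * (norm x)\<^sup>2 + l * (x \<bullet> y) \<le> g y"
    and exp: "has_second_order_expansion g y (l *\<^sub>R x) M"
  shows "elliptic_superjet D v x (l *\<^sub>R (x - y)) (\<lambda>h. M h - l *\<^sub>R h)"
  unfolding elliptic_superjet_def
proof (intro conjI allI impI)
  have M: "bounded_linear M" using exp by (simp add: has_second_order_expansion_def)
  then show "bounded_linear (\<lambda>h. M h - l *\<^sub>R h)"
    by (intro bounded_linear_sub bounded_linear_scaleR_right)
  fix e :: real assume "e > 0"
  then obtain d where d: "d > 0"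
    "\<And>h. norm h < d \<Longrightarrow> \<bar>g (y + h) - g y - (l *\<^sub>R x) \<bullet> h - 1/2 * (M h \<bullet> h)\<bar> \<le> e * (norm h)\<^sup>2"
    using exp unfolding has_second_order_expansion_def by blast
  have "v x' \<le> v x + l *\<^sub>R (x - y) \<bullet> (x' - x) + 1/2 * ((M (x' - x) - l *\<^sub>R (x' - x)) \<bullet> (x' - x)) + e * (norm (x' - x))\<^sup>2"
    if x': "x' \<in> D" "norm (x' - x) < d" for x'
  proof -
    define h where "h = x' - x"
    have xh: "x' = x + h" by (simp add: h_def)
    have "v x' - l/2 * (norm x')\<^sup>2 + l * (x' \<bullet> (y + h)) \<le> g (y + h)" by (rule sup[OF x'(1)])
    also have "\<dots> \<le> g y + (l *\<^sub>R x) \<bullet> h + 1/2 * (M h \<bullet> h) + e * (norm h)\<^sup>2"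
      using d(2)[of h] x'(2) by (simp add: h_def abs_le_iff)
    finally show ?thesis
      unfolding gx h_def[symmetric] unfolding xh power2_norm_eq_inner
      by (simp add: inner_diff_left inner_diff_right inner_add_left inner_add_right inner_commute algebra_simps)
  qed
  then show "\<exists>d>0. \<forall>x'\<in>D. norm (x' - x) < d \<longrightarrow> v x' \<le> v x + l *\<^sub>R (x - y) \<bullet> (x' - x)
      + 1/2 * ((M (x' - x) - l *\<^sub>R (x' - x)) \<bullet> (x' - x)) + e * (norm (x' - x))\<^sup>2"
    using d(1) by blast
qed

lemma second_order_expansion_nonneg:
  assumes exp: "has_second_order_expansion g y q M" and sub: "subgradient g y q"
  shows "0 \<le> M h \<bullet> h"
proof -
  have M: "linear M" using exp by (simp add: has_second_order_expansion_def bounded_linear.linear)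
  have "- (M h \<bullet> h) \<le> e * (2 * (norm h)\<^sup>2)" if e: "0 < e" "e \<le> 1" for e
  proof -
    obtain d where d: "d > 0" "\<And>k. norm k < d \<Longrightarrow> \<bar>g (y + k) - g y - q \<bullet> k - 1/2 * (M k \<bullet> k)\<bar> \<le> e * (norm k)\<^sup>2"
      using exp e unfolding has_second_order_expansion_def by blast
    define N where "N = norm h + 1"
    have N: "N > 0" "norm h \<le> N" by (auto simp: N_def add_nonneg_pos)
    define t where "t = d / (2 * N)"
    have t: "t > 0" using d N by (simp add: t_def)
    have "norm (t *\<^sub>R h) < d"
    proof -
      have "t * norm h \<le> t * N" using t N by (intro mult_left_mono) auto
      also have "\<dots> = d / 2" using N by (simp add: t_def)
      finally show ?thesis using t d by simp
    qed
    then have "\<bar>g (y + t *\<^sub>R h) - g y - q \<bullet> (t *\<^sub>R h) - 1/2 * (M (t *\<^sub>R h) \<bullet> (t *\<^sub>R h))\<bar> \<le> e * (norm (t *\<^sub>R h))\<^sup>2"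
      by (rule d(2))
    moreover have "g y + q \<bullet> (t *\<^sub>R h) \<le> g (y + t *\<^sub>R h)" using subgradientD[OF sub, of "y + t *\<^sub>R h"] by simp
    ultimately have "0 \<le> 1/2 * (M (t *\<^sub>R h) \<bullet> (t *\<^sub>R h)) + e * (norm (t *\<^sub>R h))\<^sup>2" unfolding abs_le_iff by linarith
    moreover have "M (t *\<^sub>R h) \<bullet> (t *\<^sub>R h) = t\<^sup>2 * (M h \<bullet> h)" by (simp add: linear_cmul[OF M] power2_eq_square)
    moreover have "(norm (t *\<^sub>R h))\<^sup>2 = t\<^sup>2 * (norm h)\<^sup>2" by (simp add: power_mult_distrib)
    ultimately have "0 \<le> 1/2 * (t\<^sup>2 * (M h \<bullet> h)) + e * (t\<^sup>2 * (norm h)\<^sup>2)" by (simp only:)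
    then have "t\<^sup>2 * (- (M h \<bullet> h)) \<le> t\<^sup>2 * (e * (2 * (norm h)\<^sup>2))" by (simp add: algebra_simps)
    then show ?thesis using t by (simp only: mult_le_cancel_left_pos zero_less_power)
  qed
  then have "- (M h \<bullet> h) \<le> 0" by (rule nonpos_if_le_small_multiples)
  then show ?thesis by simp
qed

text \<open>Compare the expansions at \<open>t h\<close>, divide by \<open>t\<^sup>2\<close> and let \<open>t\<close> tend to zero.\<close>

lemma second_order_expansions_le_touching_form:
  fixes S :: "'a::real_inner \<times> 'b::real_inner \<Rightarrow> 'a \<times> 'b"
  assumes exp: "has_second_order_expansion g1 y1 q1 M1" "has_second_order_expansion g2 y2 q2 M2"
    and S: "linear S"
    and up: "\<And>h1 h2. g1 (y1 + h1) + g2 (y2 + h2) \<le> g1 y1 + g2 y2 + q1 \<bullet> h1 + q2 \<bullet> h2 + 1/2 * (S (h1,h2) \<bullet> (h1,h2))"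
  shows "M1 h1 \<bullet> h1 + M2 h2 \<bullet> h2 \<le> S (h1,h2) \<bullet> (h1,h2)"
proof -
  have M: "linear M1" "linear M2" using exp by (simp_all add: has_second_order_expansion_def bounded_linear.linear)
  let ?m = "M1 h1 \<bullet> h1 + M2 h2 \<bullet> h2 - S (h1,h2) \<bullet> (h1,h2)"
  let ?n = "(norm h1)\<^sup>2 + (norm h2)\<^sup>2"
  have "?m \<le> e * (2 * ?n)" if e: "0 < e" "e \<le> 1" for e
  proof -
    obtain d1 where d1: "d1 > 0" "\<And>k. norm k < d1 \<Longrightarrow> \<bar>g1 (y1 + k) - g1 y1 - q1 \<bullet> k - 1/2 * (M1 k \<bullet> k)\<bar> \<le> e * (norm k)\<^sup>2"
      using exp(1) e unfolding has_second_order_expansion_def by blast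
    obtain d2 where d2: "d2 > 0" "\<And>k. norm k < d2 \<Longrightarrow> \<bar>g2 (y2 + k) - g2 y2 - q2 \<bullet> k - 1/2 * (M2 k \<bullet> k)\<bar> \<le> e * (norm k)\<^sup>2"
      using exp(2) e unfolding has_second_order_expansion_def by blast
    define N where "N = norm h1 + norm h2 + 1"
    have N: "N > 0" "norm h1 \<le> N" "norm h2 \<le> N" by (auto simp: N_def add_nonneg_pos)
    define t where "t = min d1 d2 / (2 * N)"
    have t: "t > 0" using d1 d2 N by (simp add: t_def)
    have tN: "t * N < d1" "t * N < d2" using d1 d2 N by (auto simp: t_def min_def)
    have "t * norm h1 \<le> t * N" "t * norm h2 \<le> t * N" using t N by (simp_all only: mult_le_cancel_left_pos)
    moreover have "norm (t *\<^sub>R h1) = t * norm h1" "norm (t *\<^sub>R h2) = t * norm h2" using t by auto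
    ultimately have "norm (t *\<^sub>R h1) < d1" "norm (t *\<^sub>R h2) < d2" using tN by linarith+
    then have 1: "\<bar>g1 (y1 + t *\<^sub>R h1) - g1 y1 - q1 \<bullet> (t *\<^sub>R h1) - 1/2 * (M1 (t *\<^sub>R h1) \<bullet> (t *\<^sub>R h1))\<bar> \<le> e * (norm (t *\<^sub>R h1))\<^sup>2"
       and 2: "\<bar>g2 (y2 + t *\<^sub>R h2) - g2 y2 - q2 \<bullet> (t *\<^sub>R h2) - 1/2 * (M2 (t *\<^sub>R h2) \<bullet> (t *\<^sub>R h2))\<bar> \<le> e * (norm (t *\<^sub>R h2))\<^sup>2"
      using d1(2) d2(2) by blast+
    have "M1 (t *\<^sub>R h1) \<bullet> (t *\<^sub>R h1) = t\<^sup>2 * (M1 h1 \<bullet> h1)" "M2 (t *\<^sub>R h2) \<bullet> (t *\<^sub>R h2) = t\<^sup>2 * (M2 h2 \<bullet> h2)"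
      by (simp_all add: linear_cmul[OF M(1)] linear_cmul[OF M(2)] power2_eq_square)
    moreover have "S (t *\<^sub>R h1, t *\<^sub>R h2) \<bullet> (t *\<^sub>R h1, t *\<^sub>R h2) = t\<^sup>2 * (S (h1,h2) \<bullet> (h1,h2))"
    proof -
      have *: "(t *\<^sub>R h1, t *\<^sub>R h2) = t *\<^sub>R (h1,h2)" by simp
      show ?thesis unfolding * linear_cmul[OF S] inner_scaleR_left inner_scaleR_right power2_eq_square mult.assoc ..
    qed
    moreover have "(norm (t *\<^sub>R h1))\<^sup>2 = t\<^sup>2 * (norm h1)\<^sup>2" "(norm (t *\<^sub>R h2))\<^sup>2 = t\<^sup>2 * (norm h2)\<^sup>2"
      by (simp_all add: power_mult_distrib)
    ultimately have "1/2 * (t\<^sup>2 * (M1 h1 \<bullet> h1)) + 1/2 * (t\<^sup>2 * (M2 h2 \<bullet> h2)) - e * (t\<^sup>2 * (norm h1)\<^sup>2) - e * (t\<^sup>2 * (norm h2)\<^sup>2)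
        \<le> 1/2 * (t\<^sup>2 * (S (h1,h2) \<bullet> (h1,h2)))"
      using 1 2 up[of "t *\<^sub>R h1" "t *\<^sub>R h2"] by (smt (verit))
    then have "t\<^sup>2 * ?m \<le> t\<^sup>2 * (e * (2 * ?n))" by (simp add: algebra_simps)
    then show ?thesis using t by (simp only: mult_le_cancel_left_pos zero_less_power)
  qed
  then have "?m \<le> 0" by (rule nonpos_if_le_small_multiples)
  then show ?thesis by simp
qed

lemma negligible_cylinders:
  fixes N :: "'a::euclidean_space set"
  assumes "negligible N"
  shows "negligible (N \<times> (UNIV :: 'b::euclidean_space set))" "negligible ((UNIV :: 'b set) \<times> N)"
proof -
  obtain N' where N': "N \<subseteq> N'" "N' \<in> null_sets lborel"
    using assms unfolding negligible_iff_null_sets null_sets_completion_iff2 by blast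
  then have [measurable]: "N' \<in> sets borel" and z: "emeasure lborel N' = 0" by (auto simp: null_sets_def)
  have "emeasure (lborel \<Otimes>\<^sub>M lborel) (N' \<times> (UNIV :: 'b set)) = 0"
    by (subst lborel.emeasure_pair_measure_Times) (simp_all add: z)
  moreover have "emeasure (lborel \<Otimes>\<^sub>M lborel) ((UNIV :: 'b set) \<times> N') = 0"
    by (subst lborel.emeasure_pair_measure_Times) (simp_all add: z)
  moreover have "N' \<times> (UNIV :: 'b set) \<in> sets (lborel \<Otimes>\<^sub>M lborel)" "(UNIV :: 'b set) \<times> N' \<in> sets (lborel \<Otimes>\<^sub>M lborel)"
    by (rule pair_measureI; simp)+
  ultimately have "N' \<times> (UNIV :: 'b set) \<in> null_sets (lborel \<Otimes>\<^sub>M lborel)"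
      "(UNIV :: 'b set) \<times> N' \<in> null_sets (lborel \<Otimes>\<^sub>M lborel)"
    by (simp_all only: null_setsI)
  then have "negligible (N' \<times> (UNIV :: 'b set))" "negligible ((UNIV :: 'b set) \<times> N')"
    unfolding lborel_prod negligible_iff_null_sets by (simp_all only: null_sets_completionI)
  then show "negligible (N \<times> (UNIV :: 'b set))" "negligible ((UNIV :: 'b set) \<times> N)"
    by - (erule negligible_subset, use N'(1) in blast)+
qed

text \<open>The hypothesis says that the sum of the two sup-convolutions is touched from above at the origin by
the quadratic form of \<open>B\<close>. After adding \<open>\<kappa>\<close> to that form the contact is strict, so the
points where a slightly tilted form touches are not negligible, and among them there is one
\<open>(y1, y2)\<close> at which both convolutions have second order expansions. The Hessians there are
ordered as required, and they are carried back to \<open>v1\<close> and \<open>v2\<close> by the maximizing points.\<close>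

theorem theorem_on_sums_approx:
  fixes v1 v2 :: "'a::euclidean_space \<Rightarrow> real" and B :: "'a \<times> 'a \<Rightarrow> 'a \<times> 'a"
  assumes D1: "bounded D1" "0 \<in> D1" "upper_semicont D1 v1" "compact_superlevels D1 v1"
    and D2: "bounded D2" "0 \<in> D2" "upper_semicont D2 v2" "compact_superlevels D2 v2"
    and B: "bounded_linear B" "\<And>x y. B x \<bullet> y = x \<bullet> B y" and l: "l > 0" and \<kappa>: "\<kappa> > 0"
    and max: "\<And>x1 x2 y. x1 \<in> D1 \<Longrightarrow> x2 \<in> D2 \<Longrightarrow>
       v1 x1 + v2 x2 \<le> v1 0 + v2 0 + 1/2 * (B y \<bullet> y + l * (norm ((x1,x2) - y))\<^sup>2)"
  shows "\<exists>x1\<in>D1. \<exists>x2\<in>D2. \<exists>p1 p2 X1 X2. norm x1 < \<kappa> \<and> norm x2 < \<kappa> \<and> norm p1 < \<kappa> \<and> norm p2 < \<kappa> \<and>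
     v1 x1 + v2 x2 \<ge> v1 0 + v2 0 - \<kappa> \<and> elliptic_superjet D1 v1 x1 p1 X1 \<and> elliptic_superjet D2 v2 x2 p2 X2 \<and>
     (\<forall>h1 h2. X1 h1 \<bullet> h1 + X2 h2 \<bullet> h2 \<le> B (h1,h2) \<bullet> (h1,h2) + \<kappa> * (norm (h1,h2))\<^sup>2) \<and>
     (\<forall>h. - l * (norm h)\<^sup>2 \<le> X1 h \<bullet> h) \<and> (\<forall>h. - l * (norm h)\<^sup>2 \<le> X2 h \<bullet> h)"
proof -
  have ne: "D1 \<noteq> {}" "D2 \<noteq> {}" using D1(2) D2(2) by auto
  obtain g1 \<xi>1 where g1: "\<And>y. \<xi>1 y \<in> D1"
    "\<And>y. g1 y = v1 (\<xi>1 y) - l/2 * (norm (\<xi>1 y))\<^sup>2 + l * (\<xi>1 y \<bullet> y)"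
    "\<And>x y. x \<in> D1 \<Longrightarrow> v1 x - l/2 * (norm x)\<^sup>2 + l * (x \<bullet> y) \<le> g1 y"
    "\<And>y. subgradient g1 y (l *\<^sub>R \<xi>1 y)"
    by (rule sup_convolution_exists[OF D1(1) ne(1) D1(3,4), of l]) (rule that; assumption)
  obtain g2 \<xi>2 where g2: "\<And>y. \<xi>2 y \<in> D2"
    "\<And>y. g2 y = v2 (\<xi>2 y) - l/2 * (norm (\<xi>2 y))\<^sup>2 + l * (\<xi>2 y \<bullet> y)"
    "\<And>x y. x \<in> D2 \<Longrightarrow> v2 x - l/2 * (norm x)\<^sup>2 + l * (x \<bullet> y) \<le> g2 y"
    "\<And>y. subgradient g2 y (l *\<^sub>R \<xi>2 y)"
    by (rule sup_convolution_exists[OF D2(1) ne(2) D2(3,4), of l]) (rule that; assumption)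
  define G where "G = (\<lambda>y. g1 (fst y) + g2 (snd y))"
  have Gsub: "\<exists>q. subgradient G y q" for y
  proof
    show "subgradient G y (l *\<^sub>R \<xi>1 (fst y), l *\<^sub>R \<xi>2 (snd y))"
      unfolding subgradient_def
    proof
      fix z
      show "G y + (l *\<^sub>R \<xi>1 (fst y), l *\<^sub>R \<xi>2 (snd y)) \<bullet> (z - y) \<le> G z"
        using subgradientD[OF g1(4), of "fst y" "fst z"] subgradientD[OF g2(4), of "snd y" "snd z"]
        unfolding G_def inner_prod_def fst_conv snd_conv fst_diff snd_diff by linarith
    qed
  qed
  define m where "m = v1 0 + v2 0"
  have Gm: "m \<le> G y" for y
    using g1(3)[OF D1(2), of "fst y"] g2(3)[OF D2(2), of "snd y"] by (simp add: G_def m_def)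
  define S where "S = (\<lambda>y. B y + (l + \<kappa>) *\<^sub>R y)"
  have S: "bounded_linear S" "\<And>x y. S x \<bullet> y = x \<bullet> S y"
  proof -
    show "bounded_linear S" unfolding S_def by (intro bounded_linear_add B(1) bounded_linear_scaleR_right)
    show "S x \<bullet> y = x \<bullet> S y" for x y
      unfolding S_def inner_add_left inner_add_right B(2) inner_scaleR_left inner_scaleR_right ..
  qed
  have Gv: "G y = v1 (\<xi>1 (fst y)) + v2 (\<xi>2 (snd y)) - l/2 * (norm (\<xi>1 (fst y), \<xi>2 (snd y)))\<^sup>2 + l * ((\<xi>1 (fst y), \<xi>2 (snd y)) \<bullet> y)" for y
    unfolding G_def g1(2)[of "fst y"] g2(2)[of "snd y"]
    by (simp add: inner_prod_def power2_norm_eq_inner algebra_simps)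
  have polar: "l * (norm (x - y))\<^sup>2 = l * (norm x)\<^sup>2 - 2 * (l * (x \<bullet> y)) + l * (norm y)\<^sup>2" for x y :: "'a \<times> 'a"
    unfolding power2_norm_eq_inner by (simp add: inner_diff_left inner_diff_right inner_commute algebra_simps)
  have strict: "G y - 1/2 * (S y \<bullet> y) \<le> G 0 - (\<kappa>/2) * (norm y)\<^sup>2" for y
  proof -
    have "v1 (\<xi>1 (fst y)) + v2 (\<xi>2 (snd y)) \<le> m + 1/2 * (B y \<bullet> y + l * (norm ((\<xi>1 (fst y), \<xi>2 (snd y)) - y))\<^sup>2)"
      using max[OF g1(1) g2(1)] by (simp add: m_def)
    then have "G y \<le> m + 1/2 * (B y \<bullet> y) + l/2 * (norm y)\<^sup>2"
      unfolding Gv polar by (simp add: algebra_simps)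
    moreover have "S y \<bullet> y = B y \<bullet> y + (l + \<kappa>) * (norm y)\<^sup>2"
      by (simp add: S_def inner_add_left dot_square_norm)
    ultimately show ?thesis using Gm[of 0] by (simp add: algebra_simps)
  qed
  define s where "s = onorm S"
  have s: "s \<ge> 0" "norm (S h) \<le> s * norm h" for h
    unfolding s_def using onorm[OF S(1)] onorm_pos_le[OF S(1)] by auto
  define W where "W = (s + 1 + l) + (s + 1) / l + l"
  have W: "W > 0" "(s + 1) / l \<le> W" "s + 1 + l \<le> W" "l \<le> W"
  proof -
    have "(s + 1) / l \<ge> 0" using s(1) l by simp
    then show "W > 0" "(s + 1) / l \<le> W" "s + 1 + l \<le> W" "l \<le> W"
      using s(1) l unfolding W_def by linarith+
  qed
  define r where "r = min 1 (\<kappa> / (2 * W))"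
  have r: "r > 0" "r \<le> 1" using \<kappa> W by (auto simp: r_def)
  have "r * W \<le> \<kappa> / 2"
  proof -
    have "r \<le> \<kappa> / (2 * W)" by (simp add: r_def)
    then show ?thesis using W(1) by (simp add: field_simps)
  qed
  then have rW: "r * W < \<kappa>" using \<kappa> by simp
  have gs: "\<exists>q. subgradient g1 y q" "\<exists>q. subgradient g2 y q" for y
    using g1(4)[of y] g2(4)[of y] by blast+
  obtain N1 where N1: "negligible N1"
    "\<And>x q C. x \<notin> N1 \<Longrightarrow> (\<forall>h. g1 (x + h) \<le> g1 x + q \<bullet> h + C * (norm h)\<^sup>2) \<Longrightarrow> \<exists>M. has_second_order_expansion g1 x q M"
    by (rule alexandrov_where_touched_above[OF gs(1)]) (rule that; assumption)
  obtain N2 where N2: "negligible N2"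
    "\<And>x q C. x \<notin> N2 \<Longrightarrow> (\<forall>h. g2 (x + h) \<le> g2 x + q \<bullet> h + C * (norm h)\<^sup>2) \<Longrightarrow> \<exists>M. has_second_order_expansion g2 x q M"
    by (rule alexandrov_where_touched_above[OF gs(2)]) (rule that; assumption)
  let ?K = "{y. norm y < r \<and> (\<exists>p. norm p < r \<and> (\<forall>y'. G y' - 1/2 * (S y' \<bullet> y') - p \<bullet> y' \<le> G y - 1/2 * (S y \<bullet> y) - p \<bullet> y))}"
  have "\<not> negligible ?K"
    by (rule jensen_contact_set_not_negligible[OF Gsub S strict]) (use \<kappa> r in auto)
  moreover have "negligible (N1 \<times> UNIV \<union> UNIV \<times> N2)"
    using negligible_cylinders[OF N1(1)] negligible_cylinders[OF N2(1)] by (simp add: negligible_Un)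
  ultimately obtain y where y: "y \<in> ?K" "y \<notin> N1 \<times> UNIV \<union> UNIV \<times> N2" using negligible_subset by blast
  then obtain p where p: "norm p < r" "\<And>y'. G y' - 1/2 * (S y' \<bullet> y') - p \<bullet> y' \<le> G y - 1/2 * (S y \<bullet> y) - p \<bullet> y"
    and yr: "norm y < r" by blast
  obtain y1 y2 where yy: "y = (y1,y2)" by (cases y)
  have yN: "y1 \<notin> N1" "y2 \<notin> N2" using y(2) by (auto simp: yy)
  define q1 where "q1 = fst (S y + p)"
  define q2 where "q2 = snd (S y + p)"
  have up: "g1 (y1 + h1) + g2 (y2 + h2) \<le> g1 y1 + g2 y2 + q1 \<bullet> h1 + q2 \<bullet> h2 + 1/2 * (S (h1,h2) \<bullet> (h1,h2))" for h1 h2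
    using contact_point_touched_above[OF S p(2), of "(h1,h2)"]
    by (simp add: G_def yy q1_def q2_def inner_prod_def)
  have Sb: "1/2 * (S h \<bullet> h) \<le> s * (norm h)\<^sup>2" for h
  proof -
    have "S h \<bullet> h \<le> norm (S h) * norm h" by (rule norm_cauchy_schwarz)
    also have "\<dots> \<le> s * norm h * norm h" using s by (intro mult_right_mono) auto
    finally have "S h \<bullet> h \<le> s * (norm h)\<^sup>2" by (simp add: power2_eq_square)
    moreover have "0 \<le> s * (norm h)\<^sup>2" using s(1) by simp
    ultimately show ?thesis by linarith
  qed
  have up1: "g1 (y1 + h) \<le> g1 y1 + q1 \<bullet> h + s * (norm h)\<^sup>2" for h
    using up[of h 0] Sb[of "(h,0)"] by simp
  have up2: "g2 (y2 + h) \<le> g2 y2 + q2 \<bullet> h + s * (norm h)\<^sup>2" for h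
    using up[of 0 h] Sb[of "(0,h)"] by simp
  obtain M1 where M1: "has_second_order_expansion g1 y1 q1 M1" using N1(2)[OF yN(1), of q1 s] up1 by blast
  obtain M2 where M2: "has_second_order_expansion g2 y2 q2 M2" using N2(2)[OF yN(2), of q2 s] up2 by blast
  define x1 where "x1 = \<xi>1 y1"
  define x2 where "x2 = \<xi>2 y2"
  have q1: "q1 = l *\<^sub>R x1" unfolding x1_def using subgradient_eq_if_touched_above[OF g1(4) up1] by simp
  have q2: "q2 = l *\<^sub>R x2" unfolding x2_def using subgradient_eq_if_touched_above[OF g2(4) up2] by simp
  have qn: "norm (S y + p) \<le> (s + 1) * r"
  proof -
    have "norm (S y + p) \<le> s * norm y + norm p" using s(2)[of y] norm_triangle_ineq[of "S y" p] by linarith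
    also have "\<dots> \<le> s * r + r" using s(1) yr p(1) by (intro add_mono mult_left_mono) auto
    finally show ?thesis by (simp add: algebra_simps)
  qed
  have q1n: "norm q1 \<le> (s + 1) * r" and q2n: "norm q2 \<le> (s + 1) * r"
  proof -
    have pr: "(q1, q2) = S y + p" unfolding q1_def q2_def by (rule prod.collapse)
    show "norm q1 \<le> (s + 1) * r" using order_trans[OF norm_fst_le[of q1 q2]] qn unfolding pr by blast
    show "norm q2 \<le> (s + 1) * r" using order_trans[OF norm_snd_le[of q2 q1]] qn unfolding pr by blast
  qed
  have yn: "norm y1 \<le> r" "norm y2 \<le> r" using yr norm_fst_le[of y1 y2] norm_snd_le[of y2 y1] by (auto simp: yy)
  have xs: "norm x < \<kappa>" if "norm (l *\<^sub>R x) \<le> (s + 1) * r" for x :: 'a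
  proof -
    have "norm x \<le> r * ((s + 1) / l)" using that l by (simp add: field_simps)
    also have "\<dots> \<le> r * W" using W r by (intro mult_left_mono) auto
    finally show ?thesis using rW by simp
  qed
  have ps: "norm (l *\<^sub>R (x - y)) < \<kappa>" if "norm (l *\<^sub>R x) \<le> (s + 1) * r" "norm y \<le> r" for x y :: 'a
  proof -
    have "norm (l *\<^sub>R (x - y)) \<le> norm (l *\<^sub>R x) + norm (l *\<^sub>R y)" unfolding scaleR_diff_right by (rule norm_triangle_ineq4)
    also have "\<dots> \<le> (s + 1) * r + l * r" using that l by (intro add_mono) auto
    also have "\<dots> = r * (s + 1 + l)" by (simp add: algebra_simps)
    also have "\<dots> \<le> r * W" using W r by (intro mult_left_mono) auto
    finally show ?thesis using rW by simp
  qed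
  have j1: "elliptic_superjet D1 v1 x1 (l *\<^sub>R (x1 - y1)) (\<lambda>h. M1 h - l *\<^sub>R h)"
    by (rule superjet_of_sup_convolution[OF _ g1(3)]) (use g1(2)[of y1] M1[unfolded q1] in \<open>simp_all only: x1_def\<close>)
  have j2: "elliptic_superjet D2 v2 x2 (l *\<^sub>R (x2 - y2)) (\<lambda>h. M2 h - l *\<^sub>R h)"
    by (rule superjet_of_sup_convolution[OF _ g2(3)]) (use g2(2)[of y2] M2[unfolded q2] in \<open>simp_all only: x2_def\<close>)
  have val: "v1 x1 + v2 x2 \<ge> v1 0 + v2 0 - \<kappa>"
  proof -
    have "m \<le> v1 x1 + v2 x2 - l/2 * (norm (x1, x2))\<^sup>2 + l * ((x1, x2) \<bullet> y)"
      using Gm[of y] Gv[of y] by (simp add: x1_def x2_def yy)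
    also have "\<dots> = v1 x1 + v2 x2 - 1/2 * (l * (norm ((x1,x2) - y))\<^sup>2) + l/2 * (norm y)\<^sup>2"
    proof -
      have "V - l/2 * N + l * P = V - 1/2 * (l * N - 2 * (l * P) + l * Y) + l/2 * Y" for V N P Y :: real
        by (simp add: field_simps)
      then show ?thesis unfolding polar[of "(x1,x2)" y] by blast
    qed
    also have "\<dots> \<le> v1 x1 + v2 x2 + l/2 * (norm y)\<^sup>2" using l by simp
    also have "l/2 * (norm y)\<^sup>2 \<le> l * r"
    proof -
      have "(norm y)\<^sup>2 \<le> r\<^sup>2" using yr by (intro power_mono) auto
      also have "\<dots> \<le> r" using r by (simp add: power2_eq_square mult_left_le)
      finally have "l/2 * (norm y)\<^sup>2 \<le> l/2 * r" using l by (intro mult_left_mono) auto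
      then show ?thesis using l r by (simp add: field_simps)
    qed
    also have "l * r \<le> r * W" using W r by (simp add: mult.commute)
    finally show ?thesis using rW by (simp add: m_def)
  qed
  have up': "(M1 h1 - l *\<^sub>R h1) \<bullet> h1 + (M2 h2 - l *\<^sub>R h2) \<bullet> h2 \<le> B (h1,h2) \<bullet> (h1,h2) + \<kappa> * (norm (h1,h2))\<^sup>2" for h1 h2
  proof -
    have "M1 h1 \<bullet> h1 + M2 h2 \<bullet> h2 \<le> S (h1,h2) \<bullet> (h1,h2)"
      by (rule second_order_expansions_le_touching_form[OF M1 M2 bounded_linear.linear[OF S(1)] up])
    moreover have "S (h1,h2) \<bullet> (h1,h2) = B (h1,h2) \<bullet> (h1,h2) + (l + \<kappa>) * (norm (h1,h2))\<^sup>2"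
      unfolding S_def power2_norm_eq_inner by (simp only: inner_add_left inner_scaleR_left)
    moreover have "(norm (h1,h2))\<^sup>2 = h1 \<bullet> h1 + h2 \<bullet> h2" by (simp add: power2_norm_eq_inner)
    ultimately show ?thesis by (simp add: inner_diff_left algebra_simps)
  qed
  have lo1: "- l * (norm h)\<^sup>2 \<le> (M1 h - l *\<^sub>R h) \<bullet> h" for h
    using second_order_expansion_nonneg[OF M1, of h] g1(4)[of y1] q1 by (simp add: x1_def inner_diff_left power2_norm_eq_inner)
  have lo2: "- l * (norm h)\<^sup>2 \<le> (M2 h - l *\<^sub>R h) \<bullet> h" for h
    using second_order_expansion_nonneg[OF M2, of h] g2(4)[of y2] q2 by (simp add: x2_def inner_diff_left power2_norm_eq_inner)
  have xD: "x1 \<in> D1" "x2 \<in> D2" using g1(1) g2(1) by (auto simp: x1_def x2_def)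
  show ?thesis
    using xD xs[of x1] xs[of x2] ps[of x1 y1] ps[of x2 y2] q1 q2 q1n q2n yn val j1 j2 up' lo1 lo2 by blast
qed

section \<open>Parabolic jets and penalization\<close>

text \<open>Almost maximizers of \<open>\<Theta> - N / (2 \<delta>)\<close> accumulate, as \<open>\<delta>\<close> tends to zero, at points where
\<open>N\<close> vanishes and \<open>\<Theta>\<close> is at least \<open>m\<close>.\<close>

lemma penalization_localizes_maxima:
  fixes K :: "'a::metric_space set"
  assumes K: "compact K" and usc: "upper_semicont K \<Theta>" and N: "continuous_on K N" "\<And>x. x \<in> K \<Longrightarrow> 0 \<le> N x"
    and G: "open G" "\<And>x. x \<in> K \<Longrightarrow> N x = 0 \<Longrightarrow> m \<le> \<Theta> x \<Longrightarrow> x \<in> G" and \<delta>0: "\<delta>0 > 0"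
  shows "\<exists>\<delta>>0. \<delta> \<le> \<delta>0 \<and> (\<forall>x\<in>K. m - \<delta> \<le> \<Theta> x - N x / (2 * \<delta>) \<longrightarrow> x \<in> G)"
proof (rule ccontr)
  assume neg: "\<not> ?thesis"
  define \<delta> where "\<delta> = (\<lambda>k::nat. \<delta>0 / real (Suc k))"
  have \<delta>: "\<delta> k > 0" "\<delta> k \<le> \<delta>0" for k using \<delta>0 by (auto simp: \<delta>_def field_simps)
  have \<delta>lim: "\<delta> \<longlonglongrightarrow> 0" unfolding \<delta>_def using LIMSEQ_Suc[OF lim_const_over_n[of \<delta>0]] by simp
  have "\<exists>x\<in>K. m - \<delta> k \<le> \<Theta> x - N x / (2 * \<delta> k) \<and> x \<notin> G" for k using neg \<delta> by blast
  then obtain x where x: "\<And>k. x k \<in> K" "\<And>k. m - \<delta> k \<le> \<Theta> (x k) - N (x k) / (2 * \<delta> k)" "\<And>k. x k \<notin> G" by metis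
  obtain l r where l: "l \<in> K" "strict_mono r" "(x \<circ> r) \<longlonglongrightarrow> l"
    using K x(1) unfolding compact_def by metis
  have "compact_superlevels K \<Theta>" using K unfolding compact_superlevels_def by blast
  then obtain y where y: "y \<in> K" "\<And>x. x \<in> K \<Longrightarrow> \<Theta> x \<le> \<Theta> y"
    using upper_semicont_attains_max[OF _ usc] x(1) by (metis empty_iff)
  have \<delta>r: "(\<lambda>k. \<delta> (r k)) \<longlonglongrightarrow> 0" using LIMSEQ_subseq_LIMSEQ[OF \<delta>lim l(2)] by (simp add: o_def)
  have Nle: "N (x k) \<le> 2 * \<delta> k * (\<Theta> y - m + \<delta>0)" for k
  proof -
    have "N (x k) / (2 * \<delta> k) \<le> \<Theta> y - m + \<delta>0" using x(2)[of k] y(2)[OF x(1)[of k]] \<delta>(2)[of k] by linarith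
    then show ?thesis using \<delta>(1)[of k] by (simp add: field_simps)
  qed
  have "(\<lambda>k. N (x (r k))) \<longlonglongrightarrow> N l"
    using N(1) l(1,3) x(1) unfolding continuous_on_sequentially by (auto simp: o_def)
  moreover have "(\<lambda>k. 2 * \<delta> (r k) * (\<Theta> y - m + \<delta>0)) \<longlonglongrightarrow> 2 * 0 * (\<Theta> y - m + \<delta>0)"
    using \<delta>r by (intro tendsto_intros)
  ultimately have "N l \<le> 2 * 0 * (\<Theta> y - m + \<delta>0)" using Nle by (intro LIMSEQ_le) auto
  then have Nl: "N l = 0" using N(2)[OF l(1)] by simp
  have "m \<le> \<Theta> l"
  proof (rule ccontr)
    assume "\<not> m \<le> \<Theta> l"
    define \<tau> where "\<tau> = (\<Theta> l + m) / 2"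
    have \<tau>: "\<Theta> l < \<tau>" "\<tau> < m" using \<open>\<not> m \<le> \<Theta> l\<close> by (auto simp: \<tau>_def)
    obtain d where d: "d > 0" "\<And>y. y \<in> K \<Longrightarrow> y \<noteq> l \<Longrightarrow> dist y l < d \<Longrightarrow> \<Theta> y < \<tau>"
      using usc l(1) \<tau>(1) unfolding upper_semicont_def eventually_at by meson
    have "eventually (\<lambda>k. dist ((x \<circ> r) k) l < d) sequentially" using l(3) d(1) by (rule tendstoD)
    moreover have "eventually (\<lambda>k. \<delta> (r k) < m - \<tau>) sequentially" using \<delta>r \<tau> by (intro order_tendstoD) auto
    ultimately have "eventually (\<lambda>k. False) sequentially"
    proof eventually_elim
      case (elim k)
      have "\<Theta> (x (r k)) < \<tau>" using d(2)[OF x(1)] elim(1) \<tau>(1) by (cases "x (r k) = l") auto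
      moreover have "N (x (r k)) / (2 * \<delta> (r k)) \<ge> 0" using N(2)[OF x(1)] \<delta>(1)[of "r k"] by simp
      ultimately show False using x(2)[of "r k"] elim(2) by linarith
    qed
    then show False by simp
  qed
  then have "l \<in> G" using G(2)[OF l(1) Nl] by simp
  then have "eventually (\<lambda>k. (x \<circ> r) k \<in> G) sequentially" using l(3) G(1) by (intro topological_tendstoD)
  then show False using x(3) by simp
qed

lemma upper_semicont_subset: "upper_semicont S f \<Longrightarrow> D \<subseteq> S \<Longrightarrow> upper_semicont D f"
  unfolding upper_semicont_def using filter_leD[OF at_le] by blast

lemma upper_semicont_compose:
  assumes "upper_semicont D v" "continuous_on UNIV \<phi>" "\<And>x. x \<in> E \<Longrightarrow> \<phi> x \<in> D"
  shows "upper_semicont E (\<lambda>h. v (\<phi> h))"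
  unfolding upper_semicont_def
proof (intro ballI allI impI)
  fix h \<tau> assume h: "h \<in> E" "v (\<phi> h) < \<tau>"
  then have "eventually (\<lambda>y. v y < \<tau>) (at (\<phi> h) within D)" using assms unfolding upper_semicont_def by blast
  then obtain S where S: "open S" "\<phi> h \<in> S" "\<And>y. y \<in> S \<Longrightarrow> y \<noteq> \<phi> h \<Longrightarrow> y \<in> D \<Longrightarrow> v y < \<tau>"
    unfolding eventually_at_topological by blast
  show "eventually (\<lambda>y. v (\<phi> y) < \<tau>) (at h within E)"
    unfolding eventually_at_topological
  proof (intro exI[of _ "\<phi> -` S"] conjI ballI impI)
    show "open (\<phi> -` S)" using assms(2) S(1) by (simp add: open_vimage)
    show "h \<in> \<phi> -` S" using S(2) by simp
    fix k assume "k \<in> \<phi> -` S" "k \<noteq> h" "k \<in> E"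
    then show "v (\<phi> k) < \<tau>" using S(3)[of "\<phi> k"] h(2) assms(3)[of k] by (cases "\<phi> k = \<phi> h") auto
  qed
qed

lemma compact_superlevels_vimage:
  assumes "compact_superlevels D v" "continuous_on UNIV \<psi>" "\<And>x. \<psi> (\<phi> x) = x" "\<And>y. \<phi> (\<psi> y) = y"
  shows "compact_superlevels {h. \<phi> h \<in> D} (\<lambda>h. v (\<phi> h))"
  unfolding compact_superlevels_def
proof
  fix c
  obtain K where K: "compact K" "K \<subseteq> D" "{x\<in>D. c \<le> v x} \<subseteq> K"
    using assms(1) unfolding compact_superlevels_def by blast
  have "compact (\<psi> ` K)" using K(1) assms(2) by (meson compact_continuous_image continuous_on_subset subset_UNIV)
  moreover have "\<psi> ` K \<subseteq> {h. \<phi> h \<in> D}" using K(2) assms(4) by auto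
  moreover have "{x \<in> {h. \<phi> h \<in> D}. c \<le> v (\<phi> x)} \<subseteq> \<psi> ` K"
  proof
    fix x assume "x \<in> {x \<in> {h. \<phi> h \<in> D}. c \<le> v (\<phi> x)}"
    then have "\<phi> x \<in> K" using K(3) by auto
    then show "x \<in> \<psi> ` K" using assms(3)[of x] by (metis imageI)
  qed
  ultimately show "\<exists>K. compact K \<and> K \<subseteq> {h. \<phi> h \<in> D} \<and> {x \<in> {h. \<phi> h \<in> D}. c \<le> v (\<phi> x)} \<subseteq> K" by blast
qed

lemma compact_superlevels_Times:
  assumes v1: "D1 \<noteq> {}" "upper_semicont D1 v1" "compact_superlevels D1 v1"
    and v2: "D2 \<noteq> {}" "upper_semicont D2 v2" "compact_superlevels D2 v2"
  shows "compact_superlevels (D1 \<times> D2) (\<lambda>p. v1 (fst p) + v2 (snd p))"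
  unfolding compact_superlevels_def
proof
  fix c
  obtain a1 where a1: "\<And>y. y \<in> D1 \<Longrightarrow> v1 y \<le> v1 a1" using upper_semicont_attains_max[OF v1] by blast
  obtain a2 where a2: "\<And>y. y \<in> D2 \<Longrightarrow> v2 y \<le> v2 a2" using upper_semicont_attains_max[OF v2] by blast
  obtain K1 where K1: "compact K1" "K1 \<subseteq> D1" "{x\<in>D1. c - v2 a2 \<le> v1 x} \<subseteq> K1"
    using v1(3) unfolding compact_superlevels_def by blast
  obtain K2 where K2: "compact K2" "K2 \<subseteq> D2" "{x\<in>D2. c - v1 a1 \<le> v2 x} \<subseteq> K2"
    using v2(3) unfolding compact_superlevels_def by blast
  have "{x \<in> D1 \<times> D2. c \<le> v1 (fst x) + v2 (snd x)} \<subseteq> K1 \<times> K2"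
  proof
    fix x assume x: "x \<in> {x \<in> D1 \<times> D2. c \<le> v1 (fst x) + v2 (snd x)}"
    then have "fst x \<in> D1" "snd x \<in> D2" by auto
    moreover have "c - v2 a2 \<le> v1 (fst x)" "c - v1 a1 \<le> v2 (snd x)" using x a1[of "fst x"] a2[of "snd x"] by auto
    ultimately have "fst x \<in> K1" "snd x \<in> K2" using K1(3) K2(3) by auto
    then show "x \<in> K1 \<times> K2" by (simp add: mem_Times_iff)
  qed
  then show "\<exists>K. compact K \<and> K \<subseteq> D1 \<times> D2 \<and> {x \<in> D1 \<times> D2. c \<le> v1 (fst x) + v2 (snd x)} \<subseteq> K"
    using K1 K2 by (intro exI[of _ "K1 \<times> K2"]) (auto intro: compact_Times)
qed

text \<open>The barrier \<open>\<eta> / (T - t)\<close> keeps maxima away from the terminal time, where no jets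
of the original functions are available.\<close>

lemma terminal_barrier:
  fixes U :: "real \<times> 'x::euclidean_space \<Rightarrow> real"
  assumes usc: "upper_semicont ({T-r..T} \<times> cball z r) U" and r: "r > 0" and \<eta>: "\<eta> > 0"
  shows "upper_semicont ({T-r..<T} \<times> cball z r) (\<lambda>P. U P - \<eta> / (T - fst P))"
    and "compact_superlevels ({T-r..<T} \<times> cball z r) (\<lambda>P. U P - \<eta> / (T - fst P))"
proof -
  have "upper_semicont ({T-r..<T} \<times> cball z r) (\<lambda>P. U P + (- (\<eta> / (T - fst P))))"
    by (intro upper_semicont_add upper_semicont_subset[OF usc] upper_semicont_if_continuous continuous_intros) auto
  then show "upper_semicont ({T-r..<T} \<times> cball z r) (\<lambda>P. U P - \<eta> / (T - fst P))" by simp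
  have cp: "compact ({T-r..T} \<times> cball z r)" by (intro compact_Times) auto
  then have "compact_superlevels ({T-r..T} \<times> cball z r) U" unfolding compact_superlevels_def by blast
  moreover have "(T, z) \<in> {T-r..T} \<times> cball z r" using r by auto
  ultimately obtain y where y: "\<And>x. x \<in> {T-r..T} \<times> cball z r \<Longrightarrow> U x \<le> U y"
    using upper_semicont_attains_max[OF _ usc] by (metis empty_iff)
  show "compact_superlevels ({T-r..<T} \<times> cball z r) (\<lambda>P. U P - \<eta> / (T - fst P))"
    unfolding compact_superlevels_def
  proof
    fix c
    define C where "C = \<bar>U y - c\<bar> + 1"
    have C: "C > 0" by (simp add: C_def)
    let ?K = "{T-r..T - \<eta>/C} \<times> cball z r"
    have "{P \<in> {T-r..<T} \<times> cball z r. c \<le> U P - \<eta> / (T - fst P)} \<subseteq> ?K"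
    proof
      fix P assume P: "P \<in> {P \<in> {T-r..<T} \<times> cball z r. c \<le> U P - \<eta> / (T - fst P)}"
      then have "P \<in> {T-r..T} \<times> cball z r" by auto
      then have "U P \<le> U y" by (rule y)
      then have "\<eta> / (T - fst P) \<le> C" using P by (auto simp: C_def)
      moreover have "T - fst P > 0" using P by auto
      ultimately have "\<eta> / C \<le> T - fst P" using C by (simp add: field_simps)
      then show "P \<in> ?K" using P by auto
    qed
    moreover have "\<eta> / C > 0" using \<eta> C by simp
    then have "?K \<subseteq> {T-r..<T} \<times> cball z r" by auto
    moreover have "compact ?K" by (intro compact_Times) auto
    ultimately show "\<exists>K. compact K \<and> K \<subseteq> {T-r..<T} \<times> cball z r \<and>
        {x \<in> {T-r..<T} \<times> cball z r. c \<le> U x - \<eta> / (T - fst x)} \<subseteq> K" by blast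
  qed
qed

definition parabolic_jet :: "(real \<times> 'x::real_inner) set \<Rightarrow> (real \<times> 'x \<Rightarrow> real) \<Rightarrow> real \<Rightarrow> 'x \<Rightarrow> real \<Rightarrow> 'x \<Rightarrow> ('x \<Rightarrow> 'x) \<Rightarrow> bool" where
  "parabolic_jet S u s z b p X \<longleftrightarrow> (\<forall>e>0. \<exists>d>0. \<forall>t x. (t,x) \<in> S \<longrightarrow> \<bar>t - s\<bar> < d \<longrightarrow> norm (x - z) < d \<longrightarrow>
     u (t,x) \<le> u (s,z) + b * (t - s) + p \<bullet> (x - z) + 1/2 * (X (x - z) \<bullet> (x - z)) + e * (\<bar>t - s\<bar> + (norm (x - z))\<^sup>2))"

text \<open>Parabolic jets forget second derivatives in time and mixed ones, because \<open>|t - s|\<^sup>2\<close> and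
\<open>|t - s| |x - z|\<close> are \<open>o(|t - s|)\<close>. Hence a superjet in space-time gives a parabolic jet whose
Hessian is the spatial block; the affine part, the time scale \<open>\<rho>\<close> and the barrier only
change the time derivative and the gradient.\<close>

lemma parabolic_jet_of_rescaled_superjet:
  fixes U :: "real \<times> 'x::euclidean_space \<Rightarrow> real"
  assumes jet: "elliptic_superjet D' f (\<tau>0,\<xi>0) (a,c) X" and \<rho>: "\<rho> > 0"
    and f: "\<And>\<tau> \<xi>. f (\<tau>,\<xi>) = U (tt + \<rho> * \<tau>, xx + \<xi>) - \<eta> / (T - (tt + \<rho> * \<tau>)) - (\<rho> * \<beta> * \<tau> + \<pi> \<bullet> \<xi>)"
    and D': "\<And>\<tau> \<xi>. \<bar>tt + \<rho> * \<tau> - t\<bar> < d0 \<Longrightarrow> norm (xx + \<xi> - x) < d0 \<Longrightarrow> tt + \<rho> * \<tau> < T \<Longrightarrow> (\<tau>,\<xi>) \<in> D'"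
    and d0: "d0 > 0" and t: "t = tt + \<rho> * \<tau>0" "t < T" and x: "x = xx + \<xi>0"
  shows "parabolic_jet ({0<..<T} \<times> UNIV) U t x (\<beta> + a / \<rho> + \<eta> / (T - t)\<^sup>2) (\<pi> + c) (\<lambda>\<xi>. snd (X (0,\<xi>)))"
  unfolding parabolic_jet_def
proof (intro allI impI)
  fix e0 :: real assume e0: "e0 > 0"
  define e where "e = e0 / 2"
  have e: "e > 0" using e0 by (simp add: e_def)
  have X: "bounded_linear X" using jet by (simp add: elliptic_superjet_def)
  then have Xl: "linear X" by (rule bounded_linear.linear)
  define K where "K = onorm X"
  have K: "K \<ge> 0" "norm (X k) \<le> K * norm k" for k
    unfolding K_def using onorm[OF X] onorm_pos_le[OF X] by auto
  have Kin: "X k \<bullet> k' \<le> K * norm k * norm k'" for k k'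
    using norm_cauchy_schwarz[of "X k" k'] mult_right_mono[OF K(2)[of k], of "norm k'"] by simp
  obtain d1 where d1: "d1 > 0" "\<And>h. h \<in> D' \<Longrightarrow> norm (h - (\<tau>0,\<xi>0)) < d1 \<Longrightarrow>
      f h \<le> f (\<tau>0,\<xi>0) + (a,c) \<bullet> (h - (\<tau>0,\<xi>0)) + 1/2 * (X (h - (\<tau>0,\<xi>0)) \<bullet> (h - (\<tau>0,\<xi>0))) + e * (norm (h - (\<tau>0,\<xi>0)))\<^sup>2"
    using jet e unfolding elliptic_superjet_def by blast
  have "((\<lambda>s. \<eta> / (T - s)) has_real_derivative \<eta> / (T - t)\<^sup>2) (at t)"
    using t(2) by (auto intro!: derivative_eq_intros simp: power2_eq_square field_simps)
  then have "((\<lambda>s. \<eta> / (T - s)) has_derivative (\<lambda>y. \<eta> / (T - t)\<^sup>2 * y)) (at t)"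
    unfolding has_field_derivative_def .
  then obtain d2 where d2: "d2 > 0" "\<And>s. \<bar>s - t\<bar> < d2 \<Longrightarrow> \<bar>\<eta> / (T - s) - \<eta> / (T - t) - \<eta> / (T - t)\<^sup>2 * (s - t)\<bar> \<le> e * \<bar>s - t\<bar>"
    using e unfolding has_derivative_at_alt by (auto simp: real_norm_def)
  define C where "C = K / (2 * \<rho>) * (1 / \<rho> + 2) + e / \<rho>\<^sup>2 + 1"
  have C: "C > 0" using K(1) \<rho> e by (simp add: C_def add_nonneg_pos)
  define d where "d = min (min d0 d2) (min (min (\<rho> * d1 / 2) (d1 / 2)) (e / C))"
  have d: "d > 0" "d \<le> d0" "d \<le> d2" "d \<le> \<rho> * d1 / 2" "d \<le> d1 / 2" "d \<le> e / C"
  proof -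
    have "0 < \<rho> * d1 / 2" "0 < d1 / 2" "0 < e / C" using d1(1) \<rho> e C by auto
    then show "d > 0" using d0 d2(1) by (simp only: d_def min_less_iff_conj)
    show "d \<le> d0" "d \<le> d2" "d \<le> \<rho> * d1 / 2" "d \<le> d1 / 2" "d \<le> e / C"
      by (simp_all only: d_def min_le_iff_disj order_refl simp_thms)
  qed
  show "\<exists>d>0. \<forall>t' x'. (t', x') \<in> {0<..<T} \<times> UNIV \<longrightarrow> \<bar>t' - t\<bar> < d \<longrightarrow> norm (x' - x) < d \<longrightarrow>
     U (t', x') \<le> U (t, x) + (\<beta> + a / \<rho> + \<eta> / (T - t)\<^sup>2) * (t' - t) + (\<pi> + c) \<bullet> (x' - x)
       + 1 / 2 * (snd (X (0, x' - x)) \<bullet> (x' - x)) + e0 * (\<bar>t' - t\<bar> + (norm (x' - x))\<^sup>2)"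
  proof (intro exI[of _ d] conjI d(1) allI impI)
    fix t' x' assume tx: "(t', x') \<in> {0<..<T} \<times> (UNIV::'x set)" "\<bar>t' - t\<bar> < d" "norm (x' - x) < d"
    define dt where "dt = t' - t"
    define dx where "dx = x' - x"
    define s where "s = dt / \<rho>"
    have s: "dt = \<rho> * s" "\<bar>dt\<bar> = \<rho> * \<bar>s\<bar>" using \<rho> by (auto simp: s_def abs_mult)
    define h where "h = (\<tau>0 + s, \<xi>0 + dx)"
    have hh: "h - (\<tau>0,\<xi>0) = (s,dx)" by (simp add: h_def)
    have t': "tt + \<rho> * (\<tau>0 + s) = t'" "xx + (\<xi>0 + dx) = x'"
      using t(1) x s(1) by (auto simp: dt_def dx_def algebra_simps)
    have hD: "h \<in> D'" unfolding h_def using tx d by (intro D') (auto simp: t')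
    have sb: "\<bar>s\<bar> < d1 / 2"
    proof -
      have "\<rho> * \<bar>s\<bar> < \<rho> * (d1 / 2)" using s(2) tx(2) d(4) by (simp add: dt_def)
      then show ?thesis using \<rho> by (simp only: mult_less_cancel_left_pos)
    qed
    have nsd: "norm (s,dx) \<le> \<bar>s\<bar> + norm dx" using norm_Pair_le[of s dx] by simp
    have "norm (s,dx) < d1" using nsd sb tx(3) d(5) by (simp add: dx_def)
    then have main: "f h \<le> f (\<tau>0,\<xi>0) + (a,c) \<bullet> (s,dx) + 1/2 * (X (s,dx) \<bullet> (s,dx)) + e * (norm (s,dx))\<^sup>2"
      using d1(2)[OF hD] unfolding hh by simp
    have n2: "(norm (s,dx))\<^sup>2 = s\<^sup>2 + (norm dx)\<^sup>2" by (simp add: norm_Pair)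
    have Xsplit: "X (s,dx) \<bullet> (s,dx) \<le> snd (X (0,dx)) \<bullet> dx + K * \<bar>s\<bar> * (\<bar>s\<bar> + 2 * norm dx)"
    proof -
      have "X (s,dx) = X (s,0) + X (0,dx)" using linear_add[OF Xl, of "(s,0)" "(0,dx)"] by simp
      then have "X (s,dx) \<bullet> (s,dx) = X (s,0) \<bullet> (s,dx) + X (0,dx) \<bullet> (s,0) + X (0,dx) \<bullet> (0,dx)"
        by (simp add: inner_prod_def distrib_right inner_add_left)
      moreover have "X (0,dx) \<bullet> (0,dx) = snd (X (0,dx)) \<bullet> dx" by (simp add: inner_prod_def)
      moreover have "X (s,0) \<bullet> (s,dx) \<le> K * \<bar>s\<bar> * (\<bar>s\<bar> + norm dx)"
      proof -
        have "X (s,0) \<bullet> (s,dx) \<le> K * \<bar>s\<bar> * norm (s,dx)" using Kin[of "(s,0)" "(s,dx)"] by simp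
        also have "\<dots> \<le> K * \<bar>s\<bar> * (\<bar>s\<bar> + norm dx)" using nsd K(1) by (intro mult_left_mono) auto
        finally show ?thesis .
      qed
      moreover have "X (0,dx) \<bullet> (s,0) \<le> K * norm dx * \<bar>s\<bar>" using Kin[of "(0,dx)" "(s,0)"] by simp
      ultimately show ?thesis by (simp add: algebra_simps)
    qed
    have small: "1/2 * (K * \<bar>s\<bar> * (\<bar>s\<bar> + 2 * norm dx)) + e * s\<^sup>2 \<le> e * \<bar>dt\<bar>"
    proof -
      have ss: "\<bar>s\<bar> = \<bar>dt\<bar> / \<rho>" using s(2) \<rho> by simp
      have "\<bar>s\<bar> + 2 * norm dx \<le> d / \<rho> + 2 * d"
        unfolding ss using tx \<rho> by (intro add_mono divide_right_mono) (auto simp: dt_def dx_def)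
      then have "K * \<bar>s\<bar> * (\<bar>s\<bar> + 2 * norm dx) \<le> K * \<bar>s\<bar> * (d / \<rho> + 2 * d)"
        using K(1) by (intro mult_left_mono) auto
      moreover have "s\<^sup>2 \<le> \<bar>s\<bar> * (d / \<rho>)"
      proof -
        have "s\<^sup>2 = \<bar>s\<bar> * \<bar>s\<bar>" by (simp add: power2_eq_square)
        also have "\<dots> \<le> \<bar>s\<bar> * (d / \<rho>)" using tx(2) \<rho> unfolding ss[of] by (intro mult_left_mono divide_right_mono) (auto simp: dt_def)
        finally show ?thesis .
      qed
      then have "e * s\<^sup>2 \<le> e * (\<bar>s\<bar> * (d / \<rho>))" using e by (intro mult_left_mono) auto
      ultimately have "1/2 * (K * \<bar>s\<bar> * (\<bar>s\<bar> + 2 * norm dx)) + e * s\<^sup>2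
          \<le> 1/2 * (K * \<bar>s\<bar> * (d / \<rho> + 2 * d)) + e * (\<bar>s\<bar> * (d / \<rho>))" by (simp add: add_mono)
      also have "\<dots> = \<bar>dt\<bar> * (d * (K / (2 * \<rho>) * (1 / \<rho> + 2) + e / \<rho>\<^sup>2))"
        unfolding ss using \<rho> by (simp add: field_simps power2_eq_square)
      also have "\<dots> \<le> \<bar>dt\<bar> * (d * C)" using d(1) by (intro mult_left_mono) (auto simp: C_def)
      also have "\<dots> \<le> \<bar>dt\<bar> * e" using d(6) C by (intro mult_left_mono) (auto simp: field_simps)
      finally show ?thesis by (simp add: mult.commute)
    qed
    have \<eta>le: "\<eta> / (T - t') \<le> \<eta> / (T - t) + \<eta> / (T - t)\<^sup>2 * dt + e * \<bar>dt\<bar>"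
      using d2(2)[of t'] tx(2) d(3) by (simp add: dt_def abs_le_iff)
    have fh: "f h = U (t',x') - \<eta> / (T - t') - (\<rho> * \<beta> * \<tau>0 + \<beta> * dt + \<pi> \<bullet> \<xi>0 + \<pi> \<bullet> dx)"
      unfolding h_def f t' s(1) by (simp add: algebra_simps inner_add_right)
    have f0: "f (\<tau>0,\<xi>0) = U (t,x) - \<eta> / (T - t) - (\<rho> * \<beta> * \<tau>0 + \<pi> \<bullet> \<xi>0)"
      unfolding f t(1) x ..
    have ac: "(a,c) \<bullet> (s,dx) = a / \<rho> * dt + c \<bullet> dx" by (simp add: s_def)
    have "U (t',x') \<le> U (t,x) + \<beta> * dt + a / \<rho> * dt + \<eta> / (T - t)\<^sup>2 * dt + \<pi> \<bullet> dx + c \<bullet> dx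
        + 1/2 * (snd (X (0,dx)) \<bullet> dx) + (2 * e) * \<bar>dt\<bar> + e * (norm dx)\<^sup>2"
      using main Xsplit small \<eta>le unfolding fh f0 ac n2 by (simp add: distrib_left)
    moreover have "(2 * e) * \<bar>dt\<bar> + e * (norm dx)\<^sup>2 \<le> e0 * (\<bar>dt\<bar> + (norm dx)\<^sup>2)"
      using e0 by (simp add: e_def distrib_left)
    ultimately show "U (t', x') \<le> U (t, x) + (\<beta> + a / \<rho> + \<eta> / (T - t)\<^sup>2) * (t' - t) + (\<pi> + c) \<bullet> (x' - x)
       + 1 / 2 * (snd (X (0, x' - x)) \<bullet> (x' - x)) + e0 * (\<bar>t' - t\<bar> + (norm (x' - x))\<^sup>2)"
      unfolding dt_def[symmetric] dx_def[symmetric] inner_add_left distrib_right by linarith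
  qed
qed

section \<open>Approximate jets near the terminal time\<close>

text \<open>The inequality that makes sup-convolution with parameter \<open>1/\<epsilon> + \<parallel>A\<parallel>\<close> compatible with the form of
\<open>A\<close>: write \<open>x = y + h\<close> and estimate the mixed term by
\<open>2 a c \<le> \<epsilon> a\<^sup>2 + c\<^sup>2 / \<epsilon>\<close>.\<close>

lemma quadratic_form_split:
  fixes A :: "'a::real_inner \<Rightarrow> 'a"
  assumes A: "bounded_linear A" "\<And>x y. A x \<bullet> y = x \<bullet> A y" and L: "\<And>h. norm (A h) \<le> L * norm h" and \<epsilon>: "\<epsilon> > 0"
  shows "A x \<bullet> x \<le> A y \<bullet> y + \<epsilon> * (norm (A y))\<^sup>2 + (1 / \<epsilon> + L) * (norm (x - y))\<^sup>2"
proof -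
  define h where "h = x - y"
  have x: "x = y + h" by (simp add: h_def)
  have "A h \<bullet> y = A y \<bullet> h" using A(2)[of h y] by (simp add: inner_commute)
  then have "A x \<bullet> x = A y \<bullet> y + 2 * (A y \<bullet> h) + A h \<bullet> h"
    by (simp add: x linear_add[OF bounded_linear.linear[OF A(1)]] inner_add_left inner_add_right)
  moreover have "A h \<bullet> h \<le> L * (norm h)\<^sup>2"
    using norm_cauchy_schwarz[of "A h" h] mult_right_mono[OF L[of h], of "norm h"] by (simp add: power2_eq_square)
  moreover have "2 * (A y \<bullet> h) \<le> \<epsilon> * (norm (A y))\<^sup>2 + 1 / \<epsilon> * (norm h)\<^sup>2"
  proof -
    have "0 \<le> (norm (\<epsilon> *\<^sub>R A y - h))\<^sup>2" by simp
    also have "\<dots> = \<epsilon> * (\<epsilon> * (norm (A y))\<^sup>2) - \<epsilon> * (2 * (A y \<bullet> h)) + (norm h)\<^sup>2"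
      unfolding power2_norm_eq_inner
      by (simp add: inner_diff_left inner_diff_right inner_commute algebra_simps)
    finally have "\<epsilon> * (2 * (A y \<bullet> h)) \<le> \<epsilon> * (\<epsilon> * (norm (A y))\<^sup>2 + 1 / \<epsilon> * (norm h)\<^sup>2)"
      using \<epsilon> by (simp add: distrib_left)
    then show ?thesis using \<epsilon> by (simp only: mult_le_cancel_left_pos)
  qed
  ultimately show ?thesis by (simp add: h_def[symmetric] distrib_right)
qed

text \<open>The values of \<open>U1\<close> and \<open>U2\<close> at time \<open>T\<close> may be approached along unrelated sequences
of times, so the time variable is doubled: \<open>U1 (t, x1) + U2 (s, x2)\<close> is maximized after
subtracting the test function, \<open>(t - s)\<^sup>2 / (2 \<delta>)\<close> and two barriers. A small \<open>\<delta>\<close> forces the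
maximum close to \<open>(T, z)\<close>; a small barrier, chosen after \<open>\<delta>\<close>, hardly changes
the maximal value and keeps both times below \<open>T\<close>. The theorem on sums is then applied
in space-time. The coupling \<open>(t - s)\<^sup>2 / (2 \<delta>)\<close> has a large Hessian, which would spoil the lower
bound on the spatial Hessians; in the time unit \<open>\<rho>\<close> it becomes as small as needed, while the
spatial part is unaffected. The coupling contributes opposite amounts to the two time derivatives,
and the barriers contribute positive ones, whence \<open>b - \<kappa> \<le> b1 + b2\<close>.\<close>

theorem parabolic_theorem_on_sums_approx:
  fixes U1 U2 :: "real \<times> 'x::euclidean_space \<Rightarrow> real" and A :: "'x \<times> 'x \<Rightarrow> 'x \<times> 'x"
  assumes T: "T > 0"
    and usc: "upper_semicont ({0<..T} \<times> UNIV) U1" "upper_semicont ({0<..T} \<times> UNIV) U2"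
    and app1: "\<And>d. d > 0 \<Longrightarrow> \<exists>t x. 0 < t \<and> t < T \<and> dist (t,x) (T,z1) < d \<and> U1 (T,z1) - d < U1 (t,x)"
    and app2: "\<And>d. d > 0 \<Longrightarrow> \<exists>t x. 0 < t \<and> t < T \<and> dist (t,x) (T,z2) < d \<and> U2 (T,z2) - d < U2 (t,x)"
    and A: "bounded_linear A" "\<And>x y. A x \<bullet> y = x \<bullet> A y" and L: "\<And>h. norm (A h) \<le> L * norm h" "L \<ge> 0"
    and loc: "\<And>\<sigma>. \<sigma> > 0 \<Longrightarrow> \<exists>r>0. \<forall>t x1 x2. 0 < t \<longrightarrow> T - r \<le> t \<longrightarrow> t \<le> T \<longrightarrow> norm (x1 - z1) \<le> r \<longrightarrow> norm (x2 - z2) \<le> r \<longrightarrow>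
       U1 (t,x1) + U2 (t,x2) \<le> U1 (T,z1) + U2 (T,z2) + b * (t - T) + p1 \<bullet> (x1 - z1) + p2 \<bullet> (x2 - z2)
         + 1/2 * (A (x1 - z1, x2 - z2) \<bullet> (x1 - z1, x2 - z2)) + \<sigma> * ((T - t) + (norm (x1 - z1, x2 - z2))\<^sup>2)"
    and \<epsilon>: "\<epsilon> > 0" and \<kappa>: "\<kappa> > 0"
  shows "\<exists>t1 x1 t2 x2 b1 b2 q1 q2 X1 X2. 0 < t1 \<and> t1 < T \<and> 0 < t2 \<and> t2 < T \<and> T - t1 < \<kappa> \<and> T - t2 < \<kappa> \<and>
     norm (x1 - z1) < \<kappa> \<and> norm (x2 - z2) < \<kappa> \<and>
     \<bar>U1 (t1,x1) - U1 (T,z1)\<bar> < \<kappa> \<and> \<bar>U2 (t2,x2) - U2 (T,z2)\<bar> < \<kappa> \<and>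
     norm (q1 - p1) < \<kappa> \<and> norm (q2 - p2) < \<kappa> \<and> b - \<kappa> \<le> b1 + b2 \<and>
     parabolic_jet ({0<..<T} \<times> UNIV) U1 t1 x1 b1 q1 X1 \<and> parabolic_jet ({0<..<T} \<times> UNIV) U2 t2 x2 b2 q2 X2 \<and>
     bounded_linear X1 \<and> bounded_linear X2 \<and>
     (\<forall>h1 h2. X1 h1 \<bullet> h1 + X2 h2 \<bullet> h2 \<le> A (h1,h2) \<bullet> (h1,h2) + \<epsilon> * (norm (A (h1,h2)))\<^sup>2 + \<kappa> * (norm (h1,h2))\<^sup>2) \<and>
     (\<forall>h. - (1 / \<epsilon> + L + \<kappa>) * (norm h)\<^sup>2 \<le> X1 h \<bullet> h) \<and> (\<forall>h. - (1 / \<epsilon> + L + \<kappa>) * (norm h)\<^sup>2 \<le> X2 h \<bullet> h)"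
proof -
  define m where "m = U1 (T,z1) + U2 (T,z2)"
  \<comment> \<open>\<open>c0\<close> is chosen such that replacing \<open>A\<close> by \<open>A + 4 \<sigma> I\<close> changes \<open>A + \<epsilon> A\<^sup>2\<close> by at most \<open>\<kappa>/2\<close>\<close>
  define c0 where "c0 = 16 + 16 * \<epsilon> * (L + 2)"
  have c0: "c0 \<ge> 16" using \<epsilon> L(2) by (simp add: c0_def)
  define \<sigma> where "\<sigma> = min 1 (\<kappa> / c0)"
  have \<sigma>: "\<sigma> > 0" "\<sigma> \<le> 1" using \<kappa> c0 by (auto simp: \<sigma>_def)
  have \<sigma>c: "\<sigma> * c0 \<le> \<kappa>"
  proof -
    have "\<sigma> \<le> \<kappa> / c0" by (simp add: \<sigma>_def)
    then show ?thesis using c0 by (simp add: field_simps)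
  qed
  have \<sigma>16: "16 * \<sigma> \<le> \<kappa>" using \<sigma>c mult_left_mono[OF c0, of \<sigma>] \<sigma>(1) by linarith
  define A' where "A' = (\<lambda>h. A h + (4 * \<sigma>) *\<^sub>R h)"
  have A': "bounded_linear A'" unfolding A'_def by (intro bounded_linear_add A(1) bounded_linear_scaleR_right)
  have A's: "A' x \<bullet> y = x \<bullet> A' y" for x y
    unfolding A'_def inner_add_left inner_add_right A(2) inner_scaleR_left inner_scaleR_right ..
  have linA': "linear A'" using A' by (rule bounded_linear.linear)
  have A'L: "norm (A' h) \<le> (L + 4 * \<sigma>) * norm h" for h
    using norm_triangle_ineq[of "A h" "(4 * \<sigma>) *\<^sub>R h"] L(1)[of h] \<sigma>(1) by (simp add: A'_def distrib_right)
  define l where "l = 1 / \<epsilon> + (L + 4 * \<sigma>)"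
  have l: "l > 0" using \<epsilon> L(2) \<sigma>(1) by (simp add: l_def add_pos_nonneg)
  obtain r0 where r0: "r0 > 0" "\<And>t x1 x2. 0 < t \<Longrightarrow> T - r0 \<le> t \<Longrightarrow> t \<le> T \<Longrightarrow> norm (x1 - z1) \<le> r0 \<Longrightarrow> norm (x2 - z2) \<le> r0 \<Longrightarrow>
       U1 (t,x1) + U2 (t,x2) \<le> m + b * (t - T) + p1 \<bullet> (x1 - z1) + p2 \<bullet> (x2 - z2)
         + 1/2 * (A (x1 - z1, x2 - z2) \<bullet> (x1 - z1, x2 - z2)) + \<sigma> * ((T - t) + (norm (x1 - z1, x2 - z2))\<^sup>2)"
    using loc[OF \<sigma>(1)] unfolding m_def by blast
  define r where "r = min r0 (T / 2)"
  have r: "r > 0" "r \<le> r0" "r < T" using r0(1) T by (auto simp: r_def)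
  \<comment> \<open>on the diagonal \<open>t = s\<close> the two time terms add up to the slope \<open>b - 2 \<sigma>\<close>; with the term \<open>4 \<sigma>\<close> in \<open>A'\<close> this makes the maximum strict\<close>
  define Q where "Q = (\<lambda>P1 P2. (b/2 - \<sigma>) * (fst P1 - T) + (b/2 - \<sigma>) * (fst P2 - T) + p1 \<bullet> (snd P1 - z1) + p2 \<bullet> (snd P2 - z2)
      + 1/2 * (A' (snd P1 - z1, snd P2 - z2) \<bullet> (snd P1 - z1, snd P2 - z2)))"
  have diag: "U1 (t,x1) + U2 (t,x2) - Q (t,x1) (t,x2) \<le> m - \<sigma> * (T - t) - \<sigma> * (norm (x1 - z1, x2 - z2))\<^sup>2"
    if "T - r \<le> t" "t \<le> T" "norm (x1 - z1) \<le> r" "norm (x2 - z2) \<le> r" for t x1 x2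
  proof -
    have "A' h \<bullet> h = A h \<bullet> h + 4 * \<sigma> * (norm h)\<^sup>2" for h by (simp add: A'_def inner_add_left power2_norm_eq_inner)
    moreover have "(b/2 - \<sigma>) * (t - T) + (b/2 - \<sigma>) * (t - T) = b * (t - T) + 2 * (\<sigma> * (T - t))" by (simp add: algebra_simps)
    moreover have "0 < t" using that r by linarith
    ultimately show ?thesis using r0(2)[of t x1 x2] that r(2) unfolding Q_def fst_conv snd_conv
      by (simp add: distrib_left)
  qed
  define B0 where "B0 = \<bar>b/2 - \<sigma>\<bar>"
  have B0: "B0 \<ge> 0" by (simp add: B0_def)
  define C5 where "C5 = 2 * B0 + norm p1 + norm p2 + 2 * (L + 4)"
  have C5: "C5 \<ge> 0" using L(2) B0 by (simp add: C5_def)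
  have Qb: "\<bar>Q P1 P2\<bar> \<le> C5 * d" if d: "0 \<le> d" "d \<le> 1" and P: "dist P1 (T,z1) \<le> d" "dist P2 (T,z2) \<le> d" for P1 P2 d
  proof -
    have t: "\<bar>fst P1 - T\<bar> \<le> d" "\<bar>fst P2 - T\<bar> \<le> d"
      using P dist_fst_le[of P1 "(T,z1)"] dist_fst_le[of P2 "(T,z2)"] by (auto simp: dist_real_def)
    have x: "norm (snd P1 - z1) \<le> d" "norm (snd P2 - z2) \<le> d"
      using P dist_snd_le[of P1 "(T,z1)"] dist_snd_le[of P2 "(T,z2)"] by (auto simp: dist_norm)
    let ?h = "(snd P1 - z1, snd P2 - z2)"
    have nh: "norm ?h \<le> 2 * d" using norm_Pair_le[of "snd P1 - z1" "snd P2 - z2"] x by simp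
    have "\<bar>A' ?h \<bullet> ?h\<bar> \<le> norm (A' ?h) * norm ?h" by (rule Cauchy_Schwarz_ineq2)
    also have "\<dots> \<le> ((L + 4 * \<sigma>) * norm ?h) * norm ?h" by (rule mult_right_mono[OF A'L]) simp
    also have "\<dots> \<le> ((L + 4) * (2 * d)) * (2 * d)"
      using nh L(2) \<sigma> d by (intro mult_mono) auto
    also have "\<dots> = 4 * (L + 4) * d * d" by simp
    also have "\<dots> \<le> 4 * (L + 4) * d * 1" using L(2) d by (intro mult_left_mono) auto
    finally have 0: "\<bar>A' ?h \<bullet> ?h\<bar> \<le> 4 * (L + 4) * d * 1" .
    have half: "\<bar>1/2 * x\<bar> \<le> 2 * y * d" if "\<bar>x\<bar> \<le> 4 * y * d * 1" for x y :: real
      using that unfolding abs_le_iff by linarith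
    from half[OF 0] have 1: "\<bar>1/2 * (A' ?h \<bullet> ?h)\<bar> \<le> 2 * (L + 4) * d" .
    have 2: "\<bar>(b/2 - \<sigma>) * (fst P1 - T)\<bar> \<le> B0 * d" "\<bar>(b/2 - \<sigma>) * (fst P2 - T)\<bar> \<le> B0 * d"
      unfolding abs_mult B0_def using t by (auto intro: mult_left_mono)
    have 3: "\<bar>p1 \<bullet> (snd P1 - z1)\<bar> \<le> norm p1 * d" "\<bar>p2 \<bullet> (snd P2 - z2)\<bar> \<le> norm p2 * d"
      using Cauchy_Schwarz_ineq2[of p1 "snd P1 - z1"] Cauchy_Schwarz_ineq2[of p2 "snd P2 - z2"] x
        mult_left_mono[of "norm (snd P1 - z1)" d "norm p1"] mult_left_mono[of "norm (snd P2 - z2)" d "norm p2"] by auto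
    have "C5 * d = 2 * (B0 * d) + norm p1 * d + norm p2 * d + 2 * (L + 4) * d"
      by (simp add: C5_def algebra_simps)
    then show ?thesis unfolding Q_def using 1 2 3 unfolding abs_le_iff by linarith
  qed
  have Qc: "continuous_on UNIV (\<lambda>P. Q (fst P) (snd P))" unfolding Q_def
    by (intro continuous_intros bounded_linear.continuous_on[OF A'])
  have nb: "\<exists>d>0. \<forall>P. P \<in> {0<..T} \<times> UNIV \<longrightarrow> dist P (T,z) < d \<longrightarrow> U P < U (T,z) + \<kappa>/16"
    if "upper_semicont ({0<..T} \<times> UNIV) U" for U :: "real \<times> 'x \<Rightarrow> real" and z
  proof -
    have "(T,z) \<in> {0<..T} \<times> UNIV" using T by simp
    then have "eventually (\<lambda>P. U P < U (T,z) + \<kappa>/16) (at (T,z) within {0<..T} \<times> UNIV)"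
      using that \<kappa> unfolding upper_semicont_def by simp
    then obtain d where "d > 0" "\<And>P. P \<in> {0<..T} \<times> UNIV \<Longrightarrow> P \<noteq> (T,z) \<Longrightarrow> dist P (T,z) < d \<Longrightarrow> U P < U (T,z) + \<kappa>/16"
      unfolding eventually_at by blast
    then show ?thesis using \<kappa> by (intro exI[of _ d]) (metis add.commute less_add_same_cancel2 zero_less_divide_iff zero_less_numeral)
  qed
  obtain d4 where d4: "d4 > 0" "\<And>P. P \<in> {0<..T} \<times> UNIV \<Longrightarrow> dist P (T,z1) < d4 \<Longrightarrow> U1 P < U1 (T,z1) + \<kappa>/16"
    using nb[OF usc(1), of z1] by blast
  obtain d5 where d5: "d5 > 0" "\<And>P. P \<in> {0<..T} \<times> UNIV \<Longrightarrow> dist P (T,z2) < d5 \<Longrightarrow> U2 P < U2 (T,z2) + \<kappa>/16"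
    using nb[OF usc(2), of z2] by blast
  \<comment> \<open>radius of a neighbourhood of \<open>(T, z)\<close> in which the test function and the excess of \<open>U1\<close>, \<open>U2\<close> over their values at \<open>(T, z)\<close> are at most \<open>\<kappa>/16\<close>\<close>
  define k where "k = min (min (min 1 (r/8)) (min (d4/8) (d5/8))) (min (\<kappa> / (16 * (C5 + 1))) (\<kappa> / (16 * (L + 5))))"
  have k: "k > 0" "k \<le> 1" "k \<le> r/8" "k \<le> d4/8" "k \<le> d5/8" "k \<le> \<kappa> / (16 * (C5 + 1))" "k \<le> \<kappa> / (16 * (L + 5))"
  proof -
    have "0 < r/8" "0 < d4/8" "0 < d5/8" "0 < \<kappa> / (16 * (C5 + 1))" "0 < \<kappa> / (16 * (L + 5))"
      using r(1) d4(1) d5(1) \<kappa> C5 L(2) by auto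
    then show "k > 0" by (simp only: k_def min_less_iff_conj zero_less_one)
    show "k \<le> 1" "k \<le> r/8" "k \<le> d4/8" "k \<le> d5/8" "k \<le> \<kappa> / (16 * (C5 + 1))" "k \<le> \<kappa> / (16 * (L + 5))"
      by (simp_all only: k_def min_le_iff_disj order_refl simp_thms)
  qed
  have kC: "(C5 + 1) * k \<le> \<kappa>/16" using k(6) C5 by (simp add: field_simps)
  have kL: "(L + 5) * k \<le> \<kappa>/16" using k(7) L(2) by (simp add: field_simps)
  have "1 * k \<le> (C5 + 1) * k" using C5 k(1) by (intro mult_right_mono) auto
  then have k16: "k \<le> \<kappa>/16" using kC by simp
  have C5k: "C5 * k \<le> \<kappa>/16" using kC k(1) by (simp add: distrib_right)
  define K1 where "K1 = {T-r..T} \<times> cball z1 r"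
  define K2 where "K2 = {T-r..T} \<times> cball z2 r"
  have Kc: "compact K1" "compact K2" unfolding K1_def K2_def by (auto intro: compact_Times)
  have Ksub: "K1 \<subseteq> {0<..T} \<times> UNIV" "K2 \<subseteq> {0<..T} \<times> UNIV" using r by (auto simp: K1_def K2_def)
  define \<Theta> where "\<Theta> = (\<lambda>P. U1 (fst P) + U2 (snd P) - Q (fst P) (snd P))"
  define N where "N = (\<lambda>P::(real \<times> 'x) \<times> (real \<times> 'x). (fst (fst P) - fst (snd P))\<^sup>2)"
  have uscU: "upper_semicont (D1 \<times> D2) (\<lambda>P. U1 (fst P) + U2 (snd P))" if "D1 \<subseteq> {0<..T} \<times> UNIV" "D2 \<subseteq> {0<..T} \<times> UNIV" for D1 D2
    using that by (intro upper_semicont_add upper_semicont_compose[OF usc(1)] upper_semicont_compose[OF usc(2)] continuous_intros) auto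
  have usc\<Theta>: "upper_semicont (K1 \<times> K2) \<Theta>"
  proof -
    have "upper_semicont (K1 \<times> K2) (\<lambda>P. (U1 (fst P) + U2 (snd P)) + (- Q (fst P) (snd P)))"
      by (intro upper_semicont_add uscU Ksub upper_semicont_if_continuous continuous_intros continuous_on_subset[OF Qc]) auto
    then show ?thesis by (simp add: \<Theta>_def)
  qed
  define G where "G = ball (T,z1) k \<times> ball (T,z2) k"
  have "\<exists>\<delta>>0. \<delta> \<le> \<kappa>/16 \<and> (\<forall>P\<in>K1 \<times> K2. m - \<delta> \<le> \<Theta> P - N P / (2 * \<delta>) \<longrightarrow> P \<in> G)"
  proof (rule penalization_localizes_maxima[OF compact_Times[OF Kc] usc\<Theta>])
    show "continuous_on (K1 \<times> K2) N" unfolding N_def by (intro continuous_intros)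
    show "open G" unfolding G_def by (intro open_Times) auto
    show "P \<in> G" if P: "P \<in> K1 \<times> K2" "N P = 0" "m \<le> \<Theta> P" for P
    proof -
      obtain t x1 s x2 where Pe: "P = ((t,x1),(s,x2))" by (metis prod.collapse)
      have s: "s = t" using P(2) by (simp add: N_def Pe)
      have tx: "T - r \<le> t" "t \<le> T" "norm (x1 - z1) \<le> r" "norm (x2 - z2) \<le> r"
        using P(1) by (auto simp: Pe K1_def K2_def dist_norm norm_minus_commute)
      have "m \<le> m - \<sigma> * (T - t) - \<sigma> * (norm (x1 - z1, x2 - z2))\<^sup>2"
        using diag[OF tx] P(3) by (simp add: \<Theta>_def Pe s)
      moreover have "\<sigma> * (T - t) \<ge> 0" "\<sigma> * (norm (x1 - z1, x2 - z2))\<^sup>2 \<ge> 0" using \<sigma>(1) tx by auto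
      ultimately have "\<sigma> * (T - t) = 0" "\<sigma> * (norm (x1 - z1, x2 - z2))\<^sup>2 = 0" by linarith+
      then have "t = T" "x1 = z1" "x2 = z2" using \<sigma>(1) by (auto simp: prod_eq_iff)
      then show "P \<in> G" using k(1) by (simp add: G_def Pe s)
    qed
  qed (use \<kappa> in \<open>auto simp: N_def\<close>)
  then obtain \<delta> where \<delta>: "\<delta> > 0" "\<delta> \<le> \<kappa>/16" "\<And>P. P \<in> K1 \<times> K2 \<Longrightarrow> m - \<delta> \<le> \<Theta> P - N P / (2 * \<delta>) \<Longrightarrow> P \<in> G"
    by blast
  \<comment> \<open>\<open>\<eta>\<close> is fixed by two points before time \<open>T\<close> with almost the terminal values, so that the barriers cost less than \<open>\<delta>\<close>\<close>
  define d where "d = min (min k (\<delta> / (8 * (C5 + 1)))) (\<delta>/8)"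
  have d: "d > 0" "d \<le> k" "d \<le> \<delta> / (8 * (C5 + 1))" "d \<le> \<delta>/8"
  proof -
    have "0 < \<delta> / (8 * (C5 + 1))" "0 < \<delta>/8" using \<delta>(1) C5 by auto
    then show "d > 0" using k(1) by (simp only: d_def min_less_iff_conj)
    show "d \<le> k" "d \<le> \<delta> / (8 * (C5 + 1))" "d \<le> \<delta>/8" by (simp_all only: d_def min_le_iff_disj order_refl simp_thms)
  qed
  have dC: "C5 * d \<le> \<delta>/8"
  proof -
    have "C5 * d \<le> (C5 + 1) * d" using d(1) by (intro mult_right_mono) auto
    also have "\<dots> \<le> \<delta>/8" using d(3) C5 by (simp add: field_simps)
    finally show ?thesis .
  qed
  obtain a1 y1 where a1: "0 < a1" "a1 < T" "dist (a1,y1) (T,z1) < d" "U1 (T,z1) - d < U1 (a1,y1)" using app1[OF d(1)] by blast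
  obtain a2 y2 where a2: "0 < a2" "a2 < T" "dist (a2,y2) (T,z2) < d" "U2 (T,z2) - d < U2 (a2,y2)" using app2[OF d(1)] by blast
  define \<eta> where "\<eta> = min ((T - a1) * \<delta>/8) ((T - a2) * \<delta>/8)"
  have \<eta>: "\<eta> > 0" "\<eta> / (T - a1) \<le> \<delta>/8" "\<eta> / (T - a2) \<le> \<delta>/8" 
  proof -
    show "\<eta> > 0" using a1(2) a2(2) \<delta>(1) by (simp add: \<eta>_def)
    have "\<eta> \<le> (T - a1) * \<delta>/8" "\<eta> \<le> (T - a2) * \<delta>/8" unfolding \<eta>_def by (rule min.cobounded1 min.cobounded2)+
    then show "\<eta> / (T - a1) \<le> \<delta>/8" "\<eta> / (T - a2) \<le> \<delta>/8" using a1(2) a2(2) by (simp_all add: pos_divide_le_eq mult.commute)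
  qed
  define D1 where "D1 = {T-r..<T} \<times> cball z1 r"
  define D2 where "D2 = {T-r..<T} \<times> cball z2 r"
  have DK: "D1 \<subseteq> K1" "D2 \<subseteq> K2" by (auto simp: D1_def K1_def D2_def K2_def)
  define v1 where "v1 = (\<lambda>P. U1 P - \<eta> / (T - fst P))"
  define v2 where "v2 = (\<lambda>P. U2 P - \<eta> / (T - fst P))"
  have v1: "upper_semicont D1 v1" "compact_superlevels D1 v1"
    unfolding D1_def v1_def
    by (rule terminal_barrier[OF upper_semicont_subset[OF usc(1) Ksub(1), unfolded K1_def] r(1) \<eta>(1)])+
  have v2: "upper_semicont D2 v2" "compact_superlevels D2 v2"
    unfolding D2_def v2_def
    by (rule terminal_barrier[OF upper_semicont_subset[OF usc(2) Ksub(2), unfolded K2_def] r(1) \<eta>(1)])+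
  have close: "T - r \<le> t \<and> norm (x - z) \<le> r" if "dist (t,x) (T,z) < k" for t x and z :: 'x
  proof -
    have "\<bar>t - T\<bar> < k" using that dist_fst_le[of "(t,x)" "(T,z)"] by (simp add: dist_real_def)
    moreover have "norm (x - z) < k" using that dist_snd_le[of "(t,x)" "(T,z)"] by (simp add: dist_norm)
    ultimately show ?thesis using k(3) r(1) by auto
  qed
  have aD: "(a1,y1) \<in> D1" "(a2,y2) \<in> D2"
    using close[of a1 y1 z1] close[of a2 y2 z2] a1 a2 d(2) by (auto simp: D1_def D2_def dist_norm norm_minus_commute)
  define W where "W = (\<lambda>P. (v1 (fst P) + v2 (snd P)) + (- Q (fst P) (snd P) - N P / (2 * \<delta>)))"
  have ne: "D1 \<noteq> {}" "D2 \<noteq> {}" using aD by auto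
  have "compact_superlevels (D1 \<times> D2) (\<lambda>P. (v1 (fst P) + v2 (snd P)) + (- Q (fst P) (snd P) - N P / (2 * \<delta>)))"
  proof -
    have "compact ((\<lambda>P. - Q (fst P) (snd P)) ` (K1 \<times> K2))"
      by (intro compact_continuous_image compact_Times Kc continuous_intros continuous_on_subset[OF Qc]) auto
    then have "bdd_above ((\<lambda>P. - Q (fst P) (snd P)) ` (K1 \<times> K2))" by (intro bounded_imp_bdd_above compact_imp_bounded)
    then obtain M where M': "\<forall>y\<in>(\<lambda>P. - Q (fst P) (snd P)) ` (K1 \<times> K2). y \<le> M" unfolding bdd_above_def by blast
    have M: "- Q (fst P) (snd P) \<le> M" if "P \<in> K1 \<times> K2" for P using M' that by blast
    show ?thesis
    proof (rule compact_superlevels_add_bounded[OF compact_superlevels_Times[OF ne(1) v1 ne(2) v2]])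
      fix P assume "P \<in> D1 \<times> D2"
      then have "P \<in> K1 \<times> K2" using DK by auto
      then have "- Q (fst P) (snd P) \<le> M" by (rule M)
      moreover have "N P / (2 * \<delta>) \<ge> 0" using \<delta>(1) by (simp add: N_def)
      ultimately show "- Q (fst P) (snd P) - N P / (2 * \<delta>) \<le> M" by linarith
    qed
  qed
  then have Wc: "compact_superlevels (D1 \<times> D2) W" unfolding W_def .
  have "upper_semicont (D1 \<times> D2) (\<lambda>P. (v1 (fst P) + v2 (snd P)) + (- Q (fst P) (snd P) - N P / (2 * \<delta>)))"
  proof -
    have "continuous_on (D1 \<times> D2) (\<lambda>P. - Q (fst P) (snd P) - N P / (2 * \<delta>))"
      unfolding N_def using \<delta>(1) by (intro continuous_intros continuous_on_subset[OF Qc]) auto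
    note c = upper_semicont_if_continuous[OF this]
    have a: "upper_semicont (D1 \<times> D2) (\<lambda>P. v1 (fst P))"
      by (rule upper_semicont_compose[OF v1(1)]) (auto intro!: continuous_intros)
    have b: "upper_semicont (D1 \<times> D2) (\<lambda>P. v2 (snd P))"
      by (rule upper_semicont_compose[OF v2(1)]) (auto intro!: continuous_intros)
    show ?thesis by (rule upper_semicont_add[OF upper_semicont_add[OF a b] c])
  qed
  then have Wu: "upper_semicont (D1 \<times> D2) W" unfolding W_def .
  have "D1 \<times> D2 \<noteq> {}" using ne by blast
  then obtain P where P: "P \<in> D1 \<times> D2" "\<And>R. R \<in> D1 \<times> D2 \<Longrightarrow> W R \<le> W P"
    by (rule upper_semicont_attains_max[OF _ Wu Wc]) (rule that; assumption)
  obtain \<tau>1 w1 \<tau>2 w2 where Pe: "P = ((\<tau>1,w1),(\<tau>2,w2))" by (metis prod.collapse)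
  have \<tau>: "\<tau>1 < T" "\<tau>2 < T" using P(1) by (auto simp: Pe D1_def D2_def)
  have WP: "m - \<delta> < W P"
  proof -
    have "W ((a1,y1),(a2,y2)) \<le> W P" by (rule P(2)) (use aD in auto)
    moreover have "\<bar>Q (a1,y1) (a2,y2)\<bar> \<le> C5 * d" using a1 a2 d k by (intro Qb) auto
    moreover have "(a1 - a2)\<^sup>2 / (2 * \<delta>) \<le> \<delta>/8"
    proof -
      have "\<bar>a1 - T\<bar> < d" "\<bar>a2 - T\<bar> < d"
        using a1(3) a2(3) dist_fst_le[of "(a1,y1)" "(T,z1)"] dist_fst_le[of "(a2,y2)" "(T,z2)"] by (simp_all add: dist_real_def)
      then have "\<bar>a1 - a2\<bar> \<le> \<delta>/8" using a1(2) a2(2) d(4) by linarith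
      then have "(a1 - a2)\<^sup>2 \<le> (\<delta>/8)\<^sup>2" using abs_le_square_iff[of "a1 - a2" "\<delta>/8"] \<delta>(1) by simp
      then have "(a1 - a2)\<^sup>2 / (2 * \<delta>) \<le> (\<delta>/8)\<^sup>2 / (2 * \<delta>)" using \<delta>(1) by (intro divide_right_mono) auto
      also have "\<dots> = \<delta>/128" using \<delta>(1) by (simp add: power2_eq_square)
      finally show ?thesis using \<delta>(1) by linarith
    qed
    ultimately show ?thesis
      using a1(4) a2(4) d(4) dC \<eta> \<delta>(1) unfolding W_def v1_def v2_def N_def m_def fst_conv snd_conv abs_le_iff by linarith
  qed
  have PU: "U1 (fst P) + U2 (snd P) \<ge> v1 (fst P) + v2 (snd P)"
  proof -
    have "\<eta> / (T - \<tau>1) \<ge> 0" "\<eta> / (T - \<tau>2) \<ge> 0" using \<tau> \<eta>(1) by auto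
    then show ?thesis by (simp add: v1_def v2_def Pe)
  qed
  have "P \<in> G"
  proof (rule \<delta>(3))
    show "P \<in> K1 \<times> K2" using P(1) DK by auto
    show "m - \<delta> \<le> \<Theta> P - N P / (2 * \<delta>)" using WP PU unfolding W_def \<Theta>_def by linarith
  qed
  then have near: "dist (\<tau>1,w1) (T,z1) < k" "dist (\<tau>2,w2) (T,z2) < k" by (auto simp: G_def Pe dist_commute)
  have near': "\<bar>\<tau>1 - T\<bar> < k" "\<bar>\<tau>2 - T\<bar> < k" "norm (w1 - z1) < k" "norm (w2 - z2) < k"
    using near dist_fst_le[of "(\<tau>1,w1)" "(T,z1)"] dist_fst_le[of "(\<tau>2,w2)" "(T,z2)"]
      dist_snd_le[of "(\<tau>1,w1)" "(T,z1)"] dist_snd_le[of "(\<tau>2,w2)" "(T,z2)"] by (auto simp: dist_real_def dist_norm)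
  \<comment> \<open>in the time unit \<open>\<rho>\<close> the Hessian of the coupling is bounded by \<open>l\<close>\<close>
  define \<rho> where "\<rho> = min 1 (l * \<delta> / 4)"
  have \<rho>: "\<rho> > 0" "\<rho> \<le> 1" "\<rho> \<le> l * \<delta> / 4" using l \<delta>(1) by (auto simp: \<rho>_def)
  have \<rho>2: "4 * \<rho>\<^sup>2 / \<delta> \<le> l"
  proof -
    have "\<rho>\<^sup>2 \<le> \<rho> * 1" unfolding power2_eq_square using \<rho> by (intro mult_left_mono) auto
    then have "4 * \<rho>\<^sup>2 \<le> l * \<delta>" using \<rho>(3) by linarith
    then show ?thesis using \<delta>(1) by (simp add: field_simps)
  qed
  define \<beta>1 where "\<beta>1 = b/2 - \<sigma> + (\<tau>1 - \<tau>2) / \<delta>"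
  define \<beta>2 where "\<beta>2 = b/2 - \<sigma> - (\<tau>1 - \<tau>2) / \<delta>"
  define g where "g = A' (w1 - z1, w2 - z2)"
  define \<pi>1 where "\<pi>1 = p1 + fst g"
  define \<pi>2 where "\<pi>2 = p2 + snd g"
  define \<phi> where "\<phi> = (\<lambda>\<tau> w (h::real \<times> 'x). (\<tau> + \<rho> * fst h, w + snd h))"
  define \<psi> where "\<psi> = (\<lambda>\<tau> w (h::real \<times> 'x). ((fst h - \<tau>) / \<rho>, snd h - w))"
  have inv: "\<phi> \<tau> w (\<psi> \<tau> w h) = h" "\<psi> \<tau> w (\<phi> \<tau> w h) = h" for \<tau> w h
    using \<rho> by (auto simp: \<phi>_def \<psi>_def)
  have cont: "continuous_on UNIV (\<phi> \<tau> w)" "continuous_on UNIV (\<psi> \<tau> w)" for \<tau> w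
    unfolding \<phi>_def \<psi>_def using \<rho>(1) by (intro continuous_intros; simp)+
  define E1 where "E1 = {h. \<phi> \<tau>1 w1 h \<in> D1}"
  define E2 where "E2 = {h. \<phi> \<tau>2 w2 h \<in> D2}"
  define f1 where "f1 = (\<lambda>h. v1 (\<phi> \<tau>1 w1 h) - (\<rho> * \<beta>1 * fst h + \<pi>1 \<bullet> snd h))"
  define f2 where "f2 = (\<lambda>h. v2 (\<phi> \<tau>2 w2 h) - (\<rho> * \<beta>2 * fst h + \<pi>2 \<bullet> snd h))"
  have prep: "bounded E \<and> upper_semicont E (\<lambda>h. v (\<phi> \<tau> w h) - (c * fst h + \<pi> \<bullet> snd h)) \<and> compact_superlevels E (\<lambda>h. v (\<phi> \<tau> w h) - (c * fst h + \<pi> \<bullet> snd h))"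
    if E: "E = {h. \<phi> \<tau> w h \<in> D}" and D: "D \<subseteq> K" "compact K" and v: "upper_semicont D v" "compact_superlevels D v"
    for E D K :: "(real \<times> 'x) set" and v and \<tau> c :: real and w \<pi> :: 'x
  proof (intro conjI)
    have cK: "compact (\<psi> \<tau> w ` K)" using D(2) cont(2) by (meson compact_continuous_image continuous_on_subset subset_UNIV)
    moreover have EK: "E \<subseteq> \<psi> \<tau> w ` K"
    proof
      fix h assume "h \<in> E"
      then have "\<phi> \<tau> w h \<in> K" using D(1) by (auto simp: E)
      then have "\<psi> \<tau> w (\<phi> \<tau> w h) \<in> \<psi> \<tau> w ` K" by (rule imageI)
      then show "h \<in> \<psi> \<tau> w ` K" by (simp only: inv(2))
    qed
    ultimately show "bounded E" using bounded_subset compact_imp_bounded by blast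
    have cl: "continuous_on X (\<lambda>h::real \<times> 'x. - (c * fst h + \<pi> \<bullet> snd h))" for X by (intro continuous_intros)
    have "upper_semicont E (\<lambda>h. v (\<phi> \<tau> w h) + (- (c * fst h + \<pi> \<bullet> snd h)))"
      by (intro upper_semicont_add upper_semicont_compose[OF v(1) cont(1)] upper_semicont_if_continuous cl) (simp add: E)
    then show "upper_semicont E (\<lambda>h. v (\<phi> \<tau> w h) - (c * fst h + \<pi> \<bullet> snd h))" unfolding diff_conv_add_uminus .
    have "compact ((\<lambda>h::real \<times> 'x. - (c * fst h + \<pi> \<bullet> snd h)) ` (\<psi> \<tau> w ` K))" by (intro compact_continuous_image cK cl)
    then have "bdd_above ((\<lambda>h::real \<times> 'x. - (c * fst h + \<pi> \<bullet> snd h)) ` (\<psi> \<tau> w ` K))" by (intro bounded_imp_bdd_above compact_imp_bounded)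
    then obtain M where M': "\<forall>y\<in>(\<lambda>h::real \<times> 'x. - (c * fst h + \<pi> \<bullet> snd h)) ` (\<psi> \<tau> w ` K). y \<le> M" unfolding bdd_above_def by blast
    have M: "- (c * fst h + \<pi> \<bullet> snd h) \<le> M" if "h \<in> E" for h using M' EK that by blast
    have "compact_superlevels E (\<lambda>h. v (\<phi> \<tau> w h) + (- (c * fst h + \<pi> \<bullet> snd h)))"
      unfolding E by (rule compact_superlevels_add_bounded[OF compact_superlevels_vimage[OF v(2) cont(2) inv(2) inv(1)]])
        (use M in \<open>simp add: E\<close>)
    then show "compact_superlevels E (\<lambda>h. v (\<phi> \<tau> w h) - (c * fst h + \<pi> \<bullet> snd h))" unfolding diff_conv_add_uminus .
  qed
  have p1: "bounded E1" "upper_semicont E1 f1" "compact_superlevels E1 f1"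
    using prep[OF E1_def DK(1) Kc(1) v1, of "\<rho> * \<beta>1" \<pi>1] unfolding f1_def by auto
  have p2: "bounded E2" "upper_semicont E2 f2" "compact_superlevels E2 f2"
    using prep[OF E2_def DK(2) Kc(2) v2, of "\<rho> * \<beta>2" \<pi>2] unfolding f2_def by auto
  have z0: "0 \<in> E1" "0 \<in> E2" using P(1) by (auto simp: E1_def E2_def \<phi>_def Pe)
  define kk where "kk = 2 * \<rho>\<^sup>2 / \<delta>"
  define BA where "BA = (\<lambda>y. A' y + \<epsilon> *\<^sub>R A' (A' y))"
  have BA: "bounded_linear BA" unfolding BA_def
    by (intro bounded_linear_add A' bounded_linear_compose[OF bounded_linear_scaleR_right bounded_linear_compose[OF A' A']])
  have BAs: "BA x \<bullet> y = x \<bullet> BA y" for x y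
    unfolding BA_def by (simp add: inner_add_left inner_add_right A's)
  have BAq: "BA y \<bullet> y = A' y \<bullet> y + \<epsilon> * (norm (A' y))\<^sup>2" for y
    unfolding BA_def inner_add_left inner_scaleR_left A's[of "A' y" y] power2_norm_eq_inner ..
  define B where "B = (\<lambda>y::(real \<times> 'x) \<times> (real \<times> 'x).
     ((kk * (fst (fst y) - fst (snd y)), fst (BA (snd (fst y), snd (snd y)))),
      (- (kk * (fst (fst y) - fst (snd y))), snd (BA (snd (fst y), snd (snd y))))))"
  have blp: "bounded_linear (\<lambda>y::(real \<times> 'x) \<times> (real \<times> 'x). BA (snd (fst y), snd (snd y)))"
    by (rule bounded_linear_compose[OF BA]) (intro bounded_linear_Pair bounded_linear_snd_comp bounded_linear_fst_comp bounded_linear_ident)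
  have blt: "bounded_linear (\<lambda>y::(real \<times> 'x) \<times> (real \<times> 'x). kk * (fst (fst y) - fst (snd y)))"
    by (intro bounded_linear_mult_right[THEN bounded_linear_compose] bounded_linear_sub bounded_linear_fst_comp bounded_linear_snd_comp bounded_linear_ident)
  have Bl: "bounded_linear B" unfolding B_def
    by (intro bounded_linear_Pair blt bounded_linear_minus bounded_linear_fst_comp[OF blp] bounded_linear_snd_comp[OF blp])
  have Bsym: "B x \<bullet> y = x \<bullet> B y" for x y
  proof -
    have "fst (BA u) \<bullet> fst v + snd (BA u) \<bullet> snd v = fst u \<bullet> fst (BA v) + snd u \<bullet> snd (BA v)" for u v
      using BAs[of u v] by (simp add: inner_prod_def)
    from this[of "(snd (fst x), snd (snd x))" "(snd (fst y), snd (snd y))"]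
    show ?thesis unfolding B_def by (simp add: inner_prod_def algebra_simps)
  qed
  have Bq: "B ((s1,u1),(s2,u2)) \<bullet> ((s1,u1),(s2,u2)) = kk * (s1 - s2)\<^sup>2 + BA (u1,u2) \<bullet> (u1,u2)" for s1 u1 s2 u2
    unfolding B_def by (simp add: inner_prod_def power2_eq_square algebra_simps)
  have max: "f1 h1 + f2 h2 \<le> f1 0 + f2 0 + 1/2 * (B y \<bullet> y + l * (norm ((h1,h2) - y))\<^sup>2)"
    if h: "h1 \<in> E1" "h2 \<in> E2" for h1 h2 y
  proof -
    obtain e1 \<xi>1 e2 \<xi>2 where he: "h1 = (e1,\<xi>1)" "h2 = (e2,\<xi>2)" by (metis prod.collapse)
    obtain s1 u1 s2 u2 where ye: "y = ((s1,u1),(s2,u2))" by (metis prod.collapse)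
    let ?\<xi> = "(\<xi>1,\<xi>2)" and ?u = "(u1,u2)" and ?w = "(w1 - z1, w2 - z2)"
    have "(\<phi> \<tau>1 w1 h1, \<phi> \<tau>2 w2 h2) \<in> D1 \<times> D2" using h by (simp add: E1_def E2_def)
    from P(2)[OF this] have W1: "W (\<phi> \<tau>1 w1 h1, \<phi> \<tau>2 w2 h2) \<le> W P" .
    have Qd: "Q (\<phi> \<tau>1 w1 h1) (\<phi> \<tau>2 w2 h2) = Q (fst P) (snd P) + (b/2 - \<sigma>) * \<rho> * e1 + (b/2 - \<sigma>) * \<rho> * e2 + \<pi>1 \<bullet> \<xi>1 + \<pi>2 \<bullet> \<xi>2 + 1/2 * (A' ?\<xi> \<bullet> ?\<xi>)"
    proof -
      have "(w1 + \<xi>1 - z1, w2 + \<xi>2 - z2) = ?w + ?\<xi>" by simp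
      moreover have "A' ?\<xi> \<bullet> ?w = A' ?w \<bullet> ?\<xi>" using A's[of ?\<xi> ?w] by (simp add: inner_commute)
      then have "A' (?w + ?\<xi>) \<bullet> (?w + ?\<xi>) = A' ?w \<bullet> ?w + 2 * (A' ?w \<bullet> ?\<xi>) + A' ?\<xi> \<bullet> ?\<xi>"
        by (simp only: linear_add[OF linA'] inner_add_left inner_add_right)
      moreover have "A' ?w \<bullet> ?\<xi> = fst g \<bullet> \<xi>1 + snd g \<bullet> \<xi>2" by (simp add: g_def inner_prod_def)
      ultimately have quad: "A' (w1 + \<xi>1 - z1, w2 + \<xi>2 - z2) \<bullet> (w1 + \<xi>1 - z1, w2 + \<xi>2 - z2)
          = A' ?w \<bullet> ?w + 2 * (fst g \<bullet> \<xi>1 + snd g \<bullet> \<xi>2) + A' ?\<xi> \<bullet> ?\<xi>" by (simp only:)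
      have time: "c * (\<tau> + \<rho> * e - T) = c * (\<tau> - T) + c * \<rho> * e" for c \<tau> e by (simp add: algebra_simps)
      have space: "p1 \<bullet> (w1 + \<xi>1 - z1) = p1 \<bullet> (w1 - z1) + p1 \<bullet> \<xi>1" "p2 \<bullet> (w2 + \<xi>2 - z2) = p2 \<bullet> (w2 - z2) + p2 \<bullet> \<xi>2"
        by (simp_all add: inner_diff_right inner_add_right)
      have half: "1/2 * (X + 2 * Y + Z) = 1/2 * X + Y + 1/2 * Z" for X Y Z :: real by simp
      show ?thesis unfolding Q_def \<phi>_def he Pe fst_conv snd_conv quad time space half \<pi>1_def \<pi>2_def inner_add_left
        by (simp only: add_ac)
    qed
    have Nd: "N (\<phi> \<tau>1 w1 h1, \<phi> \<tau>2 w2 h2) / (2 * \<delta>) = N P / (2 * \<delta>) + (\<tau>1 - \<tau>2) / \<delta> * \<rho> * e1 - (\<tau>1 - \<tau>2) / \<delta> * \<rho> * e2 + 1/2 * (\<rho>\<^sup>2 / \<delta> * (e1 - e2)\<^sup>2)"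
    proof -
      have "(\<tau>1 + \<rho> * e1 - (\<tau>2 + \<rho> * e2))\<^sup>2 = (\<tau>1 - \<tau>2)\<^sup>2 + 2 * ((\<tau>1 - \<tau>2) * \<rho> * e1) - 2 * ((\<tau>1 - \<tau>2) * \<rho> * e2) + \<rho>\<^sup>2 * (e1 - e2)\<^sup>2"
        by algebra
      moreover have "(X\<^sup>2 + 2 * (X * \<rho> * e1) - 2 * (X * \<rho> * e2) + \<rho>\<^sup>2 * Y) / (2 * \<delta>)
          = X\<^sup>2 / (2 * \<delta>) + X / \<delta> * \<rho> * e1 - X / \<delta> * \<rho> * e2 + 1/2 * (\<rho>\<^sup>2 / \<delta> * Y)" for X Y
        by (simp add: add_divide_distrib diff_divide_distrib)
      ultimately show ?thesis unfolding N_def \<phi>_def he Pe fst_conv snd_conv by (simp only:)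
    qed
    have f0: "f1 0 = v1 (fst P)" "f2 0 = v2 (snd P)" by (auto simp: f1_def f2_def \<phi>_def Pe)
    have bb: "\<rho> * \<beta>1 * e1 = (b/2 - \<sigma>) * \<rho> * e1 + (\<tau>1 - \<tau>2) / \<delta> * \<rho> * e1" "\<rho> * \<beta>2 * e2 = (b/2 - \<sigma>) * \<rho> * e2 - (\<tau>1 - \<tau>2) / \<delta> * \<rho> * e2"
      unfolding \<beta>1_def \<beta>2_def by (simp_all add: algebra_simps)
    have 1: "f1 h1 + f2 h2 \<le> f1 0 + f2 0 + 1/2 * (A' ?\<xi> \<bullet> ?\<xi>) + 1/2 * (\<rho>\<^sup>2 / \<delta> * (e1 - e2)\<^sup>2)"
    proof -
      have f1h: "f1 h1 = v1 (\<phi> \<tau>1 w1 h1) - (\<rho> * \<beta>1 * e1 + \<pi>1 \<bullet> \<xi>1)" unfolding f1_def he fst_conv snd_conv ..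
      have f2h: "f2 h2 = v2 (\<phi> \<tau>2 w2 h2) - (\<rho> * \<beta>2 * e2 + \<pi>2 \<bullet> \<xi>2)" unfolding f2_def he fst_conv snd_conv ..
      show ?thesis using W1[unfolded W_def fst_conv snd_conv Qd Nd] unfolding f1h f2h f0 bb by linarith
    qed
    have 2: "A' ?\<xi> \<bullet> ?\<xi> \<le> BA ?u \<bullet> ?u + l * (norm (?\<xi> - ?u))\<^sup>2"
      using quadratic_form_split[OF A' A's A'L \<epsilon>, of ?\<xi> ?u] unfolding BAq l_def by simp
    have 3: "\<rho>\<^sup>2 / \<delta> * (e1 - e2)\<^sup>2 \<le> kk * (s1 - s2)\<^sup>2 + l * ((e1 - s1)\<^sup>2 + (e2 - s2)\<^sup>2)"
    proof -
      have "(e1 - e2)\<^sup>2 \<le> 2 * (s1 - s2)\<^sup>2 + 4 * ((e1 - s1)\<^sup>2 + (e2 - s2)\<^sup>2)"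
      proof -
        define a where "a = e1 - s1" define c where "c = e2 - s2" define f where "f = s1 - s2"
        have "2 * f\<^sup>2 + 4 * (a\<^sup>2 + c\<^sup>2) - (f + a - c)\<^sup>2 = (f - (a - c))\<^sup>2 + 2 * (a + c)\<^sup>2" by algebra
        moreover have "(f - (a - c))\<^sup>2 + 2 * (a + c)\<^sup>2 \<ge> 0" by (intro add_nonneg_nonneg) simp_all
        ultimately have "(f + a - c)\<^sup>2 \<le> 2 * f\<^sup>2 + 4 * (a\<^sup>2 + c\<^sup>2)" by linarith
        moreover have "f + a - c = e1 - e2" by (simp add: a_def c_def f_def)
        ultimately show ?thesis unfolding a_def c_def f_def by simp
      qed
      then have "\<rho>\<^sup>2 / \<delta> * (e1 - e2)\<^sup>2 \<le> \<rho>\<^sup>2 / \<delta> * (2 * (s1 - s2)\<^sup>2 + 4 * ((e1 - s1)\<^sup>2 + (e2 - s2)\<^sup>2))"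
        using \<delta>(1) by (intro mult_left_mono) auto
      also have "\<dots> = kk * (s1 - s2)\<^sup>2 + (4 * \<rho>\<^sup>2 / \<delta>) * ((e1 - s1)\<^sup>2 + (e2 - s2)\<^sup>2)"
      proof -
        have "c * (2 * X + 4 * Y) = 2 * c * X + 4 * c * Y" for c X Y :: real by (simp add: algebra_simps)
        from this[of "\<rho>\<^sup>2 / \<delta>"] show ?thesis by (simp only: kk_def times_divide_eq_right)
      qed
      also have "\<dots> \<le> kk * (s1 - s2)\<^sup>2 + l * ((e1 - s1)\<^sup>2 + (e2 - s2)\<^sup>2)"
        using \<rho>2 by (intro add_left_mono mult_right_mono) auto
      finally show ?thesis .
    qed
    have 4: "(norm ((h1,h2) - y))\<^sup>2 = (norm (?\<xi> - ?u))\<^sup>2 + ((e1 - s1)\<^sup>2 + (e2 - s2)\<^sup>2)"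
      by (simp add: he ye norm_Pair)
    have 5: "B y \<bullet> y = kk * (s1 - s2)\<^sup>2 + BA ?u \<bullet> ?u" unfolding ye by (rule Bq)
    have half: "v \<le> v' + 1/2 * ((X2 + X1) + (Y1 + Y2))" if "a \<le> X1 + Y1" "c \<le> X2 + Y2" "v \<le> v' + 1/2 * a + 1/2 * c"
      for a c X1 X2 Y1 Y2 v v' :: real using that unfolding distrib_left by linarith
    show ?thesis unfolding 4 5 distrib_left[of l "(norm (?\<xi> - ?u))\<^sup>2"] by (rule half[OF 2 3 1])
  qed
  \<comment> \<open>the tolerance \<open>k / M\<close> is such that undoing the time scale and adding back the linear terms costs at most \<open>k\<close>\<close>
  define R1 where "R1 = \<bar>\<rho> * \<beta>1\<bar>"
  define R2 where "R2 = \<bar>\<rho> * \<beta>2\<bar>"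
  define M where "M = 1 + 1/\<rho> + R1 + R2 + norm \<pi>1 + norm \<pi>2"
  have M: "M \<ge> 1" "1/\<rho> \<le> M" using \<rho>(1) by (auto simp: M_def R1_def R2_def)
  define \<kappa>' where "\<kappa>' = k / M"
  have \<kappa>': "\<kappa>' > 0" using k(1) M(1) by (simp add: \<kappa>'_def)
  have \<kappa>'M: "\<kappa>' * M = k" using M(1) by (simp add: \<kappa>'_def)
  have \<kappa>'k: "\<kappa>' \<le> k" using mult_left_mono[OF M(1), of \<kappa>'] \<kappa>' \<kappa>'M by simp
  have \<kappa>'\<rho>: "\<kappa>' / \<rho> \<le> k" using mult_left_mono[OF M(2), of \<kappa>'] \<kappa>' \<kappa>'M by simp
  obtain h1 h2 c1 c2 Y1 Y2 where hE: "h1 \<in> E1" "h2 \<in> E2" and hn: "norm h1 < \<kappa>'" "norm h2 < \<kappa>'" "norm c1 < \<kappa>'" "norm c2 < \<kappa>'"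
    and fv: "f1 h1 + f2 h2 \<ge> f1 0 + f2 0 - \<kappa>'" and jets: "elliptic_superjet E1 f1 h1 c1 Y1" "elliptic_superjet E2 f2 h2 c2 Y2"
    and Yup: "\<And>k1 k2. Y1 k1 \<bullet> k1 + Y2 k2 \<bullet> k2 \<le> B (k1,k2) \<bullet> (k1,k2) + \<kappa>' * (norm (k1,k2))\<^sup>2"
    and Ylo: "\<And>h. - l * (norm h)\<^sup>2 \<le> Y1 h \<bullet> h" "\<And>h. - l * (norm h)\<^sup>2 \<le> Y2 h \<bullet> h"
    using theorem_on_sums_approx[OF p1(1) z0(1) p1(2,3) p2(1) z0(2) p2(2,3) Bl Bsym l \<kappa>' max] by blast
  obtain e1 \<xi>1 e2 \<xi>2 where he: "h1 = (e1,\<xi>1)" "h2 = (e2,\<xi>2)" by (metis prod.collapse)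
  obtain a1' q1' a2' q2' where ce: "c1 = (a1',q1')" "c2 = (a2',q2')" by (metis prod.collapse)
  have en: "\<bar>e1\<bar> < \<kappa>'" "\<bar>e2\<bar> < \<kappa>'" "norm \<xi>1 < \<kappa>'" "norm \<xi>2 < \<kappa>'" "\<bar>a1'\<bar> < \<kappa>'" "\<bar>a2'\<bar> < \<kappa>'" "norm q1' < \<kappa>'" "norm q2' < \<kappa>'"
    using hn norm_fst_le[of e1 \<xi>1] norm_fst_le[of e2 \<xi>2] norm_snd_le[of \<xi>1 e1] norm_snd_le[of \<xi>2 e2]
      norm_fst_le[of a1' q1'] norm_fst_le[of a2' q2'] norm_snd_le[of q1' a1'] norm_snd_le[of q2' a2'] unfolding he ce by auto
  define t1 where "t1 = \<tau>1 + \<rho> * e1"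
  define t2 where "t2 = \<tau>2 + \<rho> * e2"
  define x1 where "x1 = w1 + \<xi>1"
  define x2 where "x2 = w2 + \<xi>2"
  have tD: "(t1,x1) \<in> D1" "(t2,x2) \<in> D2" using hE by (auto simp: E1_def E2_def \<phi>_def he t1_def t2_def x1_def x2_def)
  have \<rho>e: "\<bar>\<rho> * e\<bar> \<le> k" if "\<bar>e\<bar> < \<kappa>'" for e
    unfolding abs_mult using mult_mono[of \<rho> 1 "\<bar>e\<bar>" k] that \<rho> \<kappa>'k by auto
  have tT: "t1 < T" "t2 < T" "0 < t1" "0 < t2" using tD r by (auto simp: D1_def D2_def)
  have tn: "\<bar>t1 - T\<bar> < 2 * k" "\<bar>t2 - T\<bar> < 2 * k" 
    using \<rho>e[OF en(1)] \<rho>e[OF en(2)] near'(1,2) unfolding t1_def t2_def abs_le_iff abs_less_iff by linarith+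
  have xn: "norm (x1 - z1) < 2 * k" "norm (x2 - z2) < 2 * k"
    using norm_triangle_ineq[of "w1 - z1" \<xi>1] norm_triangle_ineq[of "w2 - z2" \<xi>2] near'(3,4) en(3,4) \<kappa>'k
    unfolding x1_def x2_def by (simp_all add: algebra_simps)
  have inD: "(s, y) \<in> {T-r..<T} \<times> cball z r"
    if "\<bar>s - t\<bar> < k" "\<bar>t - T\<bar> < 2 * k" "norm (y - x) < k" "norm (x - z) < 2 * k" "s < T" for s t and x y z :: 'x
  proof -
    have "norm (y - z) < 3 * k" using norm_triangle_ineq[of "y - x" "x - z"] that(3,4) by simp
    then have "norm (y - z) \<le> r" using k(1,3) by linarith
    moreover have "T - r \<le> s" using that(1,2) k(1,3) unfolding abs_less_iff by linarith
    ultimately show ?thesis using that(5) by (simp add: dist_norm norm_minus_commute)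
  qed
  have j1: "parabolic_jet ({0<..<T} \<times> UNIV) U1 t1 x1 (\<beta>1 + a1' / \<rho> + \<eta> / (T - t1)\<^sup>2) (\<pi>1 + q1') (\<lambda>\<xi>. snd (Y1 (0,\<xi>)))"
  proof (rule parabolic_jet_of_rescaled_superjet[OF jets(1)[unfolded he ce] \<rho>(1), where ?d0.0=k and tt=\<tau>1 and xx=w1])
    show "f1 (\<tau>, \<xi>) = U1 (\<tau>1 + \<rho> * \<tau>, w1 + \<xi>) - \<eta> / (T - (\<tau>1 + \<rho> * \<tau>)) - (\<rho> * \<beta>1 * \<tau> + \<pi>1 \<bullet> \<xi>)" for \<tau> \<xi>
      by (simp add: f1_def v1_def \<phi>_def)
    show "(\<tau>, \<xi>) \<in> E1" if "\<bar>\<tau>1 + \<rho> * \<tau> - t1\<bar> < k" "norm (w1 + \<xi> - x1) < k" "\<tau>1 + \<rho> * \<tau> < T" for \<tau> \<xi>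
    proof -
      have "(\<tau>1 + \<rho> * \<tau>, w1 + \<xi>) \<in> {T-r..<T} \<times> cball z1 r"
        by (rule inD[OF that(1) tn(1) that(2) xn(1) that(3)])
      then show ?thesis by (simp add: E1_def \<phi>_def D1_def)
    qed
  qed (use k(1) tT in \<open>auto simp: t1_def x1_def\<close>)
  have j2: "parabolic_jet ({0<..<T} \<times> UNIV) U2 t2 x2 (\<beta>2 + a2' / \<rho> + \<eta> / (T - t2)\<^sup>2) (\<pi>2 + q2') (\<lambda>\<xi>. snd (Y2 (0,\<xi>)))"
  proof (rule parabolic_jet_of_rescaled_superjet[OF jets(2)[unfolded he ce] \<rho>(1), where ?d0.0=k and tt=\<tau>2 and xx=w2])
    show "f2 (\<tau>, \<xi>) = U2 (\<tau>2 + \<rho> * \<tau>, w2 + \<xi>) - \<eta> / (T - (\<tau>2 + \<rho> * \<tau>)) - (\<rho> * \<beta>2 * \<tau> + \<pi>2 \<bullet> \<xi>)" for \<tau> \<xi>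
      by (simp add: f2_def v2_def \<phi>_def)
    show "(\<tau>, \<xi>) \<in> E2" if "\<bar>\<tau>2 + \<rho> * \<tau> - t2\<bar> < k" "norm (w2 + \<xi> - x2) < k" "\<tau>2 + \<rho> * \<tau> < T" for \<tau> \<xi>
    proof -
      have "(\<tau>2 + \<rho> * \<tau>, w2 + \<xi>) \<in> {T-r..<T} \<times> cball z2 r"
        by (rule inD[OF that(1) tn(2) that(2) xn(2) that(3)])
      then show ?thesis by (simp add: E2_def \<phi>_def D2_def)
    qed
  qed (use k(1) tT in \<open>auto simp: t2_def x2_def\<close>)
  have bsum: "b - \<kappa> \<le> (\<beta>1 + a1' / \<rho> + \<eta> / (T - t1)\<^sup>2) + (\<beta>2 + a2' / \<rho> + \<eta> / (T - t2)\<^sup>2)"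
  proof -
    have "\<bar>a / \<rho>\<bar> \<le> k" if "\<bar>a\<bar> < \<kappa>'" for a
      using divide_right_mono[of "\<bar>a\<bar>" \<kappa>' \<rho>] that \<rho>(1) \<kappa>'\<rho> by simp
    then have "\<bar>a1' / \<rho>\<bar> \<le> k" "\<bar>a2' / \<rho>\<bar> \<le> k" using en by auto
    moreover have "\<eta> / (T - t1)\<^sup>2 \<ge> 0" "\<eta> / (T - t2)\<^sup>2 \<ge> 0" using \<eta>(1) by auto
    ultimately show ?thesis unfolding \<beta>1_def \<beta>2_def using k16 \<sigma>16 by linarith
  qed
  have gn: "norm g \<le> \<kappa>/8"
  proof -
    have "norm g \<le> (L + 4 * \<sigma>) * norm (w1 - z1, w2 - z2)" unfolding g_def by (rule A'L)
    also have "\<dots> \<le> (L + 5) * (2 * k)"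
      using norm_Pair_le[of "w1 - z1" "w2 - z2"] near' L(2) \<sigma> by (intro mult_mono) auto
    finally show ?thesis using kL by linarith
  qed
  have qn: "norm (\<pi>1 + q1' - p1) < \<kappa>" "norm (\<pi>2 + q2' - p2) < \<kappa>"
  proof -
    have "norm (fst g + q1') \<le> \<kappa>/8 + k"
      using norm_triangle_ineq[of "fst g" q1'] gn norm_fst_le[of "fst g" "snd g"] en(7) \<kappa>'k by simp
    then show "norm (\<pi>1 + q1' - p1) < \<kappa>" using k16 \<kappa> by (simp add: \<pi>1_def)
    have "norm (snd g + q2') \<le> \<kappa>/8 + k"
      using norm_triangle_ineq[of "snd g" q2'] gn norm_snd_le[of "snd g" "fst g"] en(8) \<kappa>'k by simp
    then show "norm (\<pi>2 + q2' - p2) < \<kappa>" using k16 \<kappa> by (simp add: \<pi>2_def)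
  qed
  have Uup: "U1 (t1,x1) < U1 (T,z1) + \<kappa>/16" "U2 (t2,x2) < U2 (T,z2) + \<kappa>/16"
  proof -
    have "dist (t,x) (T,z) < 4 * k" if "\<bar>t - T\<bar> < 2 * k" "norm (x - z) < 2 * k" for t x and z :: 'x
      using that norm_Pair_le[of "t - T" "x - z"] by (simp add: dist_norm)
    then have "dist (t1,x1) (T,z1) < 4 * k" "dist (t2,x2) (T,z2) < 4 * k" using tn xn by blast+
    then show "U1 (t1,x1) < U1 (T,z1) + \<kappa>/16" "U2 (t2,x2) < U2 (T,z2) + \<kappa>/16"
      using d4(2)[of "(t1,x1)"] d5(2)[of "(t2,x2)"] tT k(1,4,5) by auto
  qed
  have Usum: "U1 (t1,x1) + U2 (t2,x2) > m - \<kappa>/4"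
  proof -
    have "\<bar>\<rho> * \<beta>1 * e1 + \<pi>1 \<bullet> \<xi>1 + (\<rho> * \<beta>2 * e2 + \<pi>2 \<bullet> \<xi>2)\<bar> \<le> k"
    proof -
      have "\<bar>\<rho> * \<beta>1 * e1\<bar> \<le> R1 * \<kappa>'" "\<bar>\<rho> * \<beta>2 * e2\<bar> \<le> R2 * \<kappa>'"
        unfolding abs_mult[of "\<rho> * \<beta>1" e1] abs_mult[of "\<rho> * \<beta>2" e2] R1_def R2_def using en by (auto intro: mult_left_mono)
      moreover have "\<bar>\<pi>1 \<bullet> \<xi>1\<bar> \<le> norm \<pi>1 * \<kappa>'" "\<bar>\<pi>2 \<bullet> \<xi>2\<bar> \<le> norm \<pi>2 * \<kappa>'"
        using Cauchy_Schwarz_ineq2[of \<pi>1 \<xi>1] Cauchy_Schwarz_ineq2[of \<pi>2 \<xi>2] en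
          mult_left_mono[of "norm \<xi>1" \<kappa>' "norm \<pi>1"] mult_left_mono[of "norm \<xi>2" \<kappa>' "norm \<pi>2"] by auto
      moreover have "R1 * \<kappa>' + R2 * \<kappa>' + norm \<pi>1 * \<kappa>' + norm \<pi>2 * \<kappa>' \<le> k"
      proof -
        have "(R1 + R2 + norm \<pi>1 + norm \<pi>2) * \<kappa>' \<le> M * \<kappa>'"
          using \<kappa>' \<rho>(1) by (intro mult_right_mono) (auto simp: M_def)
        then show ?thesis using \<kappa>'M unfolding distrib_right mult.commute[of M] by linarith
      qed
      ultimately show ?thesis unfolding abs_le_iff by linarith
    qed
    moreover have "f1 h1 = v1 (t1,x1) - (\<rho> * \<beta>1 * e1 + \<pi>1 \<bullet> \<xi>1)" "f2 h2 = v2 (t2,x2) - (\<rho> * \<beta>2 * e2 + \<pi>2 \<bullet> \<xi>2)"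
      by (auto simp: f1_def f2_def \<phi>_def he t1_def t2_def x1_def x2_def)
    moreover have "f1 0 = v1 (fst P)" "f2 0 = v2 (snd P)" by (auto simp: f1_def f2_def \<phi>_def Pe)
    ultimately have 1: "v1 (t1,x1) + v2 (t2,x2) \<ge> v1 (fst P) + v2 (snd P) - 2 * k" using fv \<kappa>'k unfolding abs_le_iff by linarith
    have "\<bar>Q (fst P) (snd P)\<bar> \<le> C5 * k" using near k(1,2) by (intro Qb) (auto simp: Pe)
    moreover have "N P / (2 * \<delta>) \<ge> 0" using \<delta>(1) by (simp add: N_def)
    ultimately have 2: "v1 (fst P) + v2 (snd P) > m - \<delta> - \<kappa>/16" using WP C5k unfolding W_def abs_le_iff by linarith
    have "U1 (t1,x1) \<ge> v1 (t1,x1)" "U2 (t2,x2) \<ge> v2 (t2,x2)" using tT \<eta>(1) by (auto simp: v1_def v2_def)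
    then show ?thesis using 1 2 \<delta>(2) k16 by linarith
  qed
  have Uabs: "\<bar>U1 (t1,x1) - U1 (T,z1)\<bar> < \<kappa>" "\<bar>U2 (t2,x2) - U2 (T,z2)\<bar> < \<kappa>"
    using Uup Usum \<kappa> unfolding m_def by linarith+
  have Ybl: "bounded_linear (\<lambda>\<xi>. snd (Y1 (0,\<xi>)))" "bounded_linear (\<lambda>\<xi>. snd (Y2 (0,\<xi>)))"
    using jets unfolding elliptic_superjet_def
    by (auto intro!: bounded_linear_snd_comp bounded_linear_compose[of _ "\<lambda>\<xi>. (0,\<xi>)"] bounded_linear_Pair bounded_linear_zero bounded_linear_ident)
  have up: "snd (Y1 (0,u1)) \<bullet> u1 + snd (Y2 (0,u2)) \<bullet> u2 \<le> A (u1,u2) \<bullet> (u1,u2) + \<epsilon> * (norm (A (u1,u2)))\<^sup>2 + \<kappa> * (norm (u1,u2))\<^sup>2" for u1 u2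
  proof -
    let ?u = "(u1,u2)"
    have "Y1 (0,u1) \<bullet> (0,u1) + Y2 (0,u2) \<bullet> (0,u2) \<le> BA ?u \<bullet> ?u + \<kappa>' * (norm ?u)\<^sup>2"
      using Yup[of "(0,u1)" "(0,u2)"] unfolding Bq by (simp add: norm_Pair)
    then have 1: "snd (Y1 (0,u1)) \<bullet> u1 + snd (Y2 (0,u2)) \<bullet> u2 \<le> BA ?u \<bullet> ?u + \<kappa>' * (norm ?u)\<^sup>2"
      by (simp add: inner_prod_def)
    have 2: "A' ?u \<bullet> ?u = A ?u \<bullet> ?u + 4 * \<sigma> * (norm ?u)\<^sup>2" unfolding A'_def inner_add_left inner_scaleR_left power2_norm_eq_inner ..
    have 3: "(norm (A' ?u))\<^sup>2 \<le> (norm (A ?u))\<^sup>2 + (8 * L + 16) * \<sigma> * (norm ?u)\<^sup>2"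
    proof -
      have "norm (A' ?u) \<le> norm (A ?u) + 4 * \<sigma> * norm ?u"
      proof -
        have *: "norm ((4 * \<sigma>) *\<^sub>R v) = 4 * \<sigma> * norm v" for v :: "'x \<times> 'x" using \<sigma>(1) by simp
        show ?thesis using norm_triangle_ineq[of "A ?u" "(4 * \<sigma>) *\<^sub>R ?u"] unfolding A'_def * .
      qed
      then have "(norm (A' ?u))\<^sup>2 \<le> (norm (A ?u) + 4 * \<sigma> * norm ?u)\<^sup>2" by (intro power_mono) auto
      also have "\<dots> = (norm (A ?u))\<^sup>2 + 8 * \<sigma> * norm ?u * norm (A ?u) + 16 * \<sigma> * (norm ?u)\<^sup>2 * \<sigma>"
        by algebra
      also have "\<dots> \<le> (norm (A ?u))\<^sup>2 + 8 * \<sigma> * norm ?u * (L * norm ?u) + 16 * \<sigma> * (norm ?u)\<^sup>2 * 1"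
        using \<sigma> L(1)[of ?u] by (intro add_mono mult_left_mono) auto
      also have "\<dots> = (norm (A ?u))\<^sup>2 + (8 * L + 16) * \<sigma> * (norm ?u)\<^sup>2" by algebra
      finally show ?thesis .
    qed
    have "BA ?u \<bullet> ?u \<le> A ?u \<bullet> ?u + 4 * \<sigma> * (norm ?u)\<^sup>2 + \<epsilon> * ((norm (A ?u))\<^sup>2 + (8 * L + 16) * \<sigma> * (norm ?u)\<^sup>2)"
      unfolding BAq 2 using 3 \<epsilon> by (intro add_left_mono mult_left_mono) auto
    also have "\<dots> = A ?u \<bullet> ?u + \<epsilon> * (norm (A ?u))\<^sup>2 + \<sigma> * (4 + \<epsilon> * (8 * L + 16)) * (norm ?u)\<^sup>2" by algebra
    finally have "BA ?u \<bullet> ?u \<le> A ?u \<bullet> ?u + \<epsilon> * (norm (A ?u))\<^sup>2 + \<sigma> * (4 + \<epsilon> * (8 * L + 16)) * (norm ?u)\<^sup>2" .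
    moreover have "\<sigma> * (4 + \<epsilon> * (8 * L + 16)) * (norm ?u)\<^sup>2 \<le> \<kappa>/2 * (norm ?u)\<^sup>2"
    proof (rule mult_right_mono)
      have "2 * (\<sigma> * (4 + \<epsilon> * (8 * L + 16))) = \<sigma> * c0 - 8 * \<sigma>" unfolding c0_def by algebra
      then show "\<sigma> * (4 + \<epsilon> * (8 * L + 16)) \<le> \<kappa>/2" using \<sigma>c \<sigma>(1) by linarith
    qed simp
    ultimately have 4: "BA ?u \<bullet> ?u \<le> A ?u \<bullet> ?u + \<epsilon> * (norm (A ?u))\<^sup>2 + \<kappa>/2 * (norm ?u)\<^sup>2" by linarith
    have "\<kappa>' * (norm ?u)\<^sup>2 \<le> \<kappa>/2 * (norm ?u)\<^sup>2" using \<kappa>'k k16 \<kappa> by (intro mult_right_mono) auto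
    then have "\<kappa>' * (norm ?u)\<^sup>2 + \<kappa>/2 * (norm ?u)\<^sup>2 \<le> \<kappa> * (norm ?u)\<^sup>2" by linarith
    then show ?thesis using 1 4 by linarith
  qed
  have lo: "- (1 / \<epsilon> + L + \<kappa>) * (norm u)\<^sup>2 \<le> snd (Y1 (0,u)) \<bullet> u" "- (1 / \<epsilon> + L + \<kappa>) * (norm u)\<^sup>2 \<le> snd (Y2 (0,u)) \<bullet> u" for u
  proof -
    have "- (1 / \<epsilon> + L + \<kappa>) * (norm u)\<^sup>2 \<le> - l * (norm u)\<^sup>2"
      using \<sigma>16 \<sigma>(1) \<kappa> by (intro mult_right_mono) (auto simp: l_def)
    moreover have "- l * (norm u)\<^sup>2 \<le> snd (Y1 (0,u)) \<bullet> u" "- l * (norm u)\<^sup>2 \<le> snd (Y2 (0,u)) \<bullet> u"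
      using Ylo(1)[of "(0,u)"] Ylo(2)[of "(0,u)"] by (auto simp: inner_prod_def norm_Pair)
    ultimately show "- (1 / \<epsilon> + L + \<kappa>) * (norm u)\<^sup>2 \<le> snd (Y1 (0,u)) \<bullet> u" "- (1 / \<epsilon> + L + \<kappa>) * (norm u)\<^sup>2 \<le> snd (Y2 (0,u)) \<bullet> u"
      by linarith+
  qed
  have "T - t1 < \<kappa>" "T - t2 < \<kappa>" "norm (x1 - z1) < \<kappa>" "norm (x2 - z2) < \<kappa>" using tn xn k16 \<kappa> by linarith+
  then show ?thesis using tT Uabs qn bsum j1 j2 Ybl up lo by blast
qed

section \<open>Jets and extensions on strips\<close>

text \<open>In the direction from right to left the remainder is the positive part of the defect.\<close>

lemma superjet_iff_parabolic_jet:
  "(b, p, X) \<in> superjet S u (s, z) \<longleftrightarrow> sym_matrix X \<and> parabolic_jet S u s z b p ((*v) X)"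
proof -
  define q where "q = (\<lambda>t x. u (s, z) + b * (t - s) + p \<bullet> (x - z) + 1/2 * ((X *v (x - z)) \<bullet> (x - z)))"
  define g where "g = (\<lambda>t x. \<bar>t - s\<bar> + (norm (x - z))\<^sup>2)"
  have g0: "g t x \<ge> 0" for t x by (simp add: g_def)
  have "(\<exists>\<rho> \<in> o[at (s, z) within S](\<lambda>(t, x). g t x). \<forall>\<^sub>F (t, x) in at (s, z) within S. u (t, x) \<le> q t x + \<rho> (t, x))
      \<longleftrightarrow> (\<forall>e>0. \<exists>d>0. \<forall>t x. (t,x) \<in> S \<longrightarrow> \<bar>t - s\<bar> < d \<longrightarrow> norm (x - z) < d \<longrightarrow> u (t,x) \<le> q t x + e * g t x)"
    (is "?L \<longleftrightarrow> ?R")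
  proof
    assume ?L
    then obtain \<rho> where \<rho>: "\<rho> \<in> o[at (s, z) within S](\<lambda>(t, x). g t x)"
      and ev: "\<forall>\<^sub>F (t, x) in at (s, z) within S. u (t, x) \<le> q t x + \<rho> (t, x)" by blast
    show ?R
    proof (intro allI impI)
      fix e :: real assume e: "e > 0"
      have "\<forall>\<^sub>F P in at (s, z) within S. norm (\<rho> P) \<le> e * norm (case P of (t, x) \<Rightarrow> g t x)"
        using landau_o.smallD[OF \<rho> e] .
      with ev have "\<forall>\<^sub>F P in at (s, z) within S. u P \<le> q (fst P) (snd P) + e * g (fst P) (snd P)"
      proof eventually_elim
        case (elim P)
        obtain t x where P: "P = (t, x)" by (cases P)
        have "\<rho> (t,x) \<le> e * g t x" using elim(2) g0[of t x] by (simp add: P abs_le_iff)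
        then show ?case using elim(1) by (simp add: P)
      qed
      then obtain d where d: "d > 0" "\<And>P. P \<in> S \<Longrightarrow> P \<noteq> (s,z) \<Longrightarrow> dist P (s,z) < d \<Longrightarrow> u P \<le> q (fst P) (snd P) + e * g (fst P) (snd P)"
        unfolding eventually_at by blast
      have "u (t,x) \<le> q t x + e * g t x" if tx: "(t,x) \<in> S" "\<bar>t - s\<bar> < d/2" "norm (x - z) < d/2" for t x
      proof (cases "(t,x) = (s,z)")
        case True
        then show ?thesis by (simp add: q_def g_def)
      next
        case False
        have "dist (t,x) (s,z) < d" using norm_Pair_le[of "t - s" "x - z"] tx(2,3) by (simp add: dist_norm)
        then show ?thesis using d(2)[OF tx(1) False] by simp
      qed
      then show "\<exists>d>0. \<forall>t x. (t,x) \<in> S \<longrightarrow> \<bar>t - s\<bar> < d \<longrightarrow> norm (x - z) < d \<longrightarrow> u (t,x) \<le> q t x + e * g t x"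
        using d(1) by (intro exI[of _ "d/2"]) auto
    qed
  next
    assume R: ?R
    define \<rho> where "\<rho> = (\<lambda>P. max 0 (u P - q (fst P) (snd P)))"
    have "\<rho> \<in> o[at (s, z) within S](\<lambda>(t, x). g t x)"
    proof (rule landau_o.smallI)
      fix e :: real assume "e > 0"
      then obtain d where d: "d > 0" "\<And>t x. (t,x) \<in> S \<Longrightarrow> \<bar>t - s\<bar> < d \<Longrightarrow> norm (x - z) < d \<Longrightarrow> u (t,x) \<le> q t x + e * g t x"
        using R by blast
      show "\<forall>\<^sub>F P in at (s, z) within S. norm (\<rho> P) \<le> e * norm (case P of (t, x) \<Rightarrow> g t x)"
        unfolding eventually_at
      proof (intro exI[of _ d] conjI d(1) ballI impI)
        fix P assume P: "P \<in> S" "P \<noteq> (s,z) \<and> dist P (s,z) < d"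
        obtain t x where Pe: "P = (t, x)" by (cases P)
        have "\<bar>t - s\<bar> < d" "norm (x - z) < d"
          using P(2) dist_fst_le[of P "(s,z)"] dist_snd_le[of P "(s,z)"] by (auto simp: Pe dist_norm)
        then have "u (t,x) \<le> q t x + e * g t x" using d(2) P(1) Pe by blast
        moreover have "0 \<le> e * g t x" using \<open>e > 0\<close> g0 by simp
        ultimately show "norm (\<rho> P) \<le> e * norm (case P of (t, x) \<Rightarrow> g t x)"
          using g0[of t x] by (simp add: \<rho>_def Pe)
      qed
    qed
    moreover have "\<forall>\<^sub>F (t, x) in at (s, z) within S. u (t, x) \<le> q t x + \<rho> (t, x)"
      by (rule always_eventually) (auto simp: \<rho>_def)
    ultimately show ?L by blast
  qed
  then show ?thesis unfolding superjet_def parabolic_jet_def q_def g_def by simp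
qed

lemma terminal_ext_below: "t \<noteq> T \<Longrightarrow> terminal_ext T u (t, x) = u (t, x)"
  by (simp add: terminal_ext_def)

lemma ereal_terminal_ext:
  "\<bar>terminal_limsup T u x\<bar> \<noteq> \<infinity> \<Longrightarrow> ereal (terminal_ext T u (T, x)) = terminal_limsup T u x"
  by (simp add: terminal_ext_def ereal_real')

text \<open>Near a point at time \<open>T\<close> the values before \<open>T\<close> are controlled by the limit superior that
defines the extension, and the values at \<open>T\<close> are limits superior of those.\<close>

lemma upper_semicont_terminal_ext:
  fixes u :: "real \<times> (real ^ 'd) \<Rightarrow> real"
  assumes usc: "usc_on (open_strip T) u" and fin: "\<And>x. \<bar>terminal_limsup T u x\<bar> \<noteq> \<infinity>"
  shows "upper_semicont ({0<..T} \<times> UNIV) (terminal_ext T u)"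
  unfolding upper_semicont_def
proof (intro ballI allI impI)
  fix P :: "real \<times> (real ^ 'd)" and \<tau> assume P: "P \<in> {0<..T} \<times> UNIV" "terminal_ext T u P < \<tau>"
  obtain t x where Pe: "P = (t, x)" by (cases P)
  show "eventually (\<lambda>R. terminal_ext T u R < \<tau>) (at P within {0<..T} \<times> UNIV)"
  proof (cases "t = T")
    case False
    then have t: "0 < t" "t < T" using P(1) by (auto simp: Pe)
    have "(t,x) \<in> open_strip T" using t by simp
    then have "Limsup (at (t,x) within open_strip T) (\<lambda>y. ereal (u y)) \<le> ereal (u (t,x))"
      using usc unfolding usc_on_def by blast
    also have "ereal (u (t,x)) < ereal \<tau>" using P(2) False by (simp add: Pe terminal_ext_below)
    finally have "Limsup (at (t,x) within open_strip T) (\<lambda>y. ereal (u y)) < ereal \<tau>" .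
    then have "eventually (\<lambda>y. ereal (u y) < ereal \<tau>) (at (t,x) within open_strip T)" by (rule Limsup_lessD)
    then obtain d where d: "d > 0" "\<And>y. y \<in> open_strip T \<Longrightarrow> y \<noteq> (t,x) \<Longrightarrow> dist y (t,x) < d \<Longrightarrow> u y < \<tau>"
      unfolding eventually_at by auto
    show ?thesis
      unfolding eventually_at
    proof (intro exI[of _ "min d (T - t)"] conjI ballI impI)
      show "0 < min d (T - t)" using d t by simp
      fix R assume R: "R \<in> {0<..T} \<times> (UNIV :: (real ^ 'd) set)" "R \<noteq> P \<and> dist R P < min d (T - t)"
      obtain s y where Re: "R = (s, y)" by (cases R)
      have "\<bar>s - t\<bar> < T - t" using R(2) dist_fst_le[of R P] by (simp add: Re Pe dist_real_def)
      then have "s < T" by simp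
      then show "terminal_ext T u R < \<tau>" using d(2)[of R] R by (simp add: Re Pe terminal_ext_below)
    qed
  next
    case True
    define \<tau>' where "\<tau>' = (terminal_ext T u (T, x) + \<tau>) / 2"
    have \<tau>': "terminal_limsup T u x < ereal \<tau>'" "\<tau>' < \<tau>"
      using P(2) ereal_terminal_ext[OF fin[of x], symmetric] by (auto simp: Pe True \<tau>'_def)
    have "eventually (\<lambda>y. ereal (u y) < ereal \<tau>') (at (T,x) within open_strip T)"
      using \<tau>'(1) unfolding terminal_limsup_def by (rule Limsup_lessD)
    then obtain d where d: "d > 0" "\<And>y. y \<in> open_strip T \<Longrightarrow> y \<noteq> (T,x) \<Longrightarrow> dist y (T,x) < d \<Longrightarrow> u y < \<tau>'"
      unfolding eventually_at by auto
    show ?thesis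
      unfolding eventually_at
    proof (intro exI[of _ d] conjI ballI impI d(1))
      fix R assume R: "R \<in> {0<..T} \<times> (UNIV :: (real ^ 'd) set)" "R \<noteq> P \<and> dist R P < d"
      obtain s y where Re: "R = (s, y)" by (cases R)
      show "terminal_ext T u R < \<tau>"
      proof (cases "s = T")
        case False
        then show ?thesis using d(2)[of R] R \<tau>'(2) by (auto simp: Re Pe True terminal_ext_below)
      next
        case s: True
        have "eventually (\<lambda>R'. ereal (u R') \<le> ereal \<tau>') (at (T,y) within open_strip T)"
          unfolding eventually_at
        proof (intro exI[of _ "d - dist R P"] conjI ballI impI)
          show "0 < d - dist R P" using R(2) by simp
          fix R' assume R': "R' \<in> open_strip T" "R' \<noteq> (T,y) \<and> dist R' (T,y) < d - dist R P"
          have "dist R' (T,x) < d" using dist_triangle[of R' "(T,x)" "(T,y)"] R'(2) by (simp add: Re Pe s True)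
          moreover have "R' \<noteq> (T,x)" using R'(1) by auto
          ultimately have "u R' < \<tau>'" using d(2) R'(1) by blast
          then show "ereal (u R') \<le> ereal \<tau>'" by simp
        qed
        then have "terminal_limsup T u y \<le> ereal \<tau>'" unfolding terminal_limsup_def by (rule Limsup_bounded)
        then have "terminal_ext T u (T,y) \<le> \<tau>'" using ereal_terminal_ext[OF fin[of y]] by (metis ereal_less_eq(3))
        then show ?thesis using \<tau>'(2) by (simp add: Re s)
      qed
    qed
  qed
qed

lemma terminal_ext_approached:
  assumes fin: "\<bar>terminal_limsup T u x\<bar> \<noteq> \<infinity>" and d: "d > 0"
  shows "\<exists>t y. 0 < t \<and> t < T \<and> dist (t,y) (T,x) < d \<and> terminal_ext T u (T,x) - d < terminal_ext T u (t,y)"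
proof (rule ccontr)
  assume neg: "\<not> ?thesis"
  have "eventually (\<lambda>R. ereal (u R) \<le> ereal (terminal_ext T u (T,x) - d)) (at (T,x) within open_strip T)"
    unfolding eventually_at
  proof (intro exI[of _ d] conjI ballI impI d)
    fix R assume R: "R \<in> open_strip T" "R \<noteq> (T,x) \<and> dist R (T,x) < d"
    obtain t y where Re: "R = (t, y)" by (cases R)
    have "terminal_ext T u (t,y) \<le> terminal_ext T u (T,x) - d"
    proof (rule ccontr)
      assume "\<not> ?thesis"
      moreover have "0 < t" "t < T" "dist (t,y) (T,x) < d" using R by (auto simp: Re)
      ultimately show False using neg by (meson not_le)
    qed
    then show "ereal (u R) \<le> ereal (terminal_ext T u (T,x) - d)" using R(1) by (auto simp: Re terminal_ext_below)
  qed
  then have "terminal_limsup T u x \<le> ereal (terminal_ext T u (T,x) - d)"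
    unfolding terminal_limsup_def by (rule Limsup_bounded)
  then have "terminal_ext T u (T,x) \<le> terminal_ext T u (T,x) - d"
    using ereal_terminal_ext[OF fin] by (metis ereal_less_eq(3))
  then show False using d by simp
qed

lemma parabolic_jet_cong_form:
  assumes "parabolic_jet S u s z b p X" "\<And>h. X h \<bullet> h = Y h \<bullet> h"
  shows "parabolic_jet S u s z b p Y"
  using assms unfolding parabolic_jet_def by simp

text \<open>Jets are local: this passes between the open and the closed strip, and between \<open>u\<close> and its
extension, at times before \<open>T\<close>.\<close>

lemma parabolic_jet_transfer:
  assumes jet: "parabolic_jet S u s z b p X" and d0: "d0 > 0"
    and eq: "\<And>t x. (t,x) \<in> S' \<Longrightarrow> \<bar>t - s\<bar> < d0 \<Longrightarrow> (t,x) \<in> S \<and> u (t,x) = v (t,x)" and eqz: "u (s,z) = v (s,z)"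
  shows "parabolic_jet S' v s z b p X"
  unfolding parabolic_jet_def
proof (intro allI impI)
  fix e :: real assume "e > 0"
  then obtain d where d: "d > 0" "\<And>t x. (t,x) \<in> S \<Longrightarrow> \<bar>t - s\<bar> < d \<Longrightarrow> norm (x - z) < d \<Longrightarrow>
     u (t,x) \<le> u (s,z) + b * (t - s) + p \<bullet> (x - z) + 1/2 * (X (x - z) \<bullet> (x - z)) + e * (\<bar>t - s\<bar> + (norm (x - z))\<^sup>2)"
    using jet unfolding parabolic_jet_def by blast
  show "\<exists>d>0. \<forall>t x. (t,x) \<in> S' \<longrightarrow> \<bar>t - s\<bar> < d \<longrightarrow> norm (x - z) < d \<longrightarrow>
     v (t,x) \<le> v (s,z) + b * (t - s) + p \<bullet> (x - z) + 1/2 * (X (x - z) \<bullet> (x - z)) + e * (\<bar>t - s\<bar> + (norm (x - z))\<^sup>2)"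
  proof (intro exI[of _ "min d d0"] conjI allI impI)
    show "min d d0 > 0" using d(1) d0 by simp
    fix t x assume tx: "(t,x) \<in> S'" "\<bar>t - s\<bar> < min d d0" "norm (x - z) < min d d0"
    have "(t,x) \<in> S" "u (t,x) = v (t,x)" using eq[OF tx(1)] tx(2) by auto
    then show "v (t,x) \<le> v (s,z) + b * (t - s) + p \<bullet> (x - z) + 1/2 * (X (x - z) \<bullet> (x - z)) + e * (\<bar>t - s\<bar> + (norm (x - z))\<^sup>2)"
      using d(2)[of t x] tx eqz by simp
  qed
qed

definition vjoin :: "real ^ 'n \<Rightarrow> real ^ 'n \<Rightarrow> real ^ ('n + 'n)" where
  "vjoin a c = (\<chi> k. case k of Inl i \<Rightarrow> a $ i | Inr i \<Rightarrow> c $ i)"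

lemma vfst_vjoin [simp]: "vfst (vjoin a c) = a" and vsnd_vjoin [simp]: "vsnd (vjoin a c) = c"
  by (simp_all add: vfst_def vsnd_def vjoin_def)

lemma vjoin_vfst_vsnd [simp]: "vjoin (vfst x) (vsnd x) = x"
  by (simp add: vfst_def vsnd_def vjoin_def vec_eq_iff split: sum.split)

lemma sum_UNIV_sum: "(\<Sum>k\<in>(UNIV :: ('n::finite + 'n) set). f k) = (\<Sum>i\<in>UNIV. f (Inl i)) + (\<Sum>i\<in>UNIV. f (Inr i))"
  unfolding UNIV_Plus_UNIV[symmetric] by (subst sum.Plus) auto

lemma inner_halves: "x \<bullet> y = vfst x \<bullet> vfst y + vsnd x \<bullet> vsnd y"
  unfolding inner_vec_def sum_UNIV_sum by (simp add: vfst_def vsnd_def)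

lemma inner_pair_halves: "(vfst x, vsnd x) \<bullet> (vfst y, vsnd y) = x \<bullet> y"
  by (simp add: inner_halves[of x y])

lemma norm_pair_halves: "norm (vfst x, vsnd x) = norm x"
  by (simp add: norm_eq_sqrt_inner inner_halves[of x x])

lemma linear_vfst: "linear vfst" and linear_vsnd: "linear vsnd"
  by (auto intro!: linearI simp: vfst_def vsnd_def vec_eq_iff)

lemma linear_vjoin: "linear (\<lambda>h. vjoin (fst h) (snd h))"
  by (auto intro!: linearI simp: vjoin_def vec_eq_iff split: sum.split)

lemma inner_block_diag:
  "(block_diag X Y *v \<xi>) \<bullet> \<xi> = (X *v vfst \<xi>) \<bullet> vfst \<xi> + (Y *v vsnd \<xi>) \<bullet> vsnd \<xi>"
proof -
  have "vfst (block_diag X Y *v \<xi>) = X *v vfst \<xi>" "vsnd (block_diag X Y *v \<xi>) = Y *v vsnd \<xi>"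
    by (auto simp: vec_eq_iff vfst_def vsnd_def matrix_vector_mult_def sum_UNIV_sum block_diag_def)
  then show ?thesis by (simp add: inner_halves[of _ \<xi>])
qed

lemma sym_matrix_inner: "sym_matrix A \<Longrightarrow> (A *v x) \<bullet> y = x \<bullet> (A *v y)"
  unfolding sym_matrix_def by (metis dot_lmul_matrix transpose_matrix_vector)

lemma linear_map_symmetric_matrix:
  fixes X :: "real ^ 'n \<Rightarrow> real ^ 'n"
  assumes "linear X"
  obtains M where "sym_matrix M" "\<And>h. (M *v h) \<bullet> h = X h \<bullet> h"
proof
  let ?B = "matrix X"
  show "sym_matrix ((1/2) *\<^sub>R (?B + transpose ?B))"
    by (simp add: sym_matrix_def transpose_def vec_eq_iff)
  fix h
  have "(transpose ?B *v h) \<bullet> h = (?B *v h) \<bullet> h"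
    by (metis dot_lmul_matrix inner_commute transpose_matrix_vector)
  then show "(((1/2) *\<^sub>R (?B + transpose ?B)) *v h) \<bullet> h = X h \<bullet> h"
    by (simp add: scaleR_matrix_vector_assoc[symmetric] matrix_vector_mult_add_rdistrib inner_add_left matrix_works assms linear_matrix_vector_mul_eq)
qed

text \<open>Polarization, tested on the vector of norm \<open>|h|\<close> in the direction of \<open>X h\<close>.\<close>

lemma sym_matrix_norm_le:
  assumes sym: "sym_matrix X" and q: "\<And>h. \<bar>(X *v h) \<bullet> h\<bar> \<le> C * (norm h)\<^sup>2"
  shows "norm (X *v h) \<le> C * norm h"
proof (cases "X *v h = 0")
  case True
  show ?thesis
  proof (cases "h = 0")
    case False
    have "0 \<le> C * (norm h)\<^sup>2" using q[of h] by linarith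
    then have "C \<ge> 0" using False by (simp add: zero_le_mult_iff)
    then show ?thesis using True by simp
  qed (use True in simp)
next
  case False
  define y where "y = X *v h"
  have y: "norm y > 0" using False by (simp add: y_def)
  define k where "k = (norm h / norm y) *\<^sub>R y"
  have nk: "norm k = norm h" using y by (simp add: k_def)
  have "(X *v h) \<bullet> k = norm h * norm y"
    using y by (simp add: k_def y_def[symmetric] dot_square_norm power2_eq_square)
  moreover have "4 * ((X *v h) \<bullet> k) = (X *v (h + k)) \<bullet> (h + k) - (X *v (h - k)) \<bullet> (h - k)"
    using sym_matrix_inner[OF sym, of k h]
    by (simp add: matrix_vector_right_distrib matrix_vector_mult_diff_distrib inner_add_left inner_add_right
        inner_diff_left inner_diff_right inner_commute)
  moreover have "(X *v (h + k)) \<bullet> (h + k) - (X *v (h - k)) \<bullet> (h - k) \<le> C * (norm (h + k))\<^sup>2 + C * (norm (h - k))\<^sup>2"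
    using q[of "h + k"] q[of "h - k"] by linarith
  moreover have "C * (norm (h + k))\<^sup>2 + C * (norm (h - k))\<^sup>2 = 4 * (C * norm h * norm h)"
  proof -
    have "(norm (h + k))\<^sup>2 + (norm (h - k))\<^sup>2 = 2 * (norm h)\<^sup>2 + 2 * (norm k)\<^sup>2"
      unfolding power2_norm_eq_inner by (simp add: inner_add_left inner_add_right inner_diff_left inner_diff_right inner_commute)
    then show ?thesis unfolding nk distrib_left[symmetric] by (simp add: power2_eq_square)
  qed
  ultimately have "norm h * norm y \<le> norm h * (C * norm h)" by (simp add: mult_ac)
  moreover have "norm h > 0" using False by auto
  ultimately show ?thesis by (simp add: y_def)
qed

lemma norm_matrix_le:
  fixes X :: "real ^ 'n ^ 'n"
  assumes "\<And>h. norm (X *v h) \<le> C * norm h"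
  shows "norm X \<le> real CARD('n) * (real CARD('n) * C)"
proof -
  have entry: "\<bar>X $ i $ j\<bar> \<le> C" for i j
  proof -
    have "X $ i $ j = (X *v axis j 1) $ i" by (simp add: matrix_vector_mul_component column_def matrix_vector_mult_basis)
    then have "\<bar>X $ i $ j\<bar> \<le> norm (X *v axis j 1)" using component_le_norm_cart by metis
    also have "\<dots> \<le> C" using assms[of "axis j 1"] by simp
    finally show ?thesis .
  qed
  have row: "norm (X $ i) \<le> real CARD('n) * C" for i
  proof -
    have "norm (X $ i) \<le> (\<Sum>j\<in>UNIV. \<bar>X $ i $ j\<bar>)" by (rule norm_le_l1_cart)
    also have "\<dots> \<le> (\<Sum>j\<in>(UNIV::'n set). C)" by (intro sum_mono entry)
    finally show ?thesis by simp
  qed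
  have "norm X \<le> (\<Sum>i\<in>UNIV. norm (X $ i))" unfolding norm_vec_def by (rule L2_set_le_sum) simp
  also have "\<dots> \<le> (\<Sum>i\<in>(UNIV::'n set). real CARD('n) * C)" by (intro sum_mono row)
  finally show ?thesis by simp
qed

lemma tendsto_matrix_form:
  fixes X :: "nat \<Rightarrow> real ^ 'n ^ 'n"
  assumes "X \<longlonglongrightarrow> Y"
  shows "(\<lambda>k. (X k *v h) \<bullet> h) \<longlonglongrightarrow> (Y *v h) \<bullet> h"
  unfolding matrix_vector_mult_def inner_vec_def using assms by (auto intro!: tendsto_intros)

lemma sym_matrix_limit:
  assumes "X \<longlonglongrightarrow> Y" "\<And>k. sym_matrix (X k)"
  shows "sym_matrix Y"
proof -
  have "Y $ i $ j = Y $ j $ i" for i j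
  proof (rule LIMSEQ_unique)
    show "(\<lambda>k. X k $ i $ j) \<longlonglongrightarrow> Y $ i $ j" using assms(1) by (intro tendsto_intros)
    have "X k $ i $ j = X k $ j $ i" for k
      using assms(2)[of k] unfolding sym_matrix_def transpose_def by (simp add: vec_eq_iff)
    then show "(\<lambda>k. X k $ i $ j) \<longlonglongrightarrow> Y $ j $ i" using assms(1) by (auto intro!: tendsto_intros)
  qed
  then show ?thesis by (simp add: sym_matrix_def transpose_def vec_eq_iff)
qed

section \<open>Passage to the limit\<close>

lemma LIMSEQ_if_dist_less_inverse:
  fixes f :: "nat \<Rightarrow> 'a::metric_space"
  assumes "\<And>k. dist (f k) l < c / real (Suc k)"
  shows "f \<longlonglongrightarrow> l"
proof -
  have "(\<lambda>k. c / real (Suc k)) \<longlonglongrightarrow> 0" using LIMSEQ_Suc[OF lim_const_over_n[of c]] by simp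
  moreover have "norm (dist (f k) l) \<le> c / real (Suc k)" for k using less_imp_le[OF assms[of k]] by simp
  then have "eventually (\<lambda>k. norm (dist (f k) l) \<le> c / real (Suc k)) sequentially" by (intro always_eventually allI)
  ultimately have "(\<lambda>k. dist (f k) l) \<longlonglongrightarrow> 0" by (rule Lim_null_comparison[rotated])
  then show ?thesis by (rule tendsto_dist_iff[THEN iffD2])
qed

lemma superjet_closureI:
  assumes "\<And>k. (t k, x k) \<in> S" "\<And>k. (c k, q k, X k) \<in> superjet S u (t k, x k)" "sym_matrix Y"
    and "t \<longlonglongrightarrow> s" "x \<longlonglongrightarrow> z" "(\<lambda>k. u (t k, x k)) \<longlonglongrightarrow> u (s, z)" "c \<longlonglongrightarrow> d" "q \<longlonglongrightarrow> p" "X \<longlonglongrightarrow> Y"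
  shows "(d, p, Y) \<in> superjet_closure S u (s, z)"
proof -
  have "(\<lambda>k. (t k, x k, u (t k, x k), c k, q k, X k)) \<longlonglongrightarrow> (s, z, u (s, z), d, p, Y)"
    using assms by (intro tendsto_Pair)
  then show ?thesis using assms(1-3) unfolding superjet_closure_def by blast
qed

theorem theorem4:
  fixes T :: real
    and u1 u2 :: "real \<times> (real ^ 'n) \<Rightarrow> real"
    and w :: "real \<times> (real ^ ('n + 'n)) \<Rightarrow> real"
    and z p :: "real ^ ('n + 'n)"
    and b :: real
    and A :: "real ^ ('n + 'n) ^ ('n + 'n)"
  assumes "T > 0"
    and "usc_on (open_strip T) u1" and "usc_on (open_strip T) u2"
    and "\<And>x. \<bar>terminal_limsup T u1 x\<bar> \<noteq> \<infinity>"
    and "\<And>x. \<bar>terminal_limsup T u2 x\<bar> \<noteq> \<infinity>"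
    and "w = (\<lambda>(t, x). terminal_ext T u1 (t, vfst x) + terminal_ext T u2 (t, vsnd x))"
    and "sym_matrix A"
    and "(b, p, A) \<in> superjet (closed_strip T) w (T, z)"
    and "\<exists>r>0. \<forall>M>0. \<exists>C.
           (\<forall>t x b1 q X. t \<in> {0<..<T} \<longrightarrow>
              (b1, q, X) \<in> superjet (open_strip T) u1 (t, x) \<longrightarrow>
              norm (x - vfst z) + \<bar>T - t\<bar> < r \<longrightarrow>
              \<bar>u1 (t, x)\<bar> + norm q + opnorm X \<le> M \<longrightarrow> b1 \<le> C) \<and>
           (\<forall>t x b2 q X. t \<in> {0<..<T} \<longrightarrow>
              (b2, q, X) \<in> superjet (open_strip T) u2 (t, x) \<longrightarrow>
              norm (x - vsnd z) + \<bar>T - t\<bar> < r \<longrightarrow>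
              \<bar>u2 (t, x)\<bar> + norm q + opnorm X \<le> M \<longrightarrow> b2 \<le> C)"
  shows "\<forall>\<epsilon>>0. \<exists>b1 b2 X1 X2.
           sym_matrix X1 \<and> sym_matrix X2 \<and>
           (b1, vfst p, X1) \<in> superjet_closure (closed_strip T) (terminal_ext T u1) (T, vfst z) \<and>
           (b2, vsnd p, X2) \<in> superjet_closure (closed_strip T) (terminal_ext T u2) (T, vsnd z) \<and>
           - ((1 / \<epsilon> + opnorm A) *\<^sub>R mat 1) \<preceq> block_diag X1 X2 \<and>
           block_diag X1 X2 \<preceq> A + \<epsilon> *\<^sub>R (A ** A) \<and>
           b1 + b2 \<ge> b"
proof (intro allI impI)
  fix \<epsilon> :: real assume \<epsilon>: "\<epsilon> > 0"
  define U1 where "U1 = terminal_ext T u1"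
  define U2 where "U2 = terminal_ext T u2"
  define z1 where "z1 = vfst z"
  define z2 where "z2 = vsnd z"
  define L where "L = opnorm A"
  have Abl: "bounded_linear ((*v) A)" by (rule matrix_vector_mul_bounded_linear)
  have L: "L \<ge> 0" "norm (A *v x) \<le> L * norm x" for x
    unfolding L_def using onorm[OF Abl] onorm_pos_le[OF Abl] by auto
  define Ap where "Ap = (\<lambda>h. (vfst (A *v vjoin (fst h) (snd h)), vsnd (A *v vjoin (fst h) (snd h))))"
  have "linear Ap"
  proof (rule linearI)
    show "Ap (x + y) = Ap x + Ap y" for x y
      using linear_add[OF linear_vjoin, of x y]
      by (simp add: Ap_def matrix_vector_right_distrib linear_add[OF linear_vfst] linear_add[OF linear_vsnd])
    show "Ap (c *\<^sub>R x) = c *\<^sub>R Ap x" for c x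
      using linear_cmul[OF linear_vjoin, of c x]
      by (simp add: Ap_def matrix_vector_mult_scaleR linear_cmul[OF linear_vfst] linear_cmul[OF linear_vsnd])
  qed
  then have Apl: "bounded_linear Ap" by (simp add: linear_conv_bounded_linear)
  have Ap: "Ap (vfst x, vsnd x) = (vfst (A *v x), vsnd (A *v x))" for x by (simp add: Ap_def)
  have pair: "\<exists>x'. h = (vfst x', vsnd x')" for h :: "(real ^ 'n) \<times> (real ^ 'n)"
    by (intro exI[of _ "vjoin (fst h) (snd h)"]) simp
  have Aps: "Ap x \<bullet> y = x \<bullet> Ap y" for x y
  proof -
    obtain x' y' where "x = (vfst x', vsnd x')" "y = (vfst y', vsnd y')" using pair by metis
    then show ?thesis using sym_matrix_inner[OF assms(7), of x' y'] by (simp only: Ap inner_pair_halves)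
  qed
  have ApL: "norm (Ap h) \<le> L * norm h" for h
  proof -
    obtain x where "h = (vfst x, vsnd x)" using pair by metis
    then show ?thesis using L(2)[of x] by (simp only: Ap norm_pair_halves)
  qed
  have jet: "parabolic_jet (closed_strip T) w T z b p ((*v) A)"
    using assms(8) by (simp add: superjet_iff_parabolic_jet)
  have loc: "\<exists>r>0. \<forall>t x1 x2. 0 < t \<longrightarrow> T - r \<le> t \<longrightarrow> t \<le> T \<longrightarrow> norm (x1 - z1) \<le> r \<longrightarrow> norm (x2 - z2) \<le> r \<longrightarrow>
       U1 (t,x1) + U2 (t,x2) \<le> U1 (T,z1) + U2 (T,z2) + b * (t - T) + vfst p \<bullet> (x1 - z1) + vsnd p \<bullet> (x2 - z2)
         + 1/2 * (Ap (x1 - z1, x2 - z2) \<bullet> (x1 - z1, x2 - z2)) + \<sigma> * ((T - t) + (norm (x1 - z1, x2 - z2))\<^sup>2)"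
    if \<sigma>: "\<sigma> > 0" for \<sigma>
  proof -
    obtain d where d: "d > 0" "\<And>t x. (t,x) \<in> closed_strip T \<Longrightarrow> \<bar>t - T\<bar> < d \<Longrightarrow> norm (x - z) < d \<Longrightarrow>
       w (t,x) \<le> w (T,z) + b * (t - T) + p \<bullet> (x - z) + 1/2 * ((A *v (x - z)) \<bullet> (x - z)) + \<sigma> * (\<bar>t - T\<bar> + (norm (x - z))\<^sup>2)"
      using jet \<sigma> unfolding parabolic_jet_def by blast
    show ?thesis
    proof (intro exI[of _ "d/3"] conjI allI impI)
      show "d/3 > 0" using d(1) by simp
      fix t x1 x2 assume t: "0 < t" "T - d/3 \<le> t" "t \<le> T" and x: "norm (x1 - z1) \<le> d/3" "norm (x2 - z2) \<le> d/3"
      define x where "x = vjoin x1 x2"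
      have h: "(x1 - z1, x2 - z2) = (vfst (x - z), vsnd (x - z))"
        by (simp add: x_def z1_def z2_def linear_diff[OF linear_vfst] linear_diff[OF linear_vsnd])
      have "norm (x - z) \<le> norm (x1 - z1) + norm (x2 - z2)"
        using norm_Pair_le[of "x1 - z1" "x2 - z2"] unfolding h norm_pair_halves .
      then have "norm (x - z) < d" using x d(1) by linarith
      moreover have "\<bar>t - T\<bar> < d" using t d(1) by linarith
      ultimately have "w (t,x) \<le> w (T,z) + b * (t - T) + p \<bullet> (x - z) + 1/2 * ((A *v (x - z)) \<bullet> (x - z)) + \<sigma> * (\<bar>t - T\<bar> + (norm (x - z))\<^sup>2)"
        using t by (intro d(2)) auto
      moreover have "w (t,x) = U1 (t,x1) + U2 (t,x2)" "w (T,z) = U1 (T,z1) + U2 (T,z2)"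
        by (simp_all add: assms(6) U1_def U2_def x_def z1_def z2_def)
      moreover have "p \<bullet> (x - z) = vfst p \<bullet> (x1 - z1) + vsnd p \<bullet> (x2 - z2)"
        using h by (simp add: inner_halves[of p])
      moreover have "\<bar>t - T\<bar> = T - t" using t by simp
      ultimately show "U1 (t,x1) + U2 (t,x2) \<le> U1 (T,z1) + U2 (T,z2) + b * (t - T) + vfst p \<bullet> (x1 - z1) + vsnd p \<bullet> (x2 - z2)
         + 1/2 * (Ap (x1 - z1, x2 - z2) \<bullet> (x1 - z1, x2 - z2)) + \<sigma> * ((T - t) + (norm (x1 - z1, x2 - z2))\<^sup>2)"
        unfolding h Ap inner_pair_halves norm_pair_halves by (simp only: add.assoc)
    qed
  qed
  note usc1 = upper_semicont_terminal_ext[OF assms(2,4), folded U1_def]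
  note usc2 = upper_semicont_terminal_ext[OF assms(3,5), folded U2_def]
  note app1 = terminal_ext_approached[OF assms(4)[of z1], folded U1_def]
  note app2 = terminal_ext_approached[OF assms(5)[of z2], folded U2_def]
  note approx = parabolic_theorem_on_sums_approx[OF assms(1) usc1 usc2 app1 app2 Apl Aps ApL L(1) loc \<epsilon>]
  obtain r where r: "r > 0" "\<And>M. M > 0 \<Longrightarrow> \<exists>C.
           (\<forall>t x b1 q X. t \<in> {0<..<T} \<longrightarrow>
              (b1, q, X) \<in> superjet (open_strip T) u1 (t, x) \<longrightarrow>
              norm (x - z1) + \<bar>T - t\<bar> < r \<longrightarrow>
              \<bar>u1 (t, x)\<bar> + norm q + opnorm X \<le> M \<longrightarrow> b1 \<le> C) \<and>
           (\<forall>t x b2 q X. t \<in> {0<..<T} \<longrightarrow>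
              (b2, q, X) \<in> superjet (open_strip T) u2 (t, x) \<longrightarrow>
              norm (x - z2) + \<bar>T - t\<bar> < r \<longrightarrow>
              \<bar>u2 (t, x)\<bar> + norm q + opnorm X \<le> M \<longrightarrow> b2 \<le> C)"
    using assms(9) unfolding z1_def z2_def by blast
  \<comment> \<open>keeps all approximating points in the neighbourhood where the time derivatives are bounded above\<close>
  define \<kappa>0 where "\<kappa>0 = min 1 (r/4)"
  define \<kappa> where "\<kappa> = (\<lambda>k::nat. \<kappa>0 / real (Suc k))"
  have \<kappa>0: "\<kappa>0 > 0" "\<kappa>0 \<le> 1" "\<kappa>0 \<le> r/4" using r(1) by (auto simp: \<kappa>0_def)
  have \<kappa>: "\<kappa> k > 0" "\<kappa> k \<le> \<kappa>0" for k
    using \<kappa>0(1) by (auto simp: \<kappa>_def field_simps)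
  have \<kappa>lim: "\<kappa> \<longlonglongrightarrow> 0" unfolding \<kappa>_def using LIMSEQ_Suc[OF lim_const_over_n[of \<kappa>0]] by simp
  define Pr where "Pr = (\<lambda>k t1 x1 t2 x2 b1 b2 q1 q2 M1 M2. (0 < t1 \<and> t1 < T \<and> 0 < t2 \<and> t2 < T) \<and>
     (dist t1 T < \<kappa> k \<and> dist t2 T < \<kappa> k \<and> dist x1 z1 < \<kappa> k \<and> dist x2 z2 < \<kappa> k) \<and>
     (dist (U1 (t1,x1)) (U1 (T,z1)) < \<kappa> k \<and> dist (U2 (t2,x2)) (U2 (T,z2)) < \<kappa> k) \<and>
     (dist q1 (vfst p) < \<kappa> k \<and> dist q2 (vsnd p) < \<kappa> k) \<and> b - \<kappa> k \<le> b1 + b2 \<and>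
     (parabolic_jet (open_strip T) U1 t1 x1 b1 q1 ((*v) M1) \<and> parabolic_jet (open_strip T) U2 t2 x2 b2 q2 ((*v) M2)) \<and>
     (sym_matrix M1 \<and> sym_matrix M2) \<and>
     (\<forall>h1 h2. (M1 *v h1) \<bullet> h1 + (M2 *v h2) \<bullet> h2 \<le> Ap (h1,h2) \<bullet> (h1,h2) + \<epsilon> * (norm (Ap (h1,h2)))\<^sup>2 + \<kappa> k * (norm (h1,h2))\<^sup>2) \<and>
     (\<forall>h. - (1 / \<epsilon> + L + \<kappa> k) * (norm h)\<^sup>2 \<le> (M1 *v h) \<bullet> h) \<and> (\<forall>h. - (1 / \<epsilon> + L + \<kappa> k) * (norm h)\<^sup>2 \<le> (M2 *v h) \<bullet> h))"
  have "\<exists>t1 x1 t2 x2 b1 b2 q1 q2 M1 M2. Pr k t1 x1 t2 x2 b1 b2 q1 q2 M1 M2" for k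
  proof -
    obtain t1 x1 t2 x2 b1 b2 q1 q2 X1 X2 where *: "0 < t1" "t1 < T" "0 < t2" "t2 < T" "T - t1 < \<kappa> k" "T - t2 < \<kappa> k"
     "norm (x1 - z1) < \<kappa> k" "norm (x2 - z2) < \<kappa> k"
     "\<bar>U1 (t1,x1) - U1 (T,z1)\<bar> < \<kappa> k" "\<bar>U2 (t2,x2) - U2 (T,z2)\<bar> < \<kappa> k"
     "norm (q1 - vfst p) < \<kappa> k" "norm (q2 - vsnd p) < \<kappa> k" "b - \<kappa> k \<le> b1 + b2"
     "parabolic_jet (open_strip T) U1 t1 x1 b1 q1 X1" "parabolic_jet (open_strip T) U2 t2 x2 b2 q2 X2"
     "bounded_linear X1" "bounded_linear X2"
     "\<forall>h1 h2. X1 h1 \<bullet> h1 + X2 h2 \<bullet> h2 \<le> Ap (h1,h2) \<bullet> (h1,h2) + \<epsilon> * (norm (Ap (h1,h2)))\<^sup>2 + \<kappa> k * (norm (h1,h2))\<^sup>2"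
     "\<forall>h. - (1 / \<epsilon> + L + \<kappa> k) * (norm h)\<^sup>2 \<le> X1 h \<bullet> h" "\<forall>h. - (1 / \<epsilon> + L + \<kappa> k) * (norm h)\<^sup>2 \<le> X2 h \<bullet> h"
      using approx[OF _ _ _ \<kappa>(1)[of k]] by blast
    obtain M1 where M1: "sym_matrix M1" "\<And>h. (M1 *v h) \<bullet> h = X1 h \<bullet> h"
      using linear_map_symmetric_matrix[OF bounded_linear.linear[OF *(16)]] by blast
    obtain M2 where M2: "sym_matrix M2" "\<And>h. (M2 *v h) \<bullet> h = X2 h \<bullet> h"
      using linear_map_symmetric_matrix[OF bounded_linear.linear[OF *(17)]] by blast
    have "parabolic_jet (open_strip T) U1 t1 x1 b1 q1 ((*v) M1)" "parabolic_jet (open_strip T) U2 t2 x2 b2 q2 ((*v) M2)"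
      using parabolic_jet_cong_form[OF *(14)] parabolic_jet_cong_form[OF *(15)] M1(2) M2(2) by metis+
    moreover have "dist t1 T < \<kappa> k" "dist t2 T < \<kappa> k" using *(1-6) by (simp_all add: dist_real_def)
    ultimately have "Pr k t1 x1 t2 x2 b1 b2 q1 q2 M1 M2"
      unfolding Pr_def M1(2) M2(2) dist_norm[of x1] dist_norm[of x2] dist_norm[of q1] dist_norm[of q2]
        dist_real_def[of "U1 _"] dist_real_def[of "U2 _"]
      using * M1(1) M2(1) by blast
    then show ?thesis by blast
  qed
  then obtain t1 x1 t2 x2 b1 b2 q1 q2 M1 M2 where
    Pr: "\<And>k. Pr k (t1 k) (x1 k) (t2 k) (x2 k) (b1 k) (b2 k) (q1 k) (q2 k) (M1 k) (M2 k)"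
    by metis
  have tk: "0 < t1 k" "t1 k < T" "0 < t2 k" "t2 k < T" for k using Pr[of k] unfolding Pr_def by blast+
  have near: "dist (t1 k) T < \<kappa> k" "dist (t2 k) T < \<kappa> k" "dist (x1 k) z1 < \<kappa> k" "dist (x2 k) z2 < \<kappa> k"
    "dist (U1 (t1 k, x1 k)) (U1 (T,z1)) < \<kappa> k" "dist (U2 (t2 k, x2 k)) (U2 (T,z2)) < \<kappa> k"
    "dist (q1 k) (vfst p) < \<kappa> k" "dist (q2 k) (vsnd p) < \<kappa> k" for k
    using Pr[of k] unfolding Pr_def by blast+
  have bk: "b - \<kappa> k \<le> b1 k + b2 k" for k using Pr[of k] unfolding Pr_def by blast
  have jk: "parabolic_jet (open_strip T) U1 (t1 k) (x1 k) (b1 k) (q1 k) ((*v) (M1 k))"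
    "parabolic_jet (open_strip T) U2 (t2 k) (x2 k) (b2 k) (q2 k) ((*v) (M2 k))" for k
    using Pr[of k] unfolding Pr_def by blast+
  have Ms: "sym_matrix (M1 k)" "sym_matrix (M2 k)" for k using Pr[of k] unfolding Pr_def by blast+
  have Mup: "(M1 k *v h1) \<bullet> h1 + (M2 k *v h2) \<bullet> h2 \<le> Ap (h1,h2) \<bullet> (h1,h2) + \<epsilon> * (norm (Ap (h1,h2)))\<^sup>2 + \<kappa> k * (norm (h1,h2))\<^sup>2" for k h1 h2
    using Pr[of k] unfolding Pr_def by blast
  have Mlo: "- (1 / \<epsilon> + L + \<kappa> k) * (norm h)\<^sup>2 \<le> (M1 k *v h) \<bullet> h" "- (1 / \<epsilon> + L + \<kappa> k) * (norm h)\<^sup>2 \<le> (M2 k *v h) \<bullet> h" for k h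
    using Pr[of k] unfolding Pr_def by blast+
  have open_jet: "(c, q, M) \<in> superjet (open_strip T) u (t, x)"
    if "parabolic_jet (open_strip T) (terminal_ext T u) t x c q ((*v) M)" "t < T" "sym_matrix M" for c q M t x and u :: "real \<times> (real ^ 'n) \<Rightarrow> real"
  proof -
    have "parabolic_jet (open_strip T) u t x c q ((*v) M)"
      by (rule parabolic_jet_transfer[OF that(1), of 1]) (use that(2) in \<open>auto simp: terminal_ext_below\<close>)
    then show ?thesis using that(3) by (simp add: superjet_iff_parabolic_jet)
  qed
  have closed_jet: "(c, q, M) \<in> superjet (closed_strip T) U (t, x)"
    if "parabolic_jet (open_strip T) U t x c q ((*v) M)" "t < T" "sym_matrix M" for c q M t x and U :: "real \<times> (real ^ 'n) \<Rightarrow> real"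
  proof -
    have "parabolic_jet (closed_strip T) U t x c q ((*v) M)"
      by (rule parabolic_jet_transfer[OF that(1), of "T - t"]) (use that(2) in auto)
    then show ?thesis using that(3) by (simp add: superjet_iff_parabolic_jet)
  qed
  define CX where "CX = 1 / \<epsilon> + L + \<epsilon> * L\<^sup>2 + 1"
  have up1: "Ap h \<bullet> h + \<epsilon> * (norm (Ap h))\<^sup>2 + \<kappa> k * (norm h)\<^sup>2 \<le> CX * (norm h)\<^sup>2" for h k
  proof -
    have "Ap h \<bullet> h \<le> L * (norm h)\<^sup>2"
      using norm_cauchy_schwarz[of "Ap h" h] mult_right_mono[OF ApL[of h], of "norm h"] by (simp add: power2_eq_square)
    moreover have "(norm (Ap h))\<^sup>2 \<le> L\<^sup>2 * (norm h)\<^sup>2"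
      using power_mono[OF ApL[of h], of 2] by (simp add: power_mult_distrib)
    then have "\<epsilon> * (norm (Ap h))\<^sup>2 \<le> \<epsilon> * (L\<^sup>2 * (norm h)\<^sup>2)" using \<epsilon> by (intro mult_left_mono) auto
    moreover have "\<kappa> k * (norm h)\<^sup>2 \<le> 1 * (norm h)\<^sup>2" using \<kappa>(2)[of k] \<kappa>0(2) by (intro mult_right_mono) auto
    moreover have "0 \<le> 1 / \<epsilon> * (norm h)\<^sup>2" using \<epsilon> by simp
    ultimately show ?thesis unfolding CX_def distrib_right by (simp only: mult.assoc)
  qed
  have lo1: "- CX * (norm h)\<^sup>2 \<le> - (1 / \<epsilon> + L + \<kappa> k) * (norm h)\<^sup>2" for k and h :: "real ^ 'n"
  proof (rule mult_right_mono)
    have "0 \<le> \<epsilon> * L\<^sup>2" using \<epsilon> by simp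
    then show "- CX \<le> - (1 / \<epsilon> + L + \<kappa> k)" using \<kappa>(2)[of k] \<kappa>0(2) unfolding CX_def by linarith
  qed simp
  have form: "\<bar>(M1 k *v h) \<bullet> h\<bar> \<le> CX * (norm h)\<^sup>2" "\<bar>(M2 k *v h) \<bullet> h\<bar> \<le> CX * (norm h)\<^sup>2" for k h
  proof -
    have "(M1 k *v h) \<bullet> h \<le> CX * (norm h)\<^sup>2" using order_trans[OF Mup[of k h 0] up1] by simp
    then show "\<bar>(M1 k *v h) \<bullet> h\<bar> \<le> CX * (norm h)\<^sup>2" using order_trans[OF lo1 Mlo(1)] by (simp add: abs_le_iff minus_le_iff)
    have "(M2 k *v h) \<bullet> h \<le> CX * (norm h)\<^sup>2" using order_trans[OF Mup[of k 0 h] up1] by simp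
    then show "\<bar>(M2 k *v h) \<bullet> h\<bar> \<le> CX * (norm h)\<^sup>2" using order_trans[OF lo1 Mlo(2)] by (simp add: abs_le_iff minus_le_iff)
  qed
  have Mn: "norm (M1 k *v h) \<le> CX * norm h" "norm (M2 k *v h) \<le> CX * norm h" for k h
    using sym_matrix_norm_le[OF Ms(1) form(1)] sym_matrix_norm_le[OF Ms(2) form(2)] by auto
  have op: "opnorm (M1 k) \<le> CX" "opnorm (M2 k) \<le> CX" for k by (rule onorm_le, rule Mn)+
  have CX: "CX \<ge> 0" using \<epsilon> L(1) by (simp add: CX_def add_nonneg_nonneg)
  define M where "M = \<bar>U1 (T,z1)\<bar> + \<bar>U2 (T,z2)\<bar> + norm p + 2 + CX"
  have M: "M > 0" using CX unfolding M_def by (smt (verit) norm_ge_zero)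
  have np: "norm (vfst p) \<le> norm p" "norm (vsnd p) \<le> norm p"
    using norm_fst_le[of "vfst p" "vsnd p"] norm_snd_le[of "vsnd p" "vfst p"] unfolding norm_pair_halves by auto
  obtain C where C: "\<And>t x c q X. t \<in> {0<..<T} \<Longrightarrow> (c, q, X) \<in> superjet (open_strip T) u1 (t, x) \<Longrightarrow>
              norm (x - z1) + \<bar>T - t\<bar> < r \<Longrightarrow> \<bar>u1 (t, x)\<bar> + norm q + opnorm X \<le> M \<Longrightarrow> c \<le> C"
     "\<And>t x c q X. t \<in> {0<..<T} \<Longrightarrow> (c, q, X) \<in> superjet (open_strip T) u2 (t, x) \<Longrightarrow>
              norm (x - z2) + \<bar>T - t\<bar> < r \<Longrightarrow> \<bar>u2 (t, x)\<bar> + norm q + opnorm X \<le> M \<Longrightarrow> c \<le> C"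
    using r(2)[OF M] by blast
  have k1: "\<kappa> k \<le> 1" "2 * \<kappa> k < r" for k using \<kappa>(2)[of k] \<kappa>0 r(1) by auto
  have b1C: "b1 k \<le> C" for k
  proof (rule C(1))
    show "t1 k \<in> {0<..<T}" using tk by simp
    show "(b1 k, q1 k, M1 k) \<in> superjet (open_strip T) u1 (t1 k, x1 k)"
      by (rule open_jet[OF jk(1)[unfolded U1_def] tk(2) Ms(1)])
    show "norm (x1 k - z1) + \<bar>T - t1 k\<bar> < r"
      using near(1,3)[of k] k1(2)[of k] by (simp add: dist_norm abs_minus_commute)
    have "\<bar>u1 (t1 k, x1 k)\<bar> \<le> \<bar>U1 (T,z1)\<bar> + 1"
      using near(5)[of k] k1(1)[of k] tk(2)[of k] by (simp add: U1_def terminal_ext_below dist_real_def abs_if split: if_splits)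
    moreover have "norm (q1 k) \<le> norm p + 1"
      using near(7)[of k] k1(1)[of k] np(1) norm_triangle_ineq[of "q1 k - vfst p" "vfst p"] by (simp add: dist_norm)
    ultimately show "\<bar>u1 (t1 k, x1 k)\<bar> + norm (q1 k) + opnorm (M1 k) \<le> M"
      using op(1)[of k] abs_ge_zero[of "U2 (T,z2)"] unfolding M_def by linarith
  qed
  have b2C: "b2 k \<le> C" for k
  proof (rule C(2))
    show "t2 k \<in> {0<..<T}" using tk by simp
    show "(b2 k, q2 k, M2 k) \<in> superjet (open_strip T) u2 (t2 k, x2 k)"
      by (rule open_jet[OF jk(2)[unfolded U2_def] tk(4) Ms(2)])
    show "norm (x2 k - z2) + \<bar>T - t2 k\<bar> < r"
      using near(2,4)[of k] k1(2)[of k] by (simp add: dist_norm abs_minus_commute)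
    have "\<bar>u2 (t2 k, x2 k)\<bar> \<le> \<bar>U2 (T,z2)\<bar> + 1"
      using near(6)[of k] k1(1)[of k] tk(4)[of k] by (simp add: U2_def terminal_ext_below dist_real_def abs_if split: if_splits)
    moreover have "norm (q2 k) \<le> norm p + 1"
      using near(8)[of k] k1(1)[of k] np(2) norm_triangle_ineq[of "q2 k - vsnd p" "vsnd p"] by (simp add: dist_norm)
    ultimately show "\<bar>u2 (t2 k, x2 k)\<bar> + norm (q2 k) + opnorm (M2 k) \<le> M"
      using op(2)[of k] abs_ge_zero[of "U1 (T,z1)"] unfolding M_def by linarith
  qed
  \<comment> \<open>each time derivative is bounded below because the other one is bounded above\<close>
  have blo: "b1 k \<ge> b - 1 - C" "b2 k \<ge> b - 1 - C" for k
    using bk[of k] b1C[of k] b2C[of k] k1(1)[of k] by linarith+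
  define R where "R = real CARD('n) * (real CARD('n) * CX)"
  define S where "S = {b - 1 - C..C} \<times> {b - 1 - C..C} \<times> cball (0 :: real ^ 'n ^ 'n) R \<times> cball (0 :: real ^ 'n ^ 'n) R"
  define s where "s = (\<lambda>k. (b1 k, b2 k, M1 k, M2 k))"
  have "compact S" unfolding S_def by (intro compact_Times) auto
  moreover have "\<forall>k. s k \<in> S"
    using b1C b2C blo norm_matrix_le[OF Mn(1)] norm_matrix_le[OF Mn(2)] by (simp add: S_def R_def s_def)
  ultimately have "\<exists>l\<in>S. \<exists>\<phi>. strict_mono \<phi> \<and> (s \<circ> \<phi>) \<longlonglongrightarrow> l" unfolding compact_def by blast
  then obtain l \<phi> where \<phi>: "strict_mono \<phi>" "(s \<circ> \<phi>) \<longlonglongrightarrow> l" by blast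
  obtain \<beta>1 \<beta>2 X1 X2 where l: "l = (\<beta>1, \<beta>2, X1, X2)" by (metis prod.collapse)
  have lim: "(\<lambda>k. b1 (\<phi> k)) \<longlonglongrightarrow> \<beta>1" "(\<lambda>k. b2 (\<phi> k)) \<longlonglongrightarrow> \<beta>2" "(\<lambda>k. M1 (\<phi> k)) \<longlonglongrightarrow> X1" "(\<lambda>k. M2 (\<phi> k)) \<longlonglongrightarrow> X2"
    using tendsto_fst[OF \<phi>(2)] tendsto_fst[OF tendsto_snd[OF \<phi>(2)]]
      tendsto_fst[OF tendsto_snd[OF tendsto_snd[OF \<phi>(2)]]] tendsto_snd[OF tendsto_snd[OF tendsto_snd[OF \<phi>(2)]]]
    by (simp_all add: l o_def s_def)
  have sub: "(\<lambda>k. f (\<phi> k)) \<longlonglongrightarrow> y" if "\<And>k. dist (f k) y < \<kappa> k" for f :: "nat \<Rightarrow> 'z::metric_space" and y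
    using LIMSEQ_subseq_LIMSEQ[OF LIMSEQ_if_dist_less_inverse[OF that[unfolded \<kappa>_def]] \<phi>(1)] by (simp add: o_def)
  have \<kappa>\<phi>: "(\<lambda>k. \<kappa> (\<phi> k)) \<longlonglongrightarrow> 0" using LIMSEQ_subseq_LIMSEQ[OF \<kappa>lim \<phi>(1)] by (simp add: o_def)
  have Xs: "sym_matrix X1" "sym_matrix X2" using sym_matrix_limit[OF lim(3)] sym_matrix_limit[OF lim(4)] Ms by auto
  have "(\<beta>1, vfst p, X1) \<in> superjet_closure (closed_strip T) U1 (T, z1)"
  proof (rule superjet_closureI[OF _ _ Xs(1) sub[OF near(1)] sub[OF near(3)] sub[OF near(5)] lim(1) sub[OF near(7)] lim(3)])
    show "(t1 (\<phi> k), x1 (\<phi> k)) \<in> closed_strip T" for k using tk[of "\<phi> k"] by simp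
    show "(b1 (\<phi> k), q1 (\<phi> k), M1 (\<phi> k)) \<in> superjet (closed_strip T) U1 (t1 (\<phi> k), x1 (\<phi> k))" for k
      by (rule closed_jet[OF jk(1) tk(2) Ms(1)])
  qed
  moreover have "(\<beta>2, vsnd p, X2) \<in> superjet_closure (closed_strip T) U2 (T, z2)"
  proof (rule superjet_closureI[OF _ _ Xs(2) sub[OF near(2)] sub[OF near(4)] sub[OF near(6)] lim(2) sub[OF near(8)] lim(4)])
    show "(t2 (\<phi> k), x2 (\<phi> k)) \<in> closed_strip T" for k using tk[of "\<phi> k"] by simp
    show "(b2 (\<phi> k), q2 (\<phi> k), M2 (\<phi> k)) \<in> superjet (closed_strip T) U2 (t2 (\<phi> k), x2 (\<phi> k))" for k
      by (rule closed_jet[OF jk(2) tk(4) Ms(2)])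
  qed
  moreover have "b \<le> \<beta>1 + \<beta>2"
  proof (rule LIMSEQ_le)
    show "(\<lambda>k. b - \<kappa> (\<phi> k)) \<longlonglongrightarrow> b" using tendsto_diff[OF tendsto_const \<kappa>\<phi>, of b] by simp
    show "(\<lambda>k. b1 (\<phi> k) + b2 (\<phi> k)) \<longlonglongrightarrow> \<beta>1 + \<beta>2" by (intro tendsto_add lim)
  qed (use bk in blast)
  moreover have "block_diag X1 X2 \<preceq> A + \<epsilon> *\<^sub>R (A ** A)"
    unfolding loewner_le_def
  proof
    fix \<xi>
    have "(X1 *v vfst \<xi>) \<bullet> vfst \<xi> + (X2 *v vsnd \<xi>) \<bullet> vsnd \<xi> \<le> (A *v \<xi>) \<bullet> \<xi> + \<epsilon> * (norm (A *v \<xi>))\<^sup>2 + 0 * (norm \<xi>)\<^sup>2"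
    proof (rule LIMSEQ_le)
      show "(\<lambda>k. (M1 (\<phi> k) *v vfst \<xi>) \<bullet> vfst \<xi> + (M2 (\<phi> k) *v vsnd \<xi>) \<bullet> vsnd \<xi>)
          \<longlonglongrightarrow> (X1 *v vfst \<xi>) \<bullet> vfst \<xi> + (X2 *v vsnd \<xi>) \<bullet> vsnd \<xi>"
        by (intro tendsto_add tendsto_matrix_form lim)
      show "(\<lambda>k. (A *v \<xi>) \<bullet> \<xi> + \<epsilon> * (norm (A *v \<xi>))\<^sup>2 + \<kappa> (\<phi> k) * (norm \<xi>)\<^sup>2)
          \<longlonglongrightarrow> (A *v \<xi>) \<bullet> \<xi> + \<epsilon> * (norm (A *v \<xi>))\<^sup>2 + 0 * (norm \<xi>)\<^sup>2"
        by (intro tendsto_intros \<kappa>\<phi>)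
      show "\<exists>N. \<forall>k\<ge>N. (M1 (\<phi> k) *v vfst \<xi>) \<bullet> vfst \<xi> + (M2 (\<phi> k) *v vsnd \<xi>) \<bullet> vsnd \<xi>
          \<le> (A *v \<xi>) \<bullet> \<xi> + \<epsilon> * (norm (A *v \<xi>))\<^sup>2 + \<kappa> (\<phi> k) * (norm \<xi>)\<^sup>2"
        using Mup[of _ "vfst \<xi>" "vsnd \<xi>"] unfolding Ap inner_pair_halves norm_pair_halves by blast
    qed
    moreover have "((A + \<epsilon> *\<^sub>R (A ** A)) *v \<xi>) \<bullet> \<xi> = (A *v \<xi>) \<bullet> \<xi> + \<epsilon> * (norm (A *v \<xi>))\<^sup>2"
      using sym_matrix_inner[OF assms(7), of "A *v \<xi>" \<xi>]
      by (simp add: matrix_vector_mult_add_rdistrib scaleR_matrix_vector_assoc[symmetric] matrix_vector_mul_assoc[symmetric]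
          inner_add_left power2_norm_eq_inner)
    ultimately show "(block_diag X1 X2 *v \<xi>) \<bullet> \<xi> \<le> ((A + \<epsilon> *\<^sub>R (A ** A)) *v \<xi>) \<bullet> \<xi>"
      by (simp add: inner_block_diag)
  qed
  moreover have "- ((1 / \<epsilon> + opnorm A) *\<^sub>R mat 1) \<preceq> block_diag X1 X2"
    unfolding loewner_le_def
  proof
    fix \<xi> :: "real ^ ('n + 'n)"
    have lo: "- (1 / \<epsilon> + L) * (norm h)\<^sup>2 \<le> (X *v h) \<bullet> h"
      if "(\<lambda>k. N (\<phi> k)) \<longlonglongrightarrow> X" "\<And>k. - (1 / \<epsilon> + L + \<kappa> k) * (norm h)\<^sup>2 \<le> (N k *v h) \<bullet> h" for N X and h :: "real ^ 'n"
    proof (rule LIMSEQ_le)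
      have "(\<lambda>k. - (1 / \<epsilon> + L + \<kappa> (\<phi> k)) * (norm h)\<^sup>2) \<longlonglongrightarrow> - (1 / \<epsilon> + L + 0) * (norm h)\<^sup>2"
        by (intro tendsto_intros \<kappa>\<phi>)
      then show "(\<lambda>k. - (1 / \<epsilon> + L + \<kappa> (\<phi> k)) * (norm h)\<^sup>2) \<longlonglongrightarrow> - (1 / \<epsilon> + L) * (norm h)\<^sup>2" by simp
      show "(\<lambda>k. (N (\<phi> k) *v h) \<bullet> h) \<longlonglongrightarrow> (X *v h) \<bullet> h" by (rule tendsto_matrix_form[OF that(1)])
    qed (use that(2) in blast)
    have "(norm \<xi>)\<^sup>2 = (norm (vfst \<xi>))\<^sup>2 + (norm (vsnd \<xi>))\<^sup>2"
      by (simp add: power2_norm_eq_inner inner_halves[of \<xi> \<xi>])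
    then have "- (1 / \<epsilon> + L) * (norm \<xi>)\<^sup>2 = - (1 / \<epsilon> + L) * (norm (vfst \<xi>))\<^sup>2 + - (1 / \<epsilon> + L) * (norm (vsnd \<xi>))\<^sup>2"
      by (simp only: distrib_left)
    also have "\<dots> \<le> (X1 *v vfst \<xi>) \<bullet> vfst \<xi> + (X2 *v vsnd \<xi>) \<bullet> vsnd \<xi>"
      by (intro add_mono lo[OF lim(3) Mlo(1)] lo[OF lim(4) Mlo(2)])
    finally have "- (1 / \<epsilon> + L) * (norm \<xi>)\<^sup>2 \<le> (block_diag X1 X2 *v \<xi>) \<bullet> \<xi>" by (simp only: inner_block_diag)
    moreover have "(- ((1 / \<epsilon> + opnorm A) *\<^sub>R mat 1) *v \<xi>) \<bullet> \<xi> = - (1 / \<epsilon> + L) * (norm \<xi>)\<^sup>2"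
    proof -
      have "- ((1 / \<epsilon> + opnorm A) *\<^sub>R mat 1) = (- (1 / \<epsilon> + L)) *\<^sub>R (mat 1 :: real ^ ('n + 'n) ^ ('n + 'n))"
        by (simp only: L_def scaleR_minus_left)
      then have "- ((1 / \<epsilon> + opnorm A) *\<^sub>R mat 1) *v \<xi> = (- (1 / \<epsilon> + L)) *\<^sub>R \<xi>"
        by (simp only: scaleR_matrix_vector_assoc[symmetric] matrix_vector_mul_lid)
      then show ?thesis by (simp only: inner_scaleR_left power2_norm_eq_inner)
    qed
    ultimately show "(- ((1 / \<epsilon> + opnorm A) *\<^sub>R mat 1) *v \<xi>) \<bullet> \<xi> \<le> (block_diag X1 X2 *v \<xi>) \<bullet> \<xi>" by simp
  qed
  ultimately show "\<exists>b1 b2 X1 X2.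
           sym_matrix X1 \<and> sym_matrix X2 \<and>
           (b1, vfst p, X1) \<in> superjet_closure (closed_strip T) (terminal_ext T u1) (T, vfst z) \<and>
           (b2, vsnd p, X2) \<in> superjet_closure (closed_strip T) (terminal_ext T u2) (T, vsnd z) \<and>
           - ((1 / \<epsilon> + opnorm A) *\<^sub>R mat 1) \<preceq> block_diag X1 X2 \<and>
           block_diag X1 X2 \<preceq> A + \<epsilon> *\<^sub>R (A ** A) \<and>
           b1 + b2 \<ge> b"
    using Xs unfolding U1_def U2_def z1_def z2_def by blast
qed

end
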